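(* Up to isomorphism there are exactly $46$ graphs that are $7$-vertex-critical and $(P_5,\text{gem})$-free, namely the following pairwise non-isomorphic graphs: $K_7$; $G_1(5,1,5,1,1)$, $G_1(5,1,4,2,1)$, $G_1(4,2,4,2,1)$, $G_1(5,1,3,3,1)$, $G_1(4,2,3,3,1)$, $G_1(3,3,3,3,1)$, $G_1(4,2,2,4,1)$, $G_1(4,2,3,2,2)$, $G_1(3,3,3,2,2)$, $G_1(3,3,2,3,2)$; $G_7(1,4,1,4,1,1,5,2)$, $G_7(1,3,2,4,1,1,5,2)$, $G_7(1,2,3,4,1,1,5,2)$, $G_7(1,1,4,4,1,1,5,2)$, $G_7(1,3,2,3,1,2,5,2)$, $G_7(1,2,3,3,1,2,5,2)$, $G_7(2,3,1,3,2,1,4,3)$, $G_7(2,2,2,3,2,1,4,3)$, $G_7(1,3,2,3,2,1,4,3)$, $G_7(2,1,3,3,2,1,4,3)$, $G_7(1,2,3,3,2,1,4,3)$, $G_7(1,1,4,3,2,1,4,3)$, $G_7(2,2,2,3,1,2,4,3)$, $G_7(2,1,3,3,1,2,4,3)$, $G_7(2,2,2,2,2,2,4,3)$, $G_7(1,2,3,2,2,2,4,3)$, $G_7(1,3,2,3,1,1,5,3)$, $G_7(1,2,3,3,1,1,5,3)$, $G_7(1,1,4,3,1,1,5,3)$, $G_7(1,3,2,2,1,2,5,3)$, $G_7(1,2,3,2,1,2,5,3)$, $G_7(1,1,3,3,1,2,5,3)$, $G_7(2,2,2,2,2,1,4,4)$, $G_7(2,1,3,2,2,1,4,4)$, $G_7(1,1,4,2,2,1,4,4)$,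 $G_7(2,2,2,2,1,2,4,4)$, $G_7(2,1,3,2,1,2,4,4)$, $G_7(1,1,3,2,2,2,4,4)$, $G_7(1,2,3,2,1,1,5,4)$, $G_7(1,1,4,2,1,1,5,4)$, $G_7(1,2,3,1,1,2,5,4)$, $G_7(1,2,2,2,1,2,5,4)$, $G_7(1,1,3,2,1,2,5,4)$, $G_7(1,1,4,1,1,1,5,5)$, $G_7(1,1,3,1,1,2,5,5)$.
   Context: All graphs are finite and simple. $\chi(G)$ denotes the chromatic number. A graph $G$ is $k$-vertex-critical if $\chi(G)=k$ and $\chi(G-v)<k$ for all $v\in V(G)$. $P_n$ is the path on $n$ vertices; the gem is $P_4$ plus a vertex adjacent to all four of its vertices. A graph is $(P_5,\text{gem})$-free if it contains neither $P_5$ nor the gem as an induced subgraph. $G_1$ is the $5$-cycle on $v_1,\dots,v_5$ with edges $v_1v_2,v_2v_3,v_3v_4,v_4v_5,v_5v_1$. $G_7$ is the graph on $v_1,\dots,v_8$ with edges $v_1v_2,v_1v_3,v_1v_4,v_1v_7,v_2v_3,v_2v_5,v_2v_8,v_3v_6,v_4v_5,v_4v_6,v_4v_8,v_5v_6,v_5v_7$. For positive integers $n_j$, $G_1(n_1,\dots,n_5)$ (respectively $G_7(n_1,\dots,n_8)$) denotes the clique expansion of $G_1$ (respectively $G_7$) in which each vertex $v_j$ is replaced by a clique $Q_j$ of order $n_j$, where the $Q_j$ are disjoint and, for $i\ne j$, every vertex of $Q_i$ is adjacent to every vertex of $Q_j$ if $v_iv_j$ is an edge, and there are no edges between $Q_i$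 and $Q_j$ otherwise. *)

theory Defs
  imports "Graph_Theory.Graph_Theory"
begin

text \<open>
  A finite simple graph is a \<^locale>\<open>pair_graph\<close>: an undirected edge is a pair of opposite arcs.
  The notions of colouring and induced subgraph below apply to all \<^type>\<open>pre_digraph\<close>s, so that
  they cover pair graphs (through the coercion \<^const>\<open>with_proj\<close>) and the results of
  \<^const>\<open>pre_digraph.del_vert\<close>.
\<close>

definition proper_colouring :: "('a, 'b) pre_digraph \<Rightarrow> nat \<Rightarrow> ('a \<Rightarrow> nat) \<Rightarrow> bool" where
  "proper_colouring G k c \<longleftrightarrow>
     (\<forall>v \<in> verts G. c v < k) \<and> (\<forall>u v. u \<rightarrow>\<^bsub>G\<^esub> v \<longrightarrow> c u \<noteq> c v)"

text \<open>Only meaningful for finite loopless graphs, where some proper colouring exists.\<close>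

definition chromatic_number :: "('a, 'b) pre_digraph \<Rightarrow> nat" where
  "chromatic_number G = (LEAST k. \<exists>c. proper_colouring G k c)"

definition vertex_critical :: "nat \<Rightarrow> ('a, 'b) pre_digraph \<Rightarrow> bool" where
  "vertex_critical k G \<longleftrightarrow>
     chromatic_number G = k \<and>
     (\<forall>v \<in> verts G. chromatic_number (pre_digraph.del_vert G v) < k)"

definition contains_induced :: "('a, 'b) pre_digraph \<Rightarrow> ('c, 'd) pre_digraph \<Rightarrow> bool" where
  "contains_induced G H \<longleftrightarrow> (\<exists>K. induced_subgraph K G \<and> digraph_iso H K)"

definition graph_of_edges :: "'a set \<Rightarrow> ('a \<times> 'a) set \<Rightarrow> 'a pair_pre_digraph" where
  "graph_of_edges V E = \<lparr> pverts = V, parcs = E \<union> E\<inverse> \<rparr>"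

definition path_graph :: "nat \<Rightarrow> nat pair_pre_digraph" where
  "path_graph n = graph_of_edges {1..n} {(i, i + 1) | i. 1 \<le> i \<and> i < n}"

text \<open>The vertices 1 to 4 form the path, and 5 is the additional vertex.\<close>

definition gem :: "nat pair_pre_digraph" where
  "gem = graph_of_edges {1..5} {(1,2), (2,3), (3,4), (5,1), (5,2), (5,3), (5,4)}"

definition P5_gem_free :: "('a, 'b) pre_digraph \<Rightarrow> bool" where
  "P5_gem_free G \<longleftrightarrow>
     \<not> contains_induced G (path_graph 5) \<and> \<not> contains_induced G gem"

definition G1 :: "nat pair_pre_digraph" where
  "G1 = graph_of_edges {1..5} {(1,2), (2,3), (3,4), (4,5), (5,1)}"

definition G7 :: "nat pair_pre_digraph" where
  "G7 = graph_of_edges {1..8}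
     {(1,2), (1,3), (1,4), (1,7), (2,3), (2,5), (2,8), (3,6), (4,5), (4,6), (4,8), (5,6), (5,7)}"

text \<open>The clique replacing the vertex \<open>v\<close> consists of the pairs \<open>(v, i)\<close> with \<open>i < n v\<close>.\<close>

definition clique_expansion ::
  "'a pair_pre_digraph \<Rightarrow> ('a \<Rightarrow> nat) \<Rightarrow> ('a \<times> nat) pair_pre_digraph" where
  "clique_expansion G n =
     (let V = (SIGMA v : pverts G. {..<n v}) in
      \<lparr> pverts = V,
        parcs = {((u, i), (v, j)) | u i v j. (u, i) \<in> V \<and> (v, j) \<in> V \<and>
                   (if u = v then i \<noteq> j else (u, v) \<in> parcs G)} \<rparr>)"

text \<open>Vertices are numbered from 1, while list positions are numbered from 0.\<close>

definition G1_expansion :: "nat list \<Rightarrow> (nat \<times> nat) pair_pre_digraph" where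
  "G1_expansion ns = clique_expansion G1 (\<lambda>v. ns ! (v - 1))"

definition G7_expansion :: "nat list \<Rightarrow> (nat \<times> nat) pair_pre_digraph" where
  "G7_expansion ns = clique_expansion G7 (\<lambda>v. ns ! (v - 1))"

definition complete_graph_on :: "'a set \<Rightarrow> 'a pair_pre_digraph" where
  "complete_graph_on V = \<lparr> pverts = V, parcs = {(u, v). u \<in> V \<and> v \<in> V \<and> u \<noteq> v} \<rparr>"

text \<open>
  The vertex set of $K_7$ is an arbitrary 7-element set, chosen so that $K_7$ has the same type as
  the clique expansions.
\<close>

definition critical_graphs :: "(nat \<times> nat) pair_pre_digraph list" where
  "critical_graphs =
     complete_graph_on ({0} \<times> {..<7}) #
     map G1_expansion
     [[5, 1, 5, 1, 1], [5, 1, 4, 2, 1], [4, 2, 4, 2, 1],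
      [5, 1, 3, 3, 1], [4, 2, 3, 3, 1], [3, 3, 3, 3, 1],
      [4, 2, 2, 4, 1], [4, 2, 3, 2, 2], [3, 3, 3, 2, 2],
      [3, 3, 2, 3, 2]] @
     map G7_expansion
     [[1, 4, 1, 4, 1, 1, 5, 2], [1, 3, 2, 4, 1, 1, 5, 2], [1, 2, 3, 4, 1, 1, 5, 2],
      [1, 1, 4, 4, 1, 1, 5, 2], [1, 3, 2, 3, 1, 2, 5, 2], [1, 2, 3, 3, 1, 2, 5, 2],
      [2, 3, 1, 3, 2, 1, 4, 3], [2, 2, 2, 3, 2, 1, 4, 3], [1, 3, 2, 3, 2, 1, 4, 3],
      [2, 1, 3, 3, 2, 1, 4, 3], [1, 2, 3, 3, 2, 1, 4, 3], [1, 1, 4, 3, 2, 1, 4, 3],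
      [2, 2, 2, 3, 1, 2, 4, 3], [2, 1, 3, 3, 1, 2, 4, 3], [2, 2, 2, 2, 2, 2, 4, 3],
      [1, 2, 3, 2, 2, 2, 4, 3], [1, 3, 2, 3, 1, 1, 5, 3], [1, 2, 3, 3, 1, 1, 5, 3],
      [1, 1, 4, 3, 1, 1, 5, 3], [1, 3, 2, 2, 1, 2, 5, 3], [1, 2, 3, 2, 1, 2, 5, 3],
      [1, 1, 3, 3, 1, 2, 5, 3], [2, 2, 2, 2, 2, 1, 4, 4], [2, 1, 3, 2, 2, 1, 4, 4],
      [1, 1, 4, 2, 2, 1, 4, 4], [2, 2, 2, 2, 1, 2, 4, 4], [2, 1, 3, 2, 1, 2, 4, 4],
      [1, 1, 3, 2, 2, 2, 4, 4], [1, 2, 3, 2, 1, 1, 5, 4], [1, 1, 4, 2, 1, 1, 5, 4],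
      [1, 2, 3, 1, 1, 2, 5, 4], [1, 2, 2, 2, 1, 2, 5, 4], [1, 1, 3, 2, 1, 2, 5, 4],
      [1, 1, 4, 1, 1, 1, 5, 5], [1, 1, 3, 1, 1, 2, 5, 5]]"

end

theory Submission
  imports Defs
begin

text \<open>
  Let \<open>G\<close> be critical, i.e. not \<open>q\<close>-colourable although all proper induced subgraphs are, with \<open>q = 6\<close>.

  First, a graph without induced \<open>P\<^sub>5\<close>, gem and \<open>C\<^sub>5\<close> is perfect. In a minimal counterexample
  homogeneous sets are cliques. Choose an inclusion-maximal component \<open>K\<close> of the non-neighbourhood of a
  vertex, let \<open>S\<close> be its set of attachments and \<open>W\<close> the remaining vertices. Maximality makes \<open>W\<close> complete to
  \<open>S\<close>, hence homogeneous, hence a clique, and the components of \<open>S\<close> turn out to be cliques. Kempe changes in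
  \<open>S \<union> K\<close> push all colours of \<open>S\<close> into those of its largest component; a Kempe chain obstructing this
  contains an induced \<open>C\<^sub>5\<close> through \<open>W\<close>. Now \<open>W\<close> can be coloured.

  So in a gem-free critical graph homogeneous sets that have a common neighbour are cliques, and a
  critical graph that is not complete contains \<open>C\<^sub>5\<close>. For a few graphs \<open>B\<close> containing \<open>C\<^sub>5\<close> the possible
  adjacencies of a further vertex to an induced copy of \<open>B\<close> are those of a twin of a vertex of \<open>B\<close>, unless a
  larger such graph is induced. Applied to all copies of \<open>B\<close> obtained by exchanging a vertex with a twin,
  this shows that \<open>G\<close> is a clique expansion of \<open>B\<close>. Unless \<open>B\<close> is \<open>C\<^sub>5\<close> or \<open>G\<^sub>7\<close>, such an expansion is not
  critical: delete the clique of a suitable vertex \<open>p\<close> and choose a colouring with as few colours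
  on the neighbours of \<open>p\<close> as possible; Kempe changes show that enough colours remain for \<open>p\<close>.

  Finally the independence numbers of \<open>C\<^sub>5\<close> and \<open>G\<^sub>7\<close> and the degree and clique conditions leave finitely
  many clique sizes, namely those listed with 13 and 19 vertices in total.
\<close>

section \<open>Colourings and homogeneous sets\<close>

text \<open>The passage to clique expansions rests on one exchange: if the chromatic and the clique
  number of a homogeneous set agree, a colouring of the graph in which the set is cut down to a
  maximum clique extends to the whole graph. Perfection is invoked for this, and a second time for
  the entire graph when it has no induced five-cycle. Chromatic number 7 appears as
  \<open>critical E 6 V\<close>; the number \<open>q\<close> of colours stays arbitrary until the
  clique sizes are enumerated. The orders 13 and 19 arise as follows: a colour class in an expansion
  of the five-cycle has at most 2 vertices and in one of \<open>G7\<close> at most 3, and deleting a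
  vertex leaves a 6-colourable graph, so the order is at most 2 times 6 plus 1, or 3 times 6 plus 1.
  Every size vector of smaller order that meets the other necessary conditions turns out to be
  6-colourable, so the bound is attained. The main obstacle is \<open>pattern6\<close>: a vertex
  attached to a copy only at 5 completes no forbidden graph, so the twins of 5 need not be
  homogeneous. No expansion is obtained there, and two colourings are glued instead.\<close>

definition colouring :: "('a \<Rightarrow> 'a \<Rightarrow> bool) \<Rightarrow> nat \<Rightarrow> 'a set \<Rightarrow> ('a \<Rightarrow> nat) \<Rightarrow> bool" where
  "colouring E q V c \<longleftrightarrow> (\<forall>v\<in>V. c v < q) \<and> (\<forall>u\<in>V. \<forall>v\<in>V. E u v \<longrightarrow> c u \<noteq> c v)"

definition colourable :: "('a \<Rightarrow> 'a \<Rightarrow> bool) \<Rightarrow> nat \<Rightarrow> 'a set \<Rightarrow> bool" where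
  "colourable E q V \<longleftrightarrow> (\<exists>c. colouring E q V c)"

text \<open>All proper subsets are allowed because the arguments delete whole cliques and
  homogeneous sets. By monotonicity of colourability this agrees with deleting single vertices, as
  shown in \<open>vertex_critical_iff\<close>.\<close>

definition critical :: "('a \<Rightarrow> 'a \<Rightarrow> bool) \<Rightarrow> nat \<Rightarrow> 'a set \<Rightarrow> bool" where
  "critical E q V \<longleftrightarrow> \<not> colourable E q V \<and> (\<forall>U. U \<subset> V \<longrightarrow> colourable E q U)"

definition clique :: "('a \<Rightarrow> 'a \<Rightarrow> bool) \<Rightarrow> 'a set \<Rightarrow> bool" where
  "clique E Q \<longleftrightarrow> (\<forall>x\<in>Q. \<forall>y\<in>Q. x \<noteq> y \<longrightarrow> E x y)"

definition homogeneous :: "('a \<Rightarrow> 'a \<Rightarrow> bool) \<Rightarrow> 'a set \<Rightarrow> 'a set \<Rightarrow> bool" where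
  "homogeneous E V M \<longleftrightarrow> M \<subseteq> V \<and> (\<forall>x\<in>V - M. \<forall>a\<in>M. \<forall>b\<in>M. E x a \<longleftrightarrow> E x b)"

text \<open>The adjacencies required in the next three definitions force the vertices to be distinct.\<close>

definition P5_free :: "('a \<Rightarrow> 'a \<Rightarrow> bool) \<Rightarrow> 'a set \<Rightarrow> bool" where
  "P5_free E V \<longleftrightarrow> (\<forall>a\<in>V. \<forall>b\<in>V. \<forall>c\<in>V. \<forall>d\<in>V. \<forall>e\<in>V.
     E a b \<longrightarrow> E b c \<longrightarrow> E c d \<longrightarrow> E d e \<longrightarrow>
     E a c \<or> E a d \<or> E a e \<or> E b d \<or> E b e \<or> E c e)"

definition gem_free :: "('a \<Rightarrow> 'a \<Rightarrow> bool) \<Rightarrow> 'a set \<Rightarrow> bool" where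
  "gem_free E V \<longleftrightarrow> (\<forall>a\<in>V. \<forall>b\<in>V. \<forall>c\<in>V. \<forall>d\<in>V. \<forall>z\<in>V.
     E a b \<longrightarrow> E b c \<longrightarrow> E c d \<longrightarrow> E z a \<longrightarrow> E z b \<longrightarrow> E z c \<longrightarrow> E z d \<longrightarrow>
     E a c \<or> E a d \<or> E b d)"

definition C5_free :: "('a \<Rightarrow> 'a \<Rightarrow> bool) \<Rightarrow> 'a set \<Rightarrow> bool" where
  "C5_free E V \<longleftrightarrow> (\<forall>a\<in>V. \<forall>b\<in>V. \<forall>c\<in>V. \<forall>d\<in>V. \<forall>e\<in>V.
     E a b \<longrightarrow> E b c \<longrightarrow> E c d \<longrightarrow> E d e \<longrightarrow> E e a \<longrightarrow>
     E a c \<or> E a d \<or> E b d \<or> E b e \<or> E c e)"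

lemma P5_free_subset: "P5_free E V \<Longrightarrow> U \<subseteq> V \<Longrightarrow> P5_free E U"
  unfolding P5_free_def by (meson subsetD)

lemma gem_free_subset: "gem_free E V \<Longrightarrow> U \<subseteq> V \<Longrightarrow> gem_free E U"
  unfolding gem_free_def by (meson subsetD)

lemma C5_free_subset: "C5_free E V \<Longrightarrow> U \<subseteq> V \<Longrightarrow> C5_free E U"
  unfolding C5_free_def by (meson subsetD)

lemma P5_freeD:
  assumes "P5_free E V" "a \<in> V" "b \<in> V" "c \<in> V" "d \<in> V" "e \<in> V" "E a b" "E b c" "E c d" "E d e"
    "\<not> E a c" "\<not> E a d" "\<not> E a e" "\<not> E b d" "\<not> E b e" "\<not> E c e"
  shows False
  using assms unfolding P5_free_def by blast

lemma gem_freeD: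
  assumes "gem_free E V" "a \<in> V" "b \<in> V" "c \<in> V" "d \<in> V" "z \<in> V" "E a b" "E b c" "E c d"
    "E z a" "E z b" "E z c" "E z d" "\<not> E a c" "\<not> E a d" "\<not> E b d"
  shows False
  using assms unfolding gem_free_def by blast

lemma C5_freeD:
  assumes "C5_free E V" "a \<in> V" "b \<in> V" "c \<in> V" "d \<in> V" "e \<in> V" "E a b" "E b c" "E c d" "E d e"
    "E e a" "\<not> E a c" "\<not> E a d" "\<not> E b d" "\<not> E b e" "\<not> E c e"
  shows False
  using assms unfolding C5_free_def by blast

lemma colouring_subset: "colouring E q V c \<Longrightarrow> U \<subseteq> V \<Longrightarrow> colouring E q U c"
  unfolding colouring_def by (meson subsetD)

lemma colourable_subset: "colourable E q V \<Longrightarrow> U \<subseteq> V \<Longrightarrow> colourable E q U"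
  unfolding colourable_def using colouring_subset by blast

lemma colouring_lt: "colouring E q V c \<Longrightarrow> v \<in> V \<Longrightarrow> c v < q"
  unfolding colouring_def by blast

lemma colouring_neq: "colouring E q V c \<Longrightarrow> u \<in> V \<Longrightarrow> v \<in> V \<Longrightarrow> E u v \<Longrightarrow> c u \<noteq> c v"
  unfolding colouring_def by blast

lemma clique_subset: "clique E Q \<Longrightarrow> R \<subseteq> Q \<Longrightarrow> clique E R"
  unfolding clique_def by blast

lemma colouring_clique_inj:
  assumes "colouring E q V c" "clique E Q" "Q \<subseteq> V"
  shows "inj_on c Q"
  using assms unfolding inj_on_def clique_def colouring_def by (meson subsetD)

lemma colouring_clique_card:
  assumes "colouring E q V c" "clique E Q" "Q \<subseteq> V"
  shows "card (c ` Q) = card Q"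
  using colouring_clique_inj[OF assms] by (rule card_image)

lemma colouring_clique_le:
  assumes "colouring E q V c" "clique E Q" "Q \<subseteq> V"
  shows "card Q \<le> q"
proof -
  have "c ` Q \<subseteq> {..<q}" using assms colouring_lt by fastforce
  then have "card (c ` Q) \<le> q" using card_mono[of "{..<q}"] by auto
  then show ?thesis using colouring_clique_card[OF assms] by simp
qed

section \<open>Extending colourings and Kempe changes\<close>

locale adjacency =
  fixes E :: "'a \<Rightarrow> 'a \<Rightarrow> bool"
  assumes sym: "E x y \<Longrightarrow> E y x" and irrefl: "\<not> E x x"
begin

lemma sym_iff: "E x y \<longleftrightarrow> E y x"
  using sym by blast

text \<open>\<open>W\<close> receives pairwise distinct colours from those absent on
  \<open>N\<close>, so edges inside \<open>W\<close> are respected automatically.\<close>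

lemma extend_colouring:
  assumes c: "colouring E q U c" and "finite W" "U \<inter> W = {}" "N \<subseteq> U" "finite N"
    and nb: "\<And>w u. w \<in> W \<Longrightarrow> u \<in> U \<Longrightarrow> E w u \<Longrightarrow> u \<in> N"
    and card: "card (c ` N) + card W \<le> q"
  shows "colourable E q (U \<union> W)"
proof -
  have "c ` N \<subseteq> {..<q}" using c \<open>N \<subseteq> U\<close> colouring_lt by fastforce
  then have "card ({..<q} - c ` N) = q - card (c ` N)"
    using \<open>finite N\<close> by (simp add: card_Diff_subset)
  then have "card W \<le> card ({..<q} - c ` N)" using card by simp
  then obtain h where h: "h ` W \<subseteq> {..<q} - c ` N" "inj_on h W"
    using card_le_inj[OF \<open>finite W\<close>, of "{..<q} - c ` N"] by auto
  have hN: "\<And>w u. w \<in> W \<Longrightarrow> u \<in> N \<Longrightarrow> h w \<noteq> c u"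
    using h(1) by (metis DiffE image_eqI subsetD)
  have hq: "\<And>w. w \<in> W \<Longrightarrow> h w < q" using h(1) by blast
  define d where "d = (\<lambda>x. if x \<in> W then h x else c x)"
  have "colouring E q (U \<union> W) d"
    unfolding colouring_def
  proof (intro conjI ballI impI)
    fix v assume "v \<in> U \<union> W" then show "d v < q"
      unfolding d_def using hq c colouring_lt by fastforce
  next
    fix u v assume uv: "u \<in> U \<union> W" "v \<in> U \<union> W" "E u v"
    show "d u \<noteq> d v"
    proof (cases "u \<in> W"; cases "v \<in> W")
      assume "u \<in> W" "v \<in> W"
      then show ?thesis using h(2) uv(3) irrefl unfolding d_def inj_on_def by auto
    next
      assume "u \<in> W" "v \<notin> W"
      then show ?thesis using hN nb[of u v] uv unfolding d_def by auto
    next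
      assume "u \<notin> W" "v \<in> W"
      then have "h v \<noteq> c u" using hN nb[of v u] uv sym by blast
      then show ?thesis using \<open>u \<notin> W\<close> \<open>v \<in> W\<close> unfolding d_def by auto
    next
      assume "u \<notin> W" "v \<notin> W"
      then show ?thesis using c uv colouring_neq unfolding d_def by fastforce
    qed
  qed
  then show ?thesis unfolding colourable_def by blast
qed

text \<open>The swap takes place on the Kempe chain containing \<open>u\<close>. Without an induced
  P5 no vertex of this chain is at distance more than 3 from \<open>u\<close>. Hence a vertex
  \<open>v\<close> of colour \<beta> that is not adjacent to \<open>u\<close> can change its colour
  only if there is an induced path \<open>u\<close>, \<open>x\<close>, \<open>y\<close>,
  \<open>v\<close> in the two colours, which is what the last premise excludes.\<close>

lemma kempe_swap:
  assumes c: "colouring E q U c" and P5: "P5_free E U" and u: "u \<in> U" "c u \<noteq> \<beta>" "\<beta> < q"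
  obtains c' where "colouring E q U c'" "c' u = \<beta>"
    "\<And>x. c' x = c x \<or> c x = c u \<and> c' x = \<beta> \<or> c x = \<beta> \<and> c' x = c u"
    "\<And>v. v \<in> U \<Longrightarrow> c v = \<beta> \<Longrightarrow> \<not> E u v \<Longrightarrow>
       (\<And>x y. x \<in> U \<Longrightarrow> y \<in> U \<Longrightarrow> E u x \<Longrightarrow> E x y \<Longrightarrow> E y v \<Longrightarrow> c x = \<beta> \<Longrightarrow> c y = c u \<Longrightarrow> \<not> E u y
           \<Longrightarrow> \<not> E x v \<Longrightarrow> False) \<Longrightarrow> c' v = \<beta>"
proof -
  let ?\<alpha> = "c u"
  define R where "R = {(x, y). x \<in> U \<and> y \<in> U \<and> E x y \<and> c x \<in> {?\<alpha>, \<beta>} \<and> c y \<in> {?\<alpha>, \<beta>}}"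
  define C where "C = R\<^sup>* `` {u}"
  define c' where "c' = (\<lambda>x. if x \<in> C then (if c x = ?\<alpha> then \<beta> else ?\<alpha>) else c x)"
  have CC: "x \<in> U \<and> c x \<in> {?\<alpha>, \<beta>}" if "x \<in> C" for x
  proof -
    have "(u, x) \<in> R\<^sup>*" using that unfolding C_def by blast
    then show ?thesis by (induction) (use u in \<open>auto simp: R_def\<close>)
  qed
  have closed: "y \<in> C" if "x \<in> C" "y \<in> U" "E x y" "c y \<in> {?\<alpha>, \<beta>}" for x y
  proof -
    have "(x, y) \<in> R" using that CC[OF that(1)] unfolding R_def by blast
    then show ?thesis using that(1) unfolding C_def by (auto intro: rtrancl_into_rtrancl)
  qed
  have neq: "c x \<noteq> c y" if "(x, y) \<in> R" for x y
    using that c unfolding R_def colouring_def by blast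
  define N1 where "N1 = R `` {u}"
  define N2 where "N2 = R `` N1"
  define N3 where "N3 = R `` N2"
  have near: "C \<subseteq> {u} \<union> N1 \<union> N2 \<union> N3"
  proof
    fix x assume "x \<in> C"
    then have "(u, x) \<in> R\<^sup>*" unfolding C_def by blast
    then show "x \<in> {u} \<union> N1 \<union> N2 \<union> N3"
    proof (induction)
      case base then show ?case by simp
    next
      case (step x z)
      show ?case
      proof (cases "x \<in> N3")
        case False
        then show ?thesis using step unfolding N1_def N2_def N3_def by blast
      next
        case True
        then obtain x1 x2 where x: "(u, x1) \<in> R" "(x1, x2) \<in> R" "(x2, x) \<in> R"
          unfolding N3_def N2_def N1_def by blast
        have z: "(x, z) \<in> R" by (rule step)
        have col: "c x1 = \<beta>" "c x2 = ?\<alpha>" "c x = \<beta>" "c z = ?\<alpha>"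
          using x z neq[OF x(1)] neq[OF x(2)] neq[OF x(3)] neq[OF z] unfolding R_def by auto
        have U: "x1 \<in> U" "x2 \<in> U" "x \<in> U" "z \<in> U" using x z unfolding R_def by auto
        have same: "\<not> E a b" if "a \<in> U" "b \<in> U" "c a = c b" for a b
          using c that unfolding colouring_def by blast
        \<comment> \<open>Colours alternate on the walk \<open>u\<close>, \<open>x1\<close>,
          \<open>x2\<close>, \<open>x\<close>, \<open>z\<close>, so these two pairs are its only
          possible chords. A chord shortens the walk; without one it is an induced P5.\<close>
        consider "E u x" | "E x1 z" | "\<not> E u x" "\<not> E x1 z" by blast
        then show ?thesis
        proof cases
          case 1
          then have "(u, x) \<in> R" using u U col unfolding R_def by auto
          then show ?thesis using z unfolding N1_def N2_def by blast
        next
          case 2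
          then have "(x1, z) \<in> R" using u U col unfolding R_def by auto
          then show ?thesis using x unfolding N1_def N2_def by blast
        next
          case 3
          have False
            by (rule P5_freeD[OF P5 u(1) U]) (use 3 x z same u U col in \<open>auto simp: R_def\<close>)
          then show ?thesis ..
        qed
      qed
    qed
  qed
  show ?thesis
  proof (rule that[of c'])
    have "u \<in> C" unfolding C_def by simp
    then show "c' u = \<beta>" unfolding c'_def by simp
    show "c' x = c x \<or> c x = c u \<and> c' x = \<beta> \<or> c x = \<beta> \<and> c' x = c u" for x
      using CC[of x] unfolding c'_def by auto
    show "colouring E q U c'"
      unfolding colouring_def
    proof (intro conjI ballI impI)
      fix v assume "v \<in> U" then show "c' v < q"
        using c u colouring_lt unfolding c'_def by fastforce
    next
      fix x y assume xy: "x \<in> U" "y \<in> U" "E x y"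
      have n: "c x \<noteq> c y" using c xy unfolding colouring_def by blast
      show "c' x \<noteq> c' y"
        using n closed[OF _ xy(2,3)] closed[OF _ xy(1) sym[OF xy(3)]] CC[of x] CC[of y] u(2)
        unfolding c'_def by auto
    qed
    fix v assume v: "v \<in> U" "c v = \<beta>" "\<not> E u v"
      and no: "\<And>x y. x \<in> U \<Longrightarrow> y \<in> U \<Longrightarrow> E u x \<Longrightarrow> E x y \<Longrightarrow> E y v \<Longrightarrow> c x = \<beta> \<Longrightarrow> c y = c u \<Longrightarrow> \<not> E u y
           \<Longrightarrow> \<not> E x v \<Longrightarrow> False"
    have "v \<notin> C"
    proof
      assume "v \<in> C"
      moreover have "v \<noteq> u" using v u by blast
      moreover have "v \<notin> N1" using v unfolding N1_def R_def by blast
      \<comment> \<open>Vertices at distance 2 carry the colour of \<open>u\<close>, whereas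
        \<open>v\<close> has colour \<beta>. So only distance 3 remains.\<close>
      moreover have "v \<notin> N2"
      proof
        assume "v \<in> N2"
        then obtain x where "(u, x) \<in> R" "(x, v) \<in> R" unfolding N2_def N1_def by blast
        then show False using neq[of u x] neq[of x v] v unfolding R_def by auto
      qed
      ultimately have "v \<in> N3" using near by blast
      then obtain x y where xy: "(u, x) \<in> R" "(x, y) \<in> R" "(y, v) \<in> R"
        unfolding N3_def N2_def N1_def by blast
      then have "c x = \<beta>" "c y = c u"
        using neq[OF xy(1)] neq[OF xy(2)] unfolding R_def by auto
      moreover have "\<not> E u y" "\<not> E x v"
        using colouring_neq[OF c, of u y] colouring_neq[OF c, of x v] xy u v calculation
        unfolding R_def by auto
      ultimately show False using no xy unfolding R_def by blast
    qed
    then show "c' v = \<beta>" unfolding c'_def using v by simp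
  qed
qed

text \<open>Keep only a maximum clique \<open>Q\<close> of \<open>M\<close> and colour the rest by
  criticality. Perfection colours \<open>M\<close> with as many colours as occur on
  \<open>Q\<close>; using exactly those colours is safe, since every outside vertex sees all of
  \<open>M\<close> or nothing of it.\<close>

lemma homogeneous_clique:
  assumes crit: "critical E q V" and fin: "finite V" and M: "homogeneous E V M"
    and perfect: "\<And>r. (\<And>Q. Q \<subseteq> M \<Longrightarrow> clique E Q \<Longrightarrow> card Q \<le> r) \<Longrightarrow> colourable E r M"
  shows "clique E M"
proof (rule ccontr)
  assume "\<not> clique E M"
  have finM: "finite M" using fin M finite_subset unfolding homogeneous_def by blast
  obtain Q where Q: "Q \<subseteq> M" "clique E Q" "\<And>Q'. Q' \<subseteq> M \<Longrightarrow> clique E Q' \<Longrightarrow> card Q' \<le> card Q"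
  proof -
    have "\<exists>Q. (Q \<subseteq> M \<and> clique E Q) \<and> (\<forall>Q'. Q' \<subseteq> M \<and> clique E Q' \<longrightarrow> card Q' \<le> card Q)"
      by (rule ex_has_greatest_nat[where k = "{}" and b = "Suc (card M)"])
        (use card_mono[OF finM] in \<open>auto simp: clique_def less_Suc_eq_le\<close>)
    then show ?thesis using that by blast
  qed
  have "Q \<noteq> M" using Q \<open>\<not> clique E M\<close> by blast
  then have "V - (M - Q) \<subset> V" using Q M unfolding homogeneous_def by blast
  then obtain c where c: "colouring E q (V - (M - Q)) c"
    using crit unfolding critical_def colourable_def by blast
  obtain d where d: "colouring E (card Q) M d"
    using perfect[of "card Q"] Q(3) unfolding colourable_def by blast
  have QV: "Q \<subseteq> V - (M - Q)" using Q M unfolding homogeneous_def by blast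
  have "card (c ` Q) = card {..<card Q}"
    using colouring_clique_card[OF c Q(2) QV] by simp
  \<comment> \<open>\<open>h\<close> renames the colours of \<open>d\<close> to the colours that
    \<open>c\<close> uses on \<open>Q\<close>.\<close>
  then obtain h where h: "bij_betw h {..<card Q} (c ` Q)"
    by (metis finM Q(1) finite_imageI finite_lessThan finite_same_card_bij finite_subset)
  have hQ: "h (d x) \<in> c ` Q" if "x \<in> M" for x
    using bij_betwE[OF h] colouring_lt[OF d that] by blast
  define e where "e = (\<lambda>x. if x \<in> M then h (d x) else c x)"
  have mixed: "c x \<noteq> h (d y)" if "x \<in> V" "x \<notin> M" "y \<in> M" "E x y" for x y
  proof -
    obtain z where z: "z \<in> Q" "h (d y) = c z" using hQ[OF \<open>y \<in> M\<close>] by blast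
    have "E x z" using M that z Q(1) unfolding homogeneous_def by blast
    then show ?thesis using colouring_neq[OF c, of x z] that z QV by auto
  qed
  have "colouring E q V e"
    unfolding colouring_def
  proof (intro conjI ballI impI)
    fix v assume "v \<in> V"
    show "e v < q"
    proof (cases "v \<in> M")
      case True
      then obtain z where "z \<in> Q" "h (d v) = c z" using hQ by blast
      then show ?thesis using True colouring_lt[OF c] QV unfolding e_def by auto
    next
      case False
      then show ?thesis using colouring_lt[OF c] \<open>v \<in> V\<close> unfolding e_def by auto
    qed
  next
    fix x y assume xy: "x \<in> V" "y \<in> V" "E x y"
    consider "x \<in> M" "y \<in> M" | "x \<in> M" "y \<notin> M" | "x \<notin> M" "y \<in> M" | "x \<notin> M" "y \<notin> M" by blast
    then show "e x \<noteq> e y"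
    proof cases
      case 1
      then have "d x \<noteq> d y" "d x < card Q" "d y < card Q"
        using d xy unfolding colouring_def by auto
      then show ?thesis using 1 bij_betw_imp_inj_on[OF h] unfolding e_def inj_on_def by auto
    next
      case 2
      then show ?thesis using mixed[of y x] xy sym unfolding e_def by force
    next
      case 3
      then show ?thesis using mixed[of x y] xy unfolding e_def by auto
    next
      case 4
      then show ?thesis using colouring_neq[OF c, of x y] xy unfolding e_def by auto
    qed
  qed
  then show False using crit unfolding critical_def colourable_def by blast
qed

section \<open>Perfection without induced five-cycles\<close>

text \<open>As a reflexive closure it also relates vertices outside \<open>X\<close> to themselves,
  which is why membership in \<open>X\<close> is demanded separately below.\<close>

definition reach :: "'a set \<Rightarrow> ('a \<times> 'a) set" where
  "reach X = {(a, b). a \<in> X \<and> b \<in> X \<and> E a b}\<^sup>*"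

lemma reach_sym:
  assumes "(x, y) \<in> reach X" shows "(y, x) \<in> reach X"
  using assms unfolding reach_def
proof (induction rule: converse_rtrancl_induct)
  case (step y z)
  then have "(z, y) \<in> {(a, b). a \<in> X \<and> b \<in> X \<and> E a b}" by (simp add: sym)
  then show ?case using step(3) by (rule rtrancl_into_rtrancl[rotated])
qed simp

lemma reach_trans: "(x, y) \<in> reach X \<Longrightarrow> (y, z) \<in> reach X \<Longrightarrow> (x, z) \<in> reach X"
  unfolding reach_def by (rule rtrancl_trans)

lemma reach_mono: "X \<subseteq> Y \<Longrightarrow> reach X \<subseteq> reach Y"
  unfolding reach_def by (rule rtrancl_mono) blast

lemma reach_in: "(x, y) \<in> reach X \<Longrightarrow> x \<in> X \<Longrightarrow> y \<in> X"
  unfolding reach_def by (induction rule: rtrancl_induct) auto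

lemma reach_step: "(x, y) \<in> reach X \<Longrightarrow> y \<in> X \<Longrightarrow> z \<in> X \<Longrightarrow> E y z \<Longrightarrow> (x, z) \<in> reach X"
  unfolding reach_def by (erule rtrancl_into_rtrancl) simp

text \<open>A path starting in a component never leaves it, so the component is connected as a graph
  of its own. The set \<open>K\<close> is used below without reference to the surrounding
  non-neighbourhood.\<close>

lemma reach_comp_self:
  assumes "(x, y) \<in> reach X" "x \<in> X"
  shows "(x, y) \<in> reach (reach X `` {x})"
  using assms(1) unfolding reach_def
proof (induction rule: rtrancl_induct)
  case base
  then show ?case by simp
next
  case (step y z)
  let ?C = "{(a, b). a \<in> X \<and> b \<in> X \<and> E a b}\<^sup>* `` {x}"
  have "y \<in> ?C" using step(1) by simp
  moreover have "z \<in> ?C" using rtrancl_into_rtrancl[OF step(1,2)] by simp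
  ultimately have "(y, z) \<in> {(a, b). a \<in> ?C \<and> b \<in> ?C \<and> E a b}" using step(2) by simp
  then show ?case using step(3) by (rule rtrancl_into_rtrancl[rotated])
qed

text \<open>The pair of a vertex and a component of its non-neighbourhood is chosen with the largest
  component. If \<open>w\<close> saw neither \<open>K\<close> nor an attachment \<open>s\<close> of
  \<open>K\<close>, then \<open>K\<close> together with \<open>s\<close> would lie in one component
  of the non-neighbourhood of \<open>w\<close>, which is larger.\<close>

lemma maximal_nonneighbour_component:
  assumes fin: "finite V" and x: "x \<in> V" "y \<in> V" "x \<noteq> y" "\<not> E x y"
  obtains v K where "v \<in> V" "K \<noteq> {}" "K \<subseteq> V" "v \<notin> K" "\<And>k. k \<in> K \<Longrightarrow> \<not> E v k"
    "\<And>a b. a \<in> K \<Longrightarrow> b \<in> K \<Longrightarrow> (a, b) \<in> reach K"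
    "\<And>w s k. w \<in> V - K \<Longrightarrow> (\<And>k. k \<in> K \<Longrightarrow> \<not> E w k) \<Longrightarrow> s \<in> V - K \<Longrightarrow> k \<in> K \<Longrightarrow> E s k \<Longrightarrow> E w s"
proof -
  define M where "M = (\<lambda>v. {z \<in> V. z \<noteq> v \<and> \<not> E v z})"
  define C where "C = (\<lambda>(v, y). reach (M v) `` {y})"
  define P where "P = {(v, y). v \<in> V \<and> y \<in> M v}"
  have CM: "C (v, y) \<subseteq> M v" if "y \<in> M v" for v y
    unfolding C_def using reach_in[OF _ that] by auto
  have MV: "M v \<subseteq> V" for v unfolding M_def by blast
  have "(x, y) \<in> P" using x unfolding P_def M_def by auto
  moreover have "card (C p) < Suc (card V)" if "p \<in> P" for p
  proof -
    obtain v y where p: "p = (v, y)" by (cases p)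
    then have "C p \<subseteq> V" using that CM[of y v] MV[of v] unfolding P_def by blast
    then show ?thesis using card_mono[OF fin] by (simp add: less_Suc_eq_le)
  qed
  ultimately have "\<exists>p. p \<in> P \<and> (\<forall>p'. p' \<in> P \<longrightarrow> card (C p') \<le> card (C p))"
    by (intro ex_has_greatest_nat[where b = "Suc (card V)"]) auto
  then obtain p where p: "p \<in> P" "\<And>p'. p' \<in> P \<Longrightarrow> card (C p') \<le> card (C p)"
    by auto
  obtain v z where vz: "p = (v, z)" by (cases p)
  have vzP: "v \<in> V" "z \<in> M v" using p(1) vz unfolding P_def by auto
  let ?K = "C (v, z)"
  have KM: "?K \<subseteq> M v" using CM vzP by blast
  show ?thesis
  proof (rule that[of v ?K])
    show "v \<in> V" by (rule vzP)
    have "(z, z) \<in> reach (M v)" unfolding reach_def by simp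
    then show "?K \<noteq> {}" unfolding C_def by blast
    show "?K \<subseteq> V" "v \<notin> ?K" using KM MV[of v] unfolding M_def by blast+
    show "\<not> E v k" if "k \<in> ?K" for k using subsetD[OF KM that] unfolding M_def by simp
    have zz: "(z, a) \<in> reach ?K" if "a \<in> ?K" for a
      using reach_comp_self[of z a "M v"] vzP(2) that unfolding C_def by simp
    show reachK: "(a, b) \<in> reach ?K" if "a \<in> ?K" "b \<in> ?K" for a b
      by (rule reach_trans[OF reach_sym[OF zz[OF that(1)]] zz[OF that(2)]])
    fix w s k
    assume w: "w \<in> V - ?K" "\<And>k. k \<in> ?K \<Longrightarrow> \<not> E w k" and s: "s \<in> V - ?K" "k \<in> ?K" "E s k"
    show "E w s"
    proof (rule ccontr)
      assume n: "\<not> E w s"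
      have KMw: "?K \<subseteq> M w"
      proof
        fix a assume a: "a \<in> ?K"
        then have "a \<in> V" "a \<noteq> w" using KM MV[of v] w(1) by auto
        then show "a \<in> M w" using w(2)[OF a] unfolding M_def by simp
      qed
      have "s \<noteq> w" using w(2)[OF s(2)] s(3) by auto
      then have sM: "s \<in> M w" using s(1) n unfolding M_def by simp
      have kP: "(w, k) \<in> P" using w(1) KMw s(2) unfolding P_def by blast
      have sub: "?K \<subseteq> C (w, k)"
      proof
        fix a assume "a \<in> ?K"
        then have "(k, a) \<in> reach (M w)" using reachK[OF s(2)] reach_mono[OF KMw] by blast
        then show "a \<in> C (w, k)" unfolding C_def by simp
      qed
      have "s \<in> C (w, k)"
      proof -
        have "(k, s) \<in> reach (M w)"
          by (rule reach_step[of k k]) (use sM s KMw sym[OF s(3)] in \<open>auto simp: reach_def\<close>)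
        then show ?thesis unfolding C_def by simp
      qed
      then have "?K \<subset> C (w, k)" using sub s(1) by blast
      moreover have "finite (C (w, k))"
        by (rule finite_subset[OF _ fin]) (use CM[of k w] kP MV[of w] in \<open>auto simp: P_def\<close>)
      ultimately have "card ?K < card (C (w, k))" by (simp add: psubset_card_mono)
      then show False using p(2)[OF kP] vz by simp
    qed
  qed
qed

end

text \<open>Used for paths in \<open>K\<close> and for paths of the complement in \<open>T\<close>.
  In the latter case a vertex that is mixed on \<open>T\<close> is found to be mixed on a
  nonadjacent pair.\<close>

lemma rtrancl_transition:
  assumes "(x, y) \<in> R\<^sup>*" "P x" "\<not> P y"
  shows "\<exists>a b. (x, a) \<in> R\<^sup>* \<and> (a, b) \<in> R \<and> P a \<and> \<not> P b"
  using assms(1,3)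
proof (induction rule: rtrancl_induct)
  case base
  then show ?case using assms(2) by simp
next
  case (step y z)
  show ?case
  proof (cases "P y")
    case True
    then have "(x, y) \<in> R\<^sup>* \<and> (y, z) \<in> R \<and> P y \<and> \<not> P z" using step(1,2,4) by simp
    then show ?thesis by (intro exI)
  next
    case False
    then show ?thesis by (rule step(3))
  qed
qed

section \<open>Attachment sets of a maximal component\<close>

context adjacency
begin

text \<open>A vertex \<open>x\<close> mixed on \<open>T\<close> separates two nonadjacent members
  \<open>a\<close>, \<open>c\<close>, since \<open>T\<close> is connected in the complement. Outside
  \<open>K\<close> and \<open>S\<close> all vertices are complete to \<open>S\<close>. If
  \<open>x\<close> is in \<open>S\<close>, maximality of \<open>T\<close> makes it nonadjacent to
  \<open>b\<close>, and \<open>x\<close>, \<open>a\<close>, \<open>b\<close>, \<open>c\<close> with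
  apex \<open>p\<close> is a gem. If \<open>x\<close> is in \<open>K\<close>, some \<open>y\<close>
  in \<open>K\<close> is adjacent to \<open>b\<close> and \<open>x\<close>; depending on whether
  \<open>y\<close> sees \<open>a\<close>, the path \<open>p\<close>, \<open>b\<close>,
  \<open>y\<close>, \<open>x\<close> with apex \<open>a\<close> is a gem, or \<open>c\<close>,
  \<open>p\<close>, \<open>a\<close>, \<open>x\<close>, \<open>y\<close> is an induced P5.\<close>

lemma homogeneous_if_anticonnected:
  assumes P5: "P5_free E V" and gem: "gem_free E V"
    and p: "p \<in> V" "p \<notin> K" "\<And>k. k \<in> K \<Longrightarrow> \<not> E p k"
    and K: "K \<subseteq> V" "\<And>x y. x \<in> K \<Longrightarrow> y \<in> K \<Longrightarrow> (x, y) \<in> reach K"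
    and S: "S = {s \<in> V - K. \<exists>k\<in>K. E s k}" "\<And>w s. w \<in> V - K - S \<Longrightarrow> s \<in> S \<Longrightarrow> E w s"
    and b: "b \<in> S" "\<And>t. t \<in> T \<Longrightarrow> E b t"
    and T: "T \<subseteq> S" "\<And>x y. x \<in> T \<Longrightarrow> y \<in> T \<Longrightarrow> (x, y) \<in> {(x, y). x \<in> T \<and> y \<in> T \<and> x \<noteq> y \<and> \<not> E x y}\<^sup>*"
    and Tmax: "\<And>x t. x \<in> S \<Longrightarrow> E b x \<Longrightarrow> t \<in> T \<Longrightarrow> x \<noteq> t \<Longrightarrow> \<not> E x t \<Longrightarrow> x \<in> T"
  shows "homogeneous E V T"
proof -
  have SV: "s \<in> V" "s \<notin> K" if "s \<in> S" for s using that unfolding S(1) by auto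
  have TV: "t \<in> V" if "t \<in> T" for t using that T(1) SV by blast
  have pS: "p \<notin> S" using p(3) unfolding S(1) by blast
  have pE: "E p s" if "s \<in> S" for s using S(2)[OF _ that] p(1,2) pS by blast
  have sepT: "\<exists>a c. a \<in> T \<and> c \<in> T \<and> \<not> E a c \<and> E x a \<and> \<not> E x c"
    if st: "s \<in> T" "t \<in> T" "E x s" "\<not> E x t" for x s t
    using rtrancl_transition[OF T(2)[OF st(1,2)], of "E x"] st(3,4) by blast
  \<comment> \<open>Otherwise \<open>y\<close>, \<open>a\<close>, \<open>p\<close>, \<open>c\<close>
    with apex \<open>b\<close> is a gem for a nonadjacent pair \<open>a\<close>, \<open>c\<close>
    separated by \<open>y\<close>.\<close>
  have mixed_b: "\<not> E y b" if y: "y \<in> K" "s \<in> T" "t \<in> T" "E y s" "\<not> E y t" for y s t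
  proof
    assume yb: "E y b"
    obtain a c where ac: "a \<in> T" "c \<in> T" "\<not> E a c" "E y a" "\<not> E y c"
      using sepT[OF y(2-5)] by blast
    have V: "y \<in> V" "a \<in> V" "c \<in> V" "b \<in> V" using y K TV ac b(1) SV by auto
    show False
      by (rule gem_freeD[OF gem V(1,2) p(1) V(3,4)])
        (use ac b T(1) pE p(3)[OF y(1)] yb sym in \<open>blast+\<close>)
  qed
  obtain k0 where k0: "k0 \<in> K" "E b k0" using b(1) unfolding S(1) by blast
  define N1 where "N1 = {z \<in> K. E b z}"
  define N2 where "N2 = {z \<in> K. \<exists>w\<in>N1. E w z}"
  \<comment> \<open>Every vertex of \<open>K\<close> is within distance 2 of \<open>b\<close>
    through \<open>K\<close>; a first vertex farther away would end an induced P5 that starts with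
    \<open>p\<close> and \<open>b\<close>.\<close>
  have near: "y \<in> N1 \<union> N2" if yK: "y \<in> K" for y
  proof (rule ccontr)
    assume y: "y \<notin> N1 \<union> N2"
    have "k0 \<in> N1 \<union> N2" using k0 unfolding N1_def by blast
    with y obtain z z' where z: "z \<in> K" "z' \<in> K" "E z z'" "z \<in> N1 \<union> N2" "z' \<notin> N1 \<union> N2"
      using rtrancl_transition[OF K(2)[OF k0(1) yK, unfolded reach_def], of "\<lambda>z. z \<in> N1 \<union> N2"]
      by blast
    have "z \<notin> N1" using z unfolding N2_def by blast
    then obtain w where w: "w \<in> N1" "E w z" using z unfolding N2_def by blast
    have wK: "w \<in> K" "E b w" using w unfolding N1_def by auto
    have n: "\<not> E b z" "\<not> E b z'" "\<not> E w z'" using \<open>z \<notin> N1\<close> z w unfolding N1_def N2_def by auto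
    have V: "z' \<in> V" "z \<in> V" "w \<in> V" "b \<in> V" using z wK K(1) b(1) SV by auto
    show False
      by (rule P5_freeD[OF P5 p(1) V(4,3,2,1) pE[OF b(1)] wK(2) w(2) z(3)])
        (use n p(3) wK z in auto)
  qed
  have "E x s \<longleftrightarrow> E x t" if x: "x \<in> V - T" and st: "s \<in> T" "t \<in> T" for x s t
  proof -
    have False if E: "s \<in> T" "t \<in> T" "E x s" "\<not> E x t" for s t
    proof -
      obtain a c where ac: "a \<in> T" "c \<in> T" "\<not> E a c" "E x a" "\<not> E x c"
        using sepT[OF E] by blast
      have acV: "a \<in> V" "c \<in> V" "a \<in> S" "c \<in> S" using ac TV T(1) by auto
      have bV: "b \<in> V" using b(1) SV by blast
      consider "x \<in> V - K - S" | "x \<in> S" | "x \<in> K" using x by blast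
      then show False
      proof cases
        case 1
        then show False using S(2)[OF 1 acV(4)] ac by blast
      next
        case 2
        have "x \<noteq> b" using b(2) ac by blast
        have "x \<noteq> c" using x ac by blast
        have nbx: "\<not> E b x" using Tmax[OF 2 _ ac(2) \<open>x \<noteq> c\<close>] x ac by blast
        show False
          by (rule gem_freeD[OF gem SV(1)[OF 2] acV(1) bV acV(2) p(1)])
            (use ac b nbx pE 2 acV sym in \<open>blast+\<close>)
      next
        case 3
        have nb: "\<not> E x b" by (rule mixed_b[OF 3 E])
        then have "x \<notin> N1" using sym unfolding N1_def by blast
        then obtain y where y: "y \<in> K" "E b y" "E y x" using near[OF 3] unfolding N1_def N2_def by blast
        have yV: "y \<in> V" "x \<in> V" using y K(1) 3 by auto
        have unmixed: "E y a \<longleftrightarrow> E y c"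
          using mixed_b[OF y(1) ac(1,2)] mixed_b[OF y(1) ac(2,1)] y(2) sym by blast
        have np: "\<not> E p x" "\<not> E p y" using p(3) 3 y by auto
        show False
        proof (cases "E y a")
          case True
          show False
            by (rule gem_freeD[OF gem p(1) bV yV acV(1)])
              (use True y ac b np nb pE acV sym in \<open>blast+\<close>)
        next
          case False
          show False
            by (rule P5_freeD[OF P5 acV(2) p(1) acV(1) yV(2,1)])
              (use False unmixed y ac np pE acV sym in \<open>blast+\<close>)
        qed
      qed
    qed
    then show ?thesis using st by blast
  qed
  then show ?thesis unfolding homogeneous_def using TV by blast
qed

text \<open>Nonadjacent \<open>a\<close> and \<open>c\<close> would lie in one component
  \<open>T\<close> of the complement of the graph on the neighbours of \<open>b\<close> in
  \<open>S\<close>. Such a \<open>T\<close> is homogeneous and misses \<open>b\<close>, so it would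
  be a clique. Hence the components of \<open>S\<close> are cliques.\<close>

lemma attachment_transitive:
  assumes P5: "P5_free E V" and gem: "gem_free E V"
    and p: "p \<in> V" "p \<notin> K" "\<And>k. k \<in> K \<Longrightarrow> \<not> E p k"
    and K: "K \<subseteq> V" "\<And>x y. x \<in> K \<Longrightarrow> y \<in> K \<Longrightarrow> (x, y) \<in> reach K"
    and S: "S = {s \<in> V - K. \<exists>k\<in>K. E s k}" "\<And>w s. w \<in> V - K - S \<Longrightarrow> s \<in> S \<Longrightarrow> E w s"
    and hom: "\<And>M. homogeneous E V M \<Longrightarrow> M \<noteq> V \<Longrightarrow> clique E M"
    and abc: "a \<in> S" "b \<in> S" "c \<in> S" "E a b" "E b c" "a \<noteq> c"
  shows "E a c"
proof (rule ccontr)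
  assume nac: "\<not> E a c"
  define N where "N = {x \<in> S. E b x}"
  define R where "R = {(x, y). x \<in> N \<and> y \<in> N \<and> x \<noteq> y \<and> \<not> E x y}"
  define T where "T = R\<^sup>* `` {a}"
  have aN: "a \<in> N" "c \<in> N" using abc sym unfolding N_def by blast+
  have TN: "t \<in> N" if "t \<in> T" for t
  proof -
    have "(a, t) \<in> R\<^sup>*" using that unfolding T_def by blast
    then show ?thesis by induction (use aN in \<open>auto simp: R_def\<close>)
  qed
  have Tstep: "y \<in> T" if "x \<in> T" "y \<in> N" "x \<noteq> y" "\<not> E x y" for x y
  proof -
    have "(x, y) \<in> R" using that TN unfolding R_def by blast
    moreover have "(a, x) \<in> R\<^sup>*" using that(1) unfolding T_def by simp
    ultimately have "(a, y) \<in> R\<^sup>*" by (rule rtrancl_into_rtrancl[rotated])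
    then show ?thesis unfolding T_def by simp
  qed
  let ?RT = "{(x, y). x \<in> T \<and> y \<in> T \<and> x \<noteq> y \<and> \<not> E x y}"
  have from_a: "(a, t) \<in> ?RT\<^sup>* \<and> (t, a) \<in> ?RT\<^sup>*" if "t \<in> T" for t
  proof -
    have "(a, t) \<in> R\<^sup>*" using that unfolding T_def by blast
    then show ?thesis
    proof induction
      case base then show ?case by simp
    next
      case (step y z)
      have "y \<in> T" "z \<in> T"
        using step(1) rtrancl_into_rtrancl[OF step(1,2)] unfolding T_def by auto
      then have "(y, z) \<in> ?RT" "(z, y) \<in> ?RT" using step(2) sym unfolding R_def by blast+
      then show ?case
        using rtrancl_into_rtrancl[of a y ?RT z] converse_rtrancl_into_rtrancl[of z y ?RT a] step(3)
        by simp
    qed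
  qed
  have "homogeneous E V T"
  proof (rule homogeneous_if_anticonnected[OF P5 gem p K S abc(2), of T])
    show "E b t" if "t \<in> T" for t using TN[OF that] unfolding N_def by blast
    show "T \<subseteq> S" using TN unfolding N_def by blast
    show "(x, y) \<in> ?RT\<^sup>*" if "x \<in> T" "y \<in> T" for x y
      using from_a[OF that(1)] from_a[OF that(2)] by (blast intro: rtrancl_trans)
    show "x \<in> T" if "x \<in> S" "E b x" "t \<in> T" "x \<noteq> t" "\<not> E x t" for x t
      using Tstep[OF that(3)] that sym unfolding N_def by blast
  qed
  moreover have "T \<noteq> V"
  proof
    assume "T = V"
    then have "b \<in> N" using TN abc(2) unfolding S(1) by blast
    then show False using irrefl unfolding N_def by blast
  qed
  ultimately have "clique E T" using hom by blast
  moreover have "a \<in> T" unfolding T_def by simp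
  moreover have "c \<in> T" using Tstep[OF \<open>a \<in> T\<close> aN(2) abc(6) nac] .
  ultimately show False using nac abc(6) unfolding clique_def by blast
qed

text \<open>Take a colouring with as many vertices of \<open>S\<close> as possible coloured from the
  palette of \<open>Q\<close>. A vertex \<open>u\<close> with a foreign colour permits a Kempe swap
  that increases this number.\<close>

lemma recolour_attachment:
  assumes fin: "finite V" and P5: "P5_free E V" and C5: "C5_free E V"
    and p: "p \<in> V" "\<And>k. k \<in> K \<Longrightarrow> \<not> E p k" "\<And>s. s \<in> S \<Longrightarrow> E p s"
    and SK: "S \<subseteq> V" "K \<subseteq> V" "S \<inter> K = {}"
    and tr: "\<And>a b c. a \<in> S \<Longrightarrow> b \<in> S \<Longrightarrow> c \<in> S \<Longrightarrow> E a b \<Longrightarrow> E b c \<Longrightarrow> a \<noteq> c \<Longrightarrow> E a c"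
    and Q: "Q \<subseteq> S" "clique E Q" "\<And>Q'. Q' \<subseteq> S \<Longrightarrow> clique E Q' \<Longrightarrow> card Q' \<le> card Q"
    and c0: "colouring E q (S \<union> K) c0"
  obtains c where "colouring E q (S \<union> K) c" "c ` S \<subseteq> c ` Q"
proof -
  let ?U = "S \<union> K"
  have finS: "finite S" by (rule finite_subset[OF SK(1) fin])
  then have finQ: "finite Q" by (rule finite_subset[OF Q(1)])
  have P5U: "P5_free E ?U" by (rule P5_free_subset[OF P5]) (use SK in blast)
  define m where "m = (\<lambda>c :: 'a \<Rightarrow> nat. card {x \<in> S. c x \<in> c ` Q})"
  have "\<exists>c. colouring E q ?U c \<and> (\<forall>c'. colouring E q ?U c' \<longrightarrow> m c' \<le> m c)"
  proof (rule ex_has_greatest_nat[where k = c0 and b = "Suc (card S)"], rule c0, intro allI impI)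
    fix c :: "'a \<Rightarrow> nat"
    show "m c < Suc (card S)" unfolding m_def using card_mono[OF finS] by (simp add: less_Suc_eq_le)
  qed
  then obtain c where c: "colouring E q ?U c" and max: "\<And>c'. colouring E q ?U c' \<Longrightarrow> m c' \<le> m c"
    by blast
  have "c ` S \<subseteq> c ` Q"
  proof (rule ccontr)
    assume "\<not> c ` S \<subseteq> c ` Q"
    then obtain u where u: "u \<in> S" "c u \<notin> c ` Q" by blast
    define J where "J = {x \<in> S. x = u \<or> E u x}"
    have "clique E J" unfolding J_def clique_def using tr u sym by blast
    have "finite J" using finS unfolding J_def by simp
    have JS: "J \<subseteq> S" "u \<in> J" using u unfolding J_def by auto
    have "card (c ` J) = card J"
      by (rule colouring_clique_card[OF c \<open>clique E J\<close>]) (use JS in blast)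
    moreover have "card (c ` Q) = card Q" by (rule colouring_clique_card[OF c Q(2)]) (use Q in blast)
    ultimately have le: "card (c ` J) \<le> card (c ` Q)" using Q(3)[OF JS(1) \<open>clique E J\<close>] by simp
    \<comment> \<open>\<open>J\<close>, the component of \<open>u\<close> in \<open>S\<close>, is a
      clique and so has at most as many colours as \<open>Q\<close>. One of them, that of
      \<open>u\<close>, is foreign to \<open>Q\<close>, so some colour of \<open>Q\<close> is
      missing on \<open>J\<close>.\<close>
    have "\<not> c ` Q \<subseteq> c ` J"
    proof
      assume "c ` Q \<subseteq> c ` J"
      then have "c ` Q \<subset> c ` J" using u JS by blast
      then show False using psubset_card_mono[of "c ` J" "c ` Q"] \<open>finite J\<close> le by simp
    qed
    then obtain v where v: "v \<in> Q" "c v \<notin> c ` J" by blast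
    let ?\<beta> = "c v"
    have J\<beta>: "c x \<noteq> ?\<beta>" if "x \<in> S" "x = u \<or> E u x" for x
    proof -
      have "x \<in> J" using that unfolding J_def by simp
      then show ?thesis using v(2) by (metis imageI)
    qed
    have uU: "u \<in> ?U" "c u \<noteq> ?\<beta>" "?\<beta> < q" using u J\<beta>[of u] v Q colouring_lt[OF c] by auto
    obtain c' where c': "colouring E q ?U c'" "c' u = ?\<beta>"
      and sw: "\<And>x. c' x = c x \<or> c x = c u \<and> c' x = ?\<beta> \<or> c x = ?\<beta> \<and> c' x = c u"
      and un: "\<And>v'. v' \<in> ?U \<Longrightarrow> c v' = ?\<beta> \<Longrightarrow> \<not> E u v' \<Longrightarrow>
       (\<And>x y. x \<in> ?U \<Longrightarrow> y \<in> ?U \<Longrightarrow> E u x \<Longrightarrow> E x y \<Longrightarrow> E y v' \<Longrightarrow> c x = ?\<beta> \<Longrightarrow> c y = c u \<Longrightarrow> \<not> E u y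
           \<Longrightarrow> \<not> E x v' \<Longrightarrow> False) \<Longrightarrow> c' v' = ?\<beta>"
      using kempe_swap[OF c P5U uU] by blast
    \<comment> \<open>A chain reaching \<open>w\<close> would be an induced path \<open>u\<close>,
      \<open>x\<close>, \<open>y\<close>, \<open>w\<close> with \<open>x\<close> and
      \<open>y\<close> in \<open>K\<close>; it closes to an induced five-cycle through
      \<open>p\<close>.\<close>
    have unS: "c' w = ?\<beta>" if w: "w \<in> S" "c w = ?\<beta>" "\<And>y. y \<in> S \<Longrightarrow> E y w \<Longrightarrow> c y \<noteq> c u" for w
    proof (rule un)
      show "w \<in> ?U" "c w = ?\<beta>" using w by auto
      show nuw: "\<not> E u w" using w(3)[OF u(1)] by blast
      fix x y
      assume xy: "x \<in> ?U" "y \<in> ?U" "E u x" "E x y" "E y w" "c x = ?\<beta>" "c y = c u" "\<not> E u y" "\<not> E x w"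
      have "x \<in> K" using J\<beta>[of x] xy by blast
      moreover have "y \<in> K" using w(3)[of y] xy by blast
      ultimately have V: "x \<in> V" "y \<in> V" "u \<in> V" "w \<in> V" and np: "\<not> E p x" "\<not> E p y"
        using SK u w p(2) by auto
      show False
        by (rule C5_freeD[OF C5 p(1) V(3,1,2,4)]) (use xy np p(3) u w nuw sym in \<open>blast+\<close>)
    qed
    \<comment> \<open>Only a vertex of \<open>Q\<close> coloured \<beta> could change. It would have
      a neighbour in \<open>S\<close> with the colour of \<open>u\<close>; by transitivity this
      neighbour is complete to the rest of \<open>Q\<close>, so it lies in \<open>Q\<close> by
      maximality, although its colour is foreign to \<open>Q\<close>.\<close>
    have Qsame: "c' x = c x" if x: "x \<in> Q" for x
    proof (cases "c x = ?\<beta>")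
      case True
      have "c' x = ?\<beta>"
      proof (rule unS)
        show "x \<in> S" "c x = ?\<beta>" using x Q True by auto
        fix y assume y: "y \<in> S" "E y x"
        have "E y z" if z: "z \<in> Q" "z \<noteq> y" for z
        proof (cases "z = x")
          case False
          then have Exz: "E x z" using Q(2) x z(1) unfolding clique_def by auto
          have "x \<in> S" "z \<in> S" using x z(1) Q(1) by auto
          from tr[OF y(1) this y(2) Exz] z(2) show ?thesis by simp
        qed (use y in simp)
        then have "clique E (insert y Q)"
        proof -
          assume n: "\<And>z. z \<in> Q \<Longrightarrow> z \<noteq> y \<Longrightarrow> E y z"
          show ?thesis
            unfolding clique_def
          proof (intro ballI impI)
            fix v w assume "v \<in> insert y Q" "w \<in> insert y Q" "v \<noteq> w"
            then consider "v = y" "w \<in> Q" "w \<noteq> y" | "w = y" "v \<in> Q" "v \<noteq> y" | "v \<in> Q" "w \<in> Q" by blast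
            then show "E v w"
            proof cases
              case 1
              then show ?thesis using n by simp
            next
              case 2
              then show ?thesis using sym[OF n] by simp
            next
              case 3
              then show ?thesis using Q(2) \<open>v \<noteq> w\<close> unfolding clique_def by simp
            qed
          qed
        qed
        then have "card (insert y Q) \<le> card Q" using Q(3)[of "insert y Q"] Q(1) y(1) by simp
        then have "y \<in> Q" using finQ by (cases "y \<in> Q") simp_all
        then show "c y \<noteq> c u" using u(2) by (metis imageI)
      qed
      then show ?thesis using True by simp
    next
      case False
      moreover have "c x \<noteq> c u" using u(2) x by (metis imageI)
      ultimately show ?thesis using sw[of x] by simp
    qed
    then have imQ: "c' ` Q = c ` Q" by (simp cong: image_cong)
    define A where "A = {x \<in> S. c x \<in> c ` Q}"
    define A' where "A' = {x \<in> S. c' x \<in> c ` Q}"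
    have ex: "\<exists>y. y \<in> S \<and> E y x \<and> c y = c u \<and> c' y = ?\<beta> \<and> y \<noteq> u \<and> c x = ?\<beta>"
      if x: "x \<in> A" "c' x \<notin> c ` Q" for x
    proof -
      have xS: "x \<in> S" "c x \<in> c ` Q" using x unfolding A_def by auto
      then have cx: "c x = ?\<beta>" "c' x = c u" using sw[of x] x u by auto
      then have "c' x \<noteq> ?\<beta>" using uU by simp
      then obtain y where y: "y \<in> S" "E y x" "c y = c u" using unS[OF xS(1) cx(1)] by blast
      have "c' y \<noteq> c' x" using colouring_neq[OF c'(1), of y x] y xS by blast
      then have "c' y = ?\<beta>" using sw[of y] y cx by auto
      moreover have "y \<noteq> u" using J\<beta>[of x] xS cx y by blast
      ultimately show ?thesis using y cx by blast
    qed
    \<comment> \<open>A vertex losing its palette colour is charged to a neighbour in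
      \<open>S\<close> that gains one. Two vertices charged to the same neighbour would be adjacent
      by transitivity, although both were coloured \<beta>.\<close>
    define g where "g = (\<lambda>x. if c' x \<in> c ` Q then x
      else SOME y. y \<in> S \<and> E y x \<and> c y = c u \<and> c' y = ?\<beta> \<and> y \<noteq> u \<and> c x = ?\<beta>)"
    have g: "g x \<in> S \<and> E (g x) x \<and> c (g x) = c u \<and> c' (g x) = ?\<beta> \<and> g x \<noteq> u \<and> c x = ?\<beta>"
      if "x \<in> A" "c' x \<notin> c ` Q" for x
      unfolding g_def if_not_P[OF that(2)] by (rule someI_ex[OF ex[OF that]])
    have g': "g x = x" if "c' x \<in> c ` Q" for x using that unfolding g_def by simp
    have "inj_on g A"
    proof (rule inj_onI)
      fix x y assume xy: "x \<in> A" "y \<in> A" "g x = g y"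
      have cA: "c x \<noteq> c u" "c y \<noteq> c u" using xy u unfolding A_def by auto
      consider "c' x \<in> c ` Q" "c' y \<in> c ` Q" | "c' x \<in> c ` Q" "c' y \<notin> c ` Q"
        | "c' x \<notin> c ` Q" "c' y \<in> c ` Q" | "c' x \<notin> c ` Q" "c' y \<notin> c ` Q" by blast
      then show "x = y"
      proof cases
        case 4
        have gx: "g x \<in> S" "E (g x) x" "c x = ?\<beta>" and gy: "E (g x) y" "c y = ?\<beta>"
          using g[OF xy(1) 4(1)] g[OF xy(2) 4(2)] xy(3) by auto
        have S: "x \<in> S" "y \<in> S" using xy unfolding A_def by auto
        show ?thesis
        proof (rule ccontr)
          assume "x \<noteq> y"
          then have "E x y" using tr[OF S(1) gx(1) S(2) sym[OF gx(2)] gy(1)] by blast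
          then show False using colouring_neq[OF c, of x y] S gx gy by auto
        qed
      qed (use g g' xy cA in metis)+
    qed
    moreover have "g ` A \<subseteq> A' - {u}"
    proof
      fix z assume "z \<in> g ` A"
      then obtain x where x: "x \<in> A" "z = g x" by blast
      show "z \<in> A' - {u}"
      proof (cases "c' x \<in> c ` Q")
        case True
        then show ?thesis using g'[OF True] x u unfolding A_def A'_def by auto
      next
        case False
        then show ?thesis using g[OF x(1) False] x v unfolding A'_def by auto
      qed
    qed
    moreover have "finite A'" using finS unfolding A'_def by simp
    ultimately have "card A \<le> card (A' - {u})" by (intro card_inj_on_le) auto
    \<comment> \<open>\<open>u\<close> gains a palette colour without being charged, so the count
      rises strictly.\<close>
    moreover have "u \<in> A'" using u c' v unfolding A'_def by blast
    then have "card (A' - {u}) < card A'" using \<open>finite A'\<close> by (rule card_Diff1_less[rotated])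
    ultimately have "m c < m c'" unfolding m_def A_def A'_def imQ by simp
    then show False using max[OF c'(1)] by simp
  qed
  then show ?thesis using that c by blast
qed

theorem C5_free_colourable:
  assumes "finite V" "P5_free E V" "gem_free E V" "C5_free E V"
    and "\<And>Q. Q \<subseteq> V \<Longrightarrow> clique E Q \<Longrightarrow> card Q \<le> q"
  shows "colourable E q V"
  using assms
proof (induction V arbitrary: q rule: finite_psubset_induct)
  case (psubset V)
  note P5 = psubset(3) and gem = psubset(4) and C5 = psubset(5) and small = psubset(6)
  have sub: "colourable E r U" if "U \<subset> V" "\<And>Q. Q \<subseteq> U \<Longrightarrow> clique E Q \<Longrightarrow> card Q \<le> r" for U r
    by (rule psubset(2)[OF that(1)])
      (use that P5_free_subset[OF P5] gem_free_subset[OF gem] C5_free_subset[OF C5] in auto)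
  show ?case
  proof (rule ccontr)
    assume nc: "\<not> colourable E q V"
    have "colourable E q U" if "U \<subset> V" for U
      using sub[OF that] small that by (metis order.trans psubset_imp_subset)
    then have crit: "critical E q V" using nc unfolding critical_def by blast
    have hom: "clique E M" if "homogeneous E V M" "M \<noteq> V" for M
    proof (rule homogeneous_clique[OF crit psubset(1) that(1)])
      have "M \<subset> V" using that unfolding homogeneous_def by blast
      then show "colourable E r M" if "\<And>Q. Q \<subseteq> M \<Longrightarrow> clique E Q \<Longrightarrow> card Q \<le> r" for r
        using sub that by blast
    qed
    have "\<not> clique E V"
    proof
      assume "clique E V"
      then have "card V \<le> q" using small by blast
      then have "colourable E q ({} \<union> V)"
        by (intro extend_colouring[where N = "{}" and c = "\<lambda>_. 0"])
          (use psubset(1) in \<open>auto simp: colouring_def\<close>)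
      then show False using nc by simp
    qed
    then obtain x y where xy: "x \<in> V" "y \<in> V" "x \<noteq> y" "\<not> E x y" unfolding clique_def by blast
    obtain p K where pV: "p \<in> V" and K1: "K \<noteq> {}" "K \<subseteq> V" and p1: "p \<notin> K" "\<And>k. k \<in> K \<Longrightarrow> \<not> E p k"
      and K2: "\<And>a b. a \<in> K \<Longrightarrow> b \<in> K \<Longrightarrow> (a, b) \<in> reach K"
      and Kmax: "\<And>w s k. w \<in> V - K \<Longrightarrow> (\<And>k. k \<in> K \<Longrightarrow> \<not> E w k) \<Longrightarrow> s \<in> V - K \<Longrightarrow> k \<in> K \<Longrightarrow> E s k \<Longrightarrow> E w s"
    proof (rule maximal_nonneighbour_component[OF psubset(1) xy])
      fix v K
      assume "v \<in> V" "K \<noteq> {}" "K \<subseteq> V" "v \<notin> K" "\<And>k. k \<in> K \<Longrightarrow> \<not> E v k"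
        "\<And>a b. a \<in> K \<Longrightarrow> b \<in> K \<Longrightarrow> (a, b) \<in> reach K"
        "\<And>w s k. w \<in> V - K \<Longrightarrow> (\<And>k. k \<in> K \<Longrightarrow> \<not> E w k) \<Longrightarrow> s \<in> V - K \<Longrightarrow> k \<in> K \<Longrightarrow> E s k \<Longrightarrow> E w s"
      then show thesis by (rule that)
    qed
    note p = pV p1 and K = K1 K2
    define S where "S = {s \<in> V - K. \<exists>k\<in>K. E s k}"
    define W where "W = V - K - S"
    have WS: "E w s" if "w \<in> V - K - S" "s \<in> S" for w s
      using that Kmax[of w s] unfolding S_def by blast
    have WK: "\<not> E w k" if "w \<in> V - K - S" "k \<in> K" for w k using that unfolding S_def by blast
    have pW: "p \<in> W" using p unfolding W_def S_def by blast
    have "homogeneous E V W"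
      unfolding homogeneous_def W_def using WS WK sym by blast
    moreover have "W \<noteq> V" using K unfolding W_def by blast
    ultimately have W: "clique E W" by (rule hom)
    have fin: "finite W" "finite S" using psubset(1) unfolding W_def S_def by auto
    obtain Q where Q: "Q \<subseteq> S" "clique E Q" "\<And>Q'. Q' \<subseteq> S \<Longrightarrow> clique E Q' \<Longrightarrow> card Q' \<le> card Q"
    proof -
      have "\<exists>Q. (Q \<subseteq> S \<and> clique E Q) \<and> (\<forall>Q'. Q' \<subseteq> S \<and> clique E Q' \<longrightarrow> card Q' \<le> card Q)"
        by (rule ex_has_greatest_nat[where k = "{}" and b = "Suc (card S)"])
          (use card_mono[OF fin(2)] in \<open>auto simp: clique_def less_Suc_eq_le\<close>)
      then show ?thesis using that by blast
    qed
    have SV: "S \<subseteq> V" "S \<inter> K = {}" unfolding S_def by auto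
    have "S \<union> K \<subset> V" using SV K pW unfolding W_def by blast
    then obtain c0 where c0: "colouring E q (S \<union> K) c0"
      using crit unfolding critical_def colourable_def by blast
    have pS: "E p s" if "s \<in> S" for s using WS[OF _ that] pW unfolding W_def by blast
    have tr: "E a c" if "a \<in> S" "b \<in> S" "c \<in> S" "E a b" "E b c" "a \<noteq> c" for a b c
      by (rule attachment_transitive[OF P5 gem p K(2,3) S_def WS hom that])
    obtain c where c: "colouring E q (S \<union> K) c" "c ` S \<subseteq> c ` Q"
    proof (rule recolour_attachment[OF psubset(1) P5 C5 p(1) _ _ SV(1) K(2) SV(2) _ Q(1,2) _ c0])
      fix c assume "colouring E q (S \<union> K) c" "c ` S \<subseteq> c ` Q"
      then show thesis by (rule that)
    next
      fix k assume "k \<in> K" then show "\<not> E p k" by (rule p(3))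
    next
      fix s assume "s \<in> S" then show "E p s" by (rule pS)
    next
      fix a b c assume "a \<in> S" "b \<in> S" "c \<in> S" "E a b" "E b c" "a \<noteq> c"
      then show "E a c" by (rule tr)
    next
      fix Q' assume "Q' \<subseteq> S" "clique E Q'" then show "card Q' \<le> card Q" by (rule Q(3))
    qed
    \<comment> \<open>This is where the clique bound enters: the colours on \<open>S\<close> are at
      most as many as \<open>Q\<close> has vertices, so enough remain for \<open>W\<close>, which
      has no neighbours in \<open>K\<close>.\<close>
    have "clique E (Q \<union> W)"
      using Q(1,2) W WS sym unfolding clique_def W_def by blast
    then have "card (Q \<union> W) \<le> q" using small[of "Q \<union> W"] Q(1) SV(1) unfolding W_def by blast
    moreover have "card (Q \<union> W) = card Q + card W"
      using fin finite_subset[OF Q(1)] Q(1) unfolding W_def by (intro card_Un_disjoint) auto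
    moreover have "card (c ` S) \<le> card Q"
      using card_mono[OF _ c(2)] card_image_le[of Q c] finite_subset[OF Q(1) fin(2)] by fastforce
    ultimately have "card (c ` S) + card W \<le> q" by simp
    then have "colourable E q ((S \<union> K) \<union> W)"
      by (intro extend_colouring[OF c(1) fin(1), where N = S])
        (use fin WK in \<open>auto simp: W_def\<close>)
    moreover have "(S \<union> K) \<union> W = V" using SV(1) K(2) unfolding W_def by blast
    ultimately show False using nc by simp
  qed
qed

text \<open>Four consecutive vertices of an induced five-cycle in \<open>M\<close> would form a gem
  with the common neighbour \<open>z\<close>. So \<open>M\<close> is free of five-cycles, and its
  chromatic number is its clique number.\<close>

lemma critical_homogeneous_clique:
  assumes crit: "critical E q V" and fin: "finite V" and gem: "gem_free E V" and P5: "P5_free E V"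
    and M: "homogeneous E V M" and z: "z \<in> V - M" "\<And>x. x \<in> M \<Longrightarrow> E z x"
  shows "clique E M"
proof (rule homogeneous_clique[OF crit fin M])
  have MV: "M \<subseteq> V" using M unfolding homogeneous_def by blast
  have C5: "C5_free E M"
    unfolding C5_free_def
  proof (intro ballI impI)
    fix a b c d e assume "a \<in> M" "b \<in> M" "c \<in> M" "d \<in> M" "e \<in> M" "E a b" "E b c" "E c d"
    then show "E a c \<or> E a d \<or> E b d \<or> E b e \<or> E c e"
      using gem_freeD[OF gem, of a b c d z] z MV by blast
  qed
  show "colourable E r M" if "\<And>Q. Q \<subseteq> M \<Longrightarrow> clique E Q \<Longrightarrow> card Q \<le> r" for r
    by (rule C5_free_colourable[OF finite_subset[OF MV fin] P5_free_subset[OF P5 MV]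
          gem_free_subset[OF gem MV] C5 that])
qed

end

section \<open>Rigid patterns\<close>

text \<open>A pattern is a graph on \<open>{..<n}\<close>, given by the list of its adjacency lists.\<close>

type_synonym pattern = "nat list list"

definition embeds :: "('a \<Rightarrow> 'a \<Rightarrow> bool) \<Rightarrow> 'a set \<Rightarrow> pattern \<Rightarrow> (nat \<Rightarrow> 'a) \<Rightarrow> bool" where
  "embeds E V B f \<longleftrightarrow> inj_on f {..<length B} \<and> f ` {..<length B} \<subseteq> V \<and>
     (\<forall>i<length B. \<forall>j<length B. E (f i) (f j) \<longleftrightarrow> j \<in> set (B ! i))"

definition contains :: "('a \<Rightarrow> 'a \<Rightarrow> bool) \<Rightarrow> 'a set \<Rightarrow> pattern \<Rightarrow> bool" where
  "contains E V B \<longleftrightarrow> (\<exists>f. embeds E V B f)"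

text \<open>\<open>extended_adj B pos\<close> is the adjacency of \<open>B\<close> with a further vertex \<open>length B\<close> whose
  neighbours are \<open>pos\<close>. A certificate is an embedding of \<open>H\<close> into this graph that only uses
  vertices whose adjacency to the new vertex has been decided.\<close>

definition extended_adj :: "pattern \<Rightarrow> nat list \<Rightarrow> nat \<Rightarrow> nat \<Rightarrow> bool" where
  "extended_adj B pos i j = (if i = length B then j \<in> set pos
     else if j = length B then i \<in> set pos else j \<in> set (B ! i))"

definition certifies :: "pattern \<Rightarrow> pattern \<Rightarrow> nat list \<Rightarrow> nat list \<Rightarrow> nat list \<Rightarrow> bool" where
  "certifies H B pos neg l \<longleftrightarrow> length l = length H \<and> distinct l \<and>
     list_all (\<lambda>i. i = length B \<or> i < length B \<and> (i \<in> set pos \<or> i \<in> set neg)) l \<and>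
     list_all (\<lambda>a. list_all (\<lambda>b. extended_adj B pos (l ! a) (l ! b) = (b \<in> set (H ! a)))
       [0..<length l]) [0..<length l]"

text \<open>\<open>X\<close> lists exceptional types. In the twin case position \<open>i\<close> is
  left open: whether a twin is adjacent to the vertex it imitates is only decided once its class is
  known to be a clique.\<close>

definition regular_type :: "pattern \<Rightarrow> nat list list \<Rightarrow> nat list \<Rightarrow> bool" where
  "regular_type B X t \<longleftrightarrow>
     list_ex (\<lambda>s. list_all (\<lambda>j. j \<in> set t \<longleftrightarrow> j \<in> set s) [0..<length B]) X \<or>
     list_ex (\<lambda>i. list_all (\<lambda>j. j = i \<or> (j \<in> set t \<longleftrightarrow> j \<in> set (B ! i))) [0..<length B])
       [0..<length B]"

text \<open>An explicit certificate, so that evaluation verifies the case distinction instead of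
  searching for it.\<close>

datatype type_tree = Split nat type_tree type_tree | Excluded nat "nat list" | Regular

fun check_tree :: "pattern list \<Rightarrow> pattern \<Rightarrow> nat list list \<Rightarrow> nat list \<Rightarrow> nat list \<Rightarrow> type_tree \<Rightarrow> bool" where
  "check_tree F B X pos neg (Split i a b) \<longleftrightarrow> i < length B \<and>
     check_tree F B X (i # pos) neg a \<and> check_tree F B X pos (i # neg) b"
| "check_tree F B X pos neg (Excluded k l) \<longleftrightarrow> k < length F \<and> certifies (F ! k) B pos neg l"
| "check_tree F B X pos neg Regular \<longleftrightarrow>
     list_all (\<lambda>i. i \<in> set pos \<or> i \<in> set neg) [0..<length B] \<and> regular_type B X pos"

definition flip :: "nat \<Rightarrow> nat list \<Rightarrow> nat list" where
  "flip i t = (if i \<in> set t then removeAll i t else i # t)"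

text \<open>If \<open>x\<close> is a twin of \<open>i\<close> and \<open>y\<close> a twin of \<open>j\<close> with the wrong adjacency, then replacing \<open>i\<close>
  by \<open>x\<close> in the pattern flips position \<open>i\<close> in the type of \<open>y\<close>. Usually the flipped type is not
  regular. In the exceptional situation, \<open>y\<close> becomes a twin of \<open>m\<close>, and after also replacing \<open>m\<close> by
  \<open>y\<close> the old vertex \<open>i\<close> has an irregular type.\<close>

definition flip_irregular :: "pattern \<Rightarrow> nat list list \<Rightarrow> nat \<Rightarrow> nat \<Rightarrow> bool" where
  "flip_irregular B X i j \<longleftrightarrow>
     \<not> regular_type B X (flip i (B ! j)) \<and> \<not> regular_type B X (flip i (j # B ! j))"

definition double_flip_irregular :: "pattern \<Rightarrow> nat list list \<Rightarrow> nat \<Rightarrow> nat \<Rightarrow> bool" where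
  "double_flip_irregular B X i j \<longleftrightarrow> i \<in> set (B ! j) \<and> \<not> regular_type B X (flip i (j # B ! j)) \<and>
     list_ex (\<lambda>m. m \<noteq> i \<and> m \<noteq> j \<and>
       list_all (\<lambda>k. k \<in> set (B ! m) \<longleftrightarrow> k \<noteq> i \<and> k \<in> set (B ! j)) [0..<length B] \<and>
       \<not> regular_type B X (m # B ! i) \<and> \<not> regular_type B X (i # m # B ! i)) [0..<length B]"

text \<open>The flip conditions, in either role of \<open>i\<close> and \<open>j\<close>, fix all
  adjacencies between different twin classes; the separating \<open>k\<close> makes these classes
  disjoint.\<close>

definition rigid :: "pattern \<Rightarrow> nat list list \<Rightarrow> bool" where
  "rigid B X \<longleftrightarrow>
     list_all (\<lambda>i. list_all (\<lambda>j. i = j \<or>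
         (flip_irregular B X i j \<or> flip_irregular B X j i \<or>
          double_flip_irregular B X i j \<or> double_flip_irregular B X j i) \<and>
         list_ex (\<lambda>k. k \<noteq> i \<and> k \<noteq> j \<and> (k \<in> set (B ! i)) \<noteq> (k \<in> set (B ! j))) [0..<length B])
       [0..<length B]) [0..<length B]"

text \<open>A vertex without neighbours in the copy that sees a twin of \<open>j\<close> would get
  the type \<open>[j]\<close> once that twin is exchanged for \<open>j\<close>. A neighbour
  \<open>k\<close> of each \<open>j\<close> later serves as a common neighbour of the class of
  \<open>j\<close>.\<close>

definition no_isolated :: "pattern \<Rightarrow> bool" where
  "no_isolated B \<longleftrightarrow> B \<noteq> [] \<and> list_all (\<lambda>j. \<not> regular_type B [[]] [j] \<and>
     list_ex (\<lambda>k. k \<in> set (B ! j)) [0..<length B]) [0..<length B]"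

definition expansion_of :: "('a \<Rightarrow> 'a \<Rightarrow> bool) \<Rightarrow> 'a set \<Rightarrow> pattern \<Rightarrow> ('a \<Rightarrow> nat) \<Rightarrow> bool" where
  "expansion_of E V B cl \<longleftrightarrow> (\<forall>x\<in>V. cl x < length B) \<and> (\<forall>i<length B. \<exists>x\<in>V. cl x = i) \<and>
     (\<forall>x\<in>V. \<forall>y\<in>V. E x y \<longleftrightarrow> x \<noteq> y \<and> (cl x = cl y \<or> cl y \<in> set (B ! cl x)))"

lemma embedsD:
  assumes "embeds E V B f"
  shows "inj_on f {..<length B}" "\<And>i. i < length B \<Longrightarrow> f i \<in> V"
    "\<And>i j. i < length B \<Longrightarrow> j < length B \<Longrightarrow> E (f i) (f j) \<longleftrightarrow> j \<in> set (B ! i)"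
  using assms unfolding embeds_def by auto

definition type_of :: "('a \<Rightarrow> 'a \<Rightarrow> bool) \<Rightarrow> pattern \<Rightarrow> (nat \<Rightarrow> 'a) \<Rightarrow> 'a \<Rightarrow> nat list" where
  "type_of E B f x = filter (\<lambda>i. E x (f i)) [0..<length B]"

lemma type_of_iff: "i \<in> set (type_of E B f x) \<longleftrightarrow> i < length B \<and> E x (f i)"
  unfolding type_of_def by auto

lemma regular_type_cong:
  assumes "\<And>j. j < length B \<Longrightarrow> j \<in> set t \<longleftrightarrow> j \<in> set t'"
  shows "regular_type B X t = regular_type B X t'"
proof -
  have "(\<forall>j\<in>set [0..<length B]. Q j \<or> (j \<in> set t \<longleftrightarrow> P j)) \<longleftrightarrow>
      (\<forall>j\<in>set [0..<length B]. Q j \<or> (j \<in> set t' \<longleftrightarrow> P j))" for P Q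
    using assms by auto
  from this[of "\<lambda>_. False"] this show ?thesis
    unfolding regular_type_def list_all_iff list_ex_iff by simp
qed

definition twin_class :: "('a \<Rightarrow> 'a \<Rightarrow> bool) \<Rightarrow> 'a set \<Rightarrow> pattern \<Rightarrow> (nat \<Rightarrow> 'a) \<Rightarrow> nat \<Rightarrow> 'a set" where
  "twin_class E V B f i = {x \<in> V. \<forall>k<length B. k \<noteq> i \<longrightarrow> (E x (f k) \<longleftrightarrow> k \<in> set (B ! i))}"

section \<open>From decision trees to regular types\<close>

context adjacency
begin

lemma contains_if_certifies:
  assumes f: "embeds E V B f" and x: "x \<in> V" "x \<notin> f ` {..<length B}"
    and pos: "\<And>i. i \<in> set pos \<Longrightarrow> i < length B \<and> E x (f i)"
    and neg: "\<And>i. i \<in> set neg \<Longrightarrow> \<not> E x (f i)"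
    and cert: "certifies H B pos neg l"
  shows "contains E V H"
proof -
  let ?n = "length B"
  define g where "g = f(?n := x)"
  have l: "length l = length H" "distinct l"
    "\<And>i. i \<in> set l \<Longrightarrow> i = ?n \<or> i < ?n \<and> (i \<in> set pos \<or> i \<in> set neg)"
    "\<And>a b. a < length l \<Longrightarrow> b < length l \<Longrightarrow> extended_adj B pos (l ! a) (l ! b) \<longleftrightarrow> b \<in> set (H ! a)"
    using cert unfolding certifies_def by (auto simp: list_all_iff)
  have inj: "inj_on g {..?n}"
    using embedsD(1)[OF f] x(2) unfolding g_def inj_on_def by (auto simp: less_le)
  have adj: "E (g i) (g j) \<longleftrightarrow> extended_adj B pos i j" if ij: "i \<in> set l" "j \<in> set l" for i j
  proof -
    consider "i = ?n" "j = ?n" | "i = ?n" "j < ?n" | "i < ?n" "j = ?n" | "i < ?n" "j < ?n"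
      using l(3)[OF ij(1)] l(3)[OF ij(2)] by blast
    then show ?thesis
    proof cases
      case 1
      then show ?thesis using irrefl pos unfolding g_def extended_adj_def by auto
    next
      case 2
      then show ?thesis using l(3)[OF ij(2)] pos neg unfolding g_def extended_adj_def by auto
    next
      case 3
      then show ?thesis
        using l(3)[OF ij(1)] pos neg sym_iff[of "f i" x]
        unfolding g_def extended_adj_def by auto
    next
      case 4
      then show ?thesis using embedsD(3)[OF f] unfolding g_def extended_adj_def by auto
    qed
  qed
  have "embeds E V H (\<lambda>a. g (l ! a))"
    unfolding embeds_def
  proof (intro conjI allI impI)
    show "inj_on (\<lambda>a. g (l ! a)) {..<length H}"
    proof (rule inj_onI)
      fix a b assume ab: "a \<in> {..<length H}" "b \<in> {..<length H}" "g (l ! a) = g (l ! b)"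
      have "l ! a \<in> set l" "l ! b \<in> set l" using ab l(1) by simp_all
      then have "l ! a \<in> {..?n}" "l ! b \<in> {..?n}" using l(3) by fastforce+
      then have "l ! a = l ! b" using inj ab(3) unfolding inj_on_def by blast
      then show "a = b" using l(1,2) ab by (simp add: nth_eq_iff_index_eq)
    qed
    show "(\<lambda>a. g (l ! a)) ` {..<length H} \<subseteq> V"
    proof
      fix z assume "z \<in> (\<lambda>a. g (l ! a)) ` {..<length H}"
      then obtain a where a: "a < length l" "z = g (l ! a)" using l(1) by auto
      then show "z \<in> V" using l(3)[OF nth_mem[OF a(1)]] x(1) embedsD(2)[OF f] unfolding g_def by auto
    qed
    show "E (g (l ! i)) (g (l ! j)) \<longleftrightarrow> j \<in> set (H ! i)" if "i < length H" "j < length H" for i j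
      using adj l that by simp
  qed
  then show ?thesis unfolding contains_def by blast
qed

lemma regular_type_if_check_tree:
  assumes f: "embeds E V B f" and x: "x \<in> V" "x \<notin> f ` {..<length B}"
    and F: "\<And>H. H \<in> set F \<Longrightarrow> \<not> contains E V H"
  shows "check_tree F B X pos neg T \<Longrightarrow> (\<And>i. i \<in> set pos \<Longrightarrow> i < length B \<and> E x (f i)) \<Longrightarrow>
    (\<And>i. i \<in> set neg \<Longrightarrow> \<not> E x (f i)) \<Longrightarrow> regular_type B X (type_of E B f x)"
proof (induction T arbitrary: pos neg)
  case (Split i a b)
  show ?case
  proof (cases "E x (f i)")
    case True
    show ?thesis by (rule Split.IH(1)[of "i # pos" neg]) (use Split.prems True in auto)
  next
    case False
    show ?thesis by (rule Split.IH(2)[of pos "i # neg"]) (use Split.prems False in auto)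
  qed
next
  case (Excluded k l)
  then have "contains E V (F ! k)"
    using contains_if_certifies[OF f x, of pos neg "F ! k" l] by auto
  then show ?case using F Excluded.prems(1) by simp
next
  case Regular
  have "regular_type B X (type_of E B f x) = regular_type B X pos"
  proof (rule regular_type_cong)
    fix j assume "j < length B"
    then have "j \<in> set pos \<or> j \<in> set neg"
      using Regular.prems(1) by (simp add: list_all_iff)
    then show "j \<in> set (type_of E B f x) \<longleftrightarrow> j \<in> set pos"
      using Regular.prems(2,3) \<open>j < length B\<close> unfolding type_of_iff by blast
  qed
  then show ?case using Regular.prems(1) by simp
qed

lemma regular_type_if_checked:
  assumes "check_tree F B X [] [] T" "\<And>H. H \<in> set F \<Longrightarrow> \<not> contains E V H"
    and f: "embeds E V B f" and x: "x \<in> V"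
  shows "regular_type B X (type_of E B f x)"
proof (cases "x \<in> f ` {..<length B}")
  case False
  then show ?thesis using regular_type_if_check_tree[OF f x False assms(2,1)] by simp
next
  case True
  then obtain i where i: "i < length B" "x = f i" by blast
  then have "\<forall>j<length B. j \<in> set (type_of E B f x) \<longleftrightarrow> j \<in> set (B ! i)"
    using embedsD(3)[OF f] unfolding type_of_iff by blast
  then show ?thesis
    using i(1) unfolding regular_type_def by (auto simp: list_all_iff list_ex_iff)
qed

end

text \<open>Regularity is required for every induced copy of \<open>B\<close>, because vertices of a
  given copy are exchanged for twins and the types are then read off the new copy.\<close>

locale rigid_pattern = adjacency E for E :: "'a \<Rightarrow> 'a \<Rightarrow> bool" +
  fixes V :: "'a set" and B :: pattern and X :: "nat list list"
  assumes regular: "\<And>f x. embeds E V B f \<Longrightarrow> x \<in> V \<Longrightarrow> regular_type B X (type_of E B f x)"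
    and rigid: "rigid B X"
begin

abbreviation "A \<equiv> twin_class E V B"

lemma rigidD:
  assumes "i < length B" "j < length B" "i \<noteq> j"
  shows "flip_irregular B X i j \<or> flip_irregular B X j i \<or>
      double_flip_irregular B X i j \<or> double_flip_irregular B X j i"
    "\<exists>k<length B. k \<noteq> i \<and> k \<noteq> j \<and> (k \<in> set (B ! i)) \<noteq> (k \<in> set (B ! j))"
proof -
  have "i \<in> set [0..<length B]" "j \<in> set [0..<length B]" using assms by simp_all
  from bspec[OF bspec[OF rigid[unfolded rigid_def list_all_iff] this(1)] this(2)] assms(3)
  show "flip_irregular B X i j \<or> flip_irregular B X j i \<or>
      double_flip_irregular B X i j \<or> double_flip_irregular B X j i"
    "\<exists>k<length B. k \<noteq> i \<and> k \<noteq> j \<and> (k \<in> set (B ! i)) \<noteq> (k \<in> set (B ! j))"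
    by (auto simp: list_ex_iff)
qed

lemma twin_classD:
  assumes "x \<in> A f i"
  shows "x \<in> V" "\<And>k. k < length B \<Longrightarrow> k \<noteq> i \<Longrightarrow> E x (f k) \<longleftrightarrow> k \<in> set (B ! i)"
  using assms unfolding twin_class_def by auto

lemma embeds_in_twin_class:
  assumes "embeds E V B f" "i < length B"
  shows "f i \<in> A f i"
  using embedsD[OF assms(1)] assms(2) unfolding twin_class_def by auto

lemma twin_class_disjoint:
  assumes "x \<in> A f i" "x \<in> A f j" "i < length B" "j < length B"
  shows "i = j"
proof (rule ccontr)
  assume "i \<noteq> j"
  then obtain k where "k < length B" "k \<noteq> i" "k \<noteq> j" "(k \<in> set (B ! i)) \<noteq> (k \<in> set (B ! j))"
    using rigidD(2) assms by blast
  then show False using twin_classD(2)[OF assms(1)] twin_classD(2)[OF assms(2)] by blast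
qed

lemma pattern_sym:
  assumes "embeds E V B f" "i < length B" "j < length B"
  shows "j \<in> set (B ! i) \<longleftrightarrow> i \<in> set (B ! j)"
  using embedsD(3)[OF assms(1)] assms(2,3) sym by blast

lemma embeds_update:
  assumes f: "embeds E V B f" and i: "i < length B" and x: "x \<in> A f i"
  shows "embeds E V B (f(i := x))"
proof -
  have ne: "x \<noteq> f k" if "k < length B" "k \<noteq> i" for k
    using twin_class_disjoint[OF x _ i that(1)] embeds_in_twin_class[OF f that(1)] that(2) by blast
  have "inj_on (f(i := x)) {..<length B}"
    using embedsD(1)[OF f] ne unfolding inj_on_def by (metis fun_upd_apply lessThan_iff)
  moreover have "f(i := x) ` {..<length B} \<subseteq> V"
    using embedsD(2)[OF f] twin_classD(1)[OF x] by auto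
  moreover have "E ((f(i := x)) a) ((f(i := x)) b) \<longleftrightarrow> b \<in> set (B ! a)"
    if "a < length B" "b < length B" for a b
  proof -
    have aa: "a \<notin> set (B ! a)" using embedsD(3)[OF f that(1) that(1)] irrefl by blast
    show ?thesis
    proof (cases "a = i"; cases "b = i")
      assume "a = i" "b = i"
      then show ?thesis using aa irrefl by simp
    next
      assume "a = i" "b \<noteq> i"
      then show ?thesis using twin_classD(2)[OF x that(2)] by simp
    next
      assume "a \<noteq> i" "b = i"
      then show ?thesis
        using twin_classD(2)[OF x that(1)] pattern_sym[OF f that] sym_iff[of "f a" x] by simp
    next
      assume "a \<noteq> i" "b \<noteq> i"
      then show ?thesis using embedsD(3)[OF f that] by simp
    qed
  qed
  ultimately show ?thesis unfolding embeds_def by blast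
qed

text \<open>In the new copy \<open>y\<close> has the type of a twin of \<open>j\<close> with
  position \<open>i\<close> flipped by the wrong adjacency. Whether \<open>y\<close> sees
  \<open>f j\<close> is open, hence the two lists.\<close>

lemma type_after_update:
  assumes f: "embeds E V B f" and ij: "i < length B" "j < length B" "i \<noteq> j"
    and x: "x \<in> A f i" and y: "y \<in> A f j" and wrong: "E x y \<longleftrightarrow> j \<notin> set (B ! i)"
  shows "regular_type B X (flip i (if E y (f j) then j # B ! j else B ! j))"
    "k < length B \<Longrightarrow> E y ((f(i := x)) k) \<longleftrightarrow> k \<in> set (flip i (if E y (f j) then j # B ! j else B ! j))"
proof -
  let ?f = "f(i := x)" and ?t = "if E y (f j) then j # B ! j else B ! j"
  have jj: "j \<notin> set (B ! j)" using embedsD(3)[OF f ij(2) ij(2)] irrefl by blast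
  have *: "k \<in> set (type_of E B ?f y) \<longleftrightarrow> k \<in> set (flip i ?t)" if k: "k < length B" for k
  proof (cases "k = i")
    case True
    then show ?thesis
      using wrong k ij pattern_sym[OF f ij(1,2)] sym_iff[of x y]
      unfolding type_of_iff flip_def by auto
  next
    case False
    have "k \<in> set (flip i ?t) \<longleftrightarrow> k \<in> set ?t" using False unfolding flip_def by auto
    moreover have "k \<in> set ?t \<longleftrightarrow> E y (f k)"
      using twin_classD(2)[OF y k] jj by (cases "k = j") auto
    ultimately show ?thesis using False k unfolding type_of_iff by simp
  qed
  then show "E y (?f k) \<longleftrightarrow> k \<in> set (flip i ?t)" if "k < length B" using that unfolding type_of_iff by blast
  have "regular_type B X (type_of E B ?f y) = regular_type B X (flip i ?t)"
    by (rule regular_type_cong) (rule *)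
  then show "regular_type B X (flip i ?t)"
    using regular[OF embeds_update[OF f ij(1) x] twin_classD(1)[OF y]] by simp
qed

lemma twin_class_adjacent_aux:
  assumes f: "embeds E V B f" and ij: "i < length B" "j < length B" "i \<noteq> j"
    and x: "x \<in> A f i" and y: "y \<in> A f j"
    and irr: "flip_irregular B X i j \<or> double_flip_irregular B X i j"
  shows "E x y \<longleftrightarrow> j \<in> set (B ! i)"
proof (rule ccontr)
  assume "\<not> (E x y \<longleftrightarrow> j \<in> set (B ! i))"
  then have wrong: "E x y \<longleftrightarrow> j \<notin> set (B ! i)" by blast
  note upd = type_after_update[OF f ij x y wrong]
  from irr show False
  proof
    assume "flip_irregular B X i j"
    then show False using upd(1) unfolding flip_irregular_def by (auto split: if_splits)
  next
    assume d: "double_flip_irregular B X i j"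
    have iB: "i \<in> set (B ! j)" and nt: "\<not> E y (f j)"
      using d upd(1) unfolding double_flip_irregular_def by (auto split: if_splits)
    obtain m where m: "m < length B" "m \<noteq> i" "m \<noteq> j"
      "\<And>k. k < length B \<Longrightarrow> k \<in> set (B ! m) \<longleftrightarrow> k \<noteq> i \<and> k \<in> set (B ! j)"
      "\<not> regular_type B X (m # B ! i)" "\<not> regular_type B X (i # m # B ! i)"
      using d unfolding double_flip_irregular_def list_ex_iff list_all_iff by auto
    let ?f = "f(i := x)"
    have f': "embeds E V B ?f" by (rule embeds_update[OF f ij(1) x])
    \<comment> \<open>Removing \<open>i\<close> from the neighbours of \<open>j\<close> yields those
      of \<open>m\<close>, so in the changed copy \<open>y\<close> can also replace
      \<open>m\<close>.\<close>
    have ym: "y \<in> A ?f m"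
      unfolding twin_class_def
    proof (intro CollectI conjI allI impI)
      show "y \<in> V" by (rule twin_classD(1)[OF y])
      fix k assume "k < length B" "k \<noteq> m"
      then show "E y (?f k) \<longleftrightarrow> k \<in> set (B ! m)"
        using upd(2)[of k] m(4)[of k] nt iB unfolding flip_def by auto
    qed
    let ?g = "?f(m := y)"
    have g: "embeds E V B ?g" by (rule embeds_update[OF f' m(1) ym])
    have ii: "i \<notin> set (B ! i)" using embedsD(3)[OF f ij(1) ij(1)] irrefl by blast
    have ji: "j \<in> set (B ! i)" using iB pattern_sym[OF f ij(1,2)] by blast
    have yi: "E (f i) y" using twin_classD(2)[OF y ij(1) ij(3)] iB sym by blast
    \<comment> \<open>The type of the displaced vertex \<open>f i\<close> in the copy containing
      \<open>x\<close> and \<open>y\<close>: it gains \<open>m\<close> because it sees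
      \<open>y\<close>, and possibly \<open>i\<close> because of \<open>x\<close>.\<close>
    let ?t = "if E (f i) x then i # m # B ! i else m # B ! i"
    have "regular_type B X (type_of E B ?g (f i)) = regular_type B X ?t"
    proof (rule regular_type_cong)
      fix k assume k: "k < length B"
      show "k \<in> set (type_of E B ?g (f i)) \<longleftrightarrow> k \<in> set ?t"
        using k yi ii m(2) embedsD(3)[OF f ij(1) k] unfolding type_of_iff by auto
    qed
    then show False using regular[OF g embedsD(2)[OF f ij(1)]] m(5,6) by (auto split: if_splits)
  qed
qed

lemma twin_class_adjacent:
  assumes f: "embeds E V B f" and ij: "i < length B" "j < length B" "i \<noteq> j"
    and x: "x \<in> A f i" and y: "y \<in> A f j"
  shows "E x y \<longleftrightarrow> j \<in> set (B ! i)"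
  using twin_class_adjacent_aux[OF f ij x y] twin_class_adjacent_aux[OF f ij(2,1) ij(3)[symmetric] y x]
    rigidD(1)[OF ij] pattern_sym[OF f ij(1,2)] sym_iff[of x y] by blast

text \<open>Exchanging \<open>f j\<close> for \<open>y\<close> would flip position \<open>j\<close>
  in the type of \<open>x\<close>. This controls vertices that belong to no twin class.\<close>

lemma twin_class_homogeneous_pair:
  assumes f: "embeds E V B f" and j: "j < length B" and y: "y \<in> A f j"
    and x: "x \<in> V" and irregular: "\<not> regular_type B X (flip j (type_of E B f x))"
  shows "E x y \<longleftrightarrow> E x (f j)"
proof (rule ccontr)
  assume wrong: "\<not> (E x y \<longleftrightarrow> E x (f j))"
  let ?f = "f(j := y)"
  have "regular_type B X (type_of E B ?f x)"
    by (rule regular[OF embeds_update[OF f j y] x])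
  moreover have "regular_type B X (type_of E B ?f x) = regular_type B X (flip j (type_of E B f x))"
  proof (rule regular_type_cong)
    fix k assume k: "k < length B"
    show "k \<in> set (type_of E B ?f x) \<longleftrightarrow> k \<in> set (flip j (type_of E B f x))"
      using wrong k unfolding flip_def by (cases "k = j") (auto simp: type_of_iff)
  qed
  ultimately show False using irregular by simp
qed

lemma twin_class_or_exceptional:
  assumes f: "embeds E V B f" and x: "x \<in> V"
  shows "(\<exists>i<length B. x \<in> A f i) \<or> (\<exists>s\<in>set X. \<forall>j<length B. E x (f j) \<longleftrightarrow> j \<in> set s)"
proof -
  have "regular_type B X (type_of E B f x)" by (rule regular[OF f x])
  then consider s where "s \<in> set X" "\<forall>j<length B. j \<in> set (type_of E B f x) \<longleftrightarrow> j \<in> set s"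
    | i where "i < length B" "\<forall>j<length B. j = i \<or> (j \<in> set (type_of E B f x) \<longleftrightarrow> j \<in> set (B ! i))"
    unfolding regular_type_def list_all_iff list_ex_iff by auto
  then show ?thesis
  proof cases
    case 1
    then have "\<forall>j<length B. E x (f j) \<longleftrightarrow> j \<in> set s" unfolding type_of_iff by simp
    then show ?thesis using 1(1) by (intro disjI2 bexI)
  next
    case 2
    then have "x \<in> A f i" using x unfolding type_of_iff twin_class_def by auto
    then show ?thesis using 2(1) by (intro disjI1 exI conjI)
  qed
qed

text \<open>The class is complete to \<open>f k\<close>, which supplies the common neighbour that
  \<open>critical_homogeneous_clique\<close> asks for.\<close>

lemma twin_class_clique:
  assumes crit: "critical E q V" "finite V" "P5_free E V" "gem_free E V"
    and f: "embeds E V B f" and i: "i < length B" "k < length B" "k \<in> set (B ! i)"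
    and unmixed: "\<And>x a. x \<in> V - A f i \<Longrightarrow> a \<in> A f i \<Longrightarrow> E x a \<longleftrightarrow> E x (f i)"
  shows "clique E (A f i)"
proof (rule critical_homogeneous_clique[OF crit(1,2,4,3)])
  show "homogeneous E V (A f i)"
    unfolding homogeneous_def
  proof (intro conjI ballI)
    show "A f i \<subseteq> V" using twin_classD(1) by blast
    fix x a b assume x: "x \<in> V - A f i" "a \<in> A f i" "b \<in> A f i"
    show "E x a \<longleftrightarrow> E x b" using unmixed[OF x(1,2)] unmixed[OF x(1,3)] by simp
  qed
  have ne: "i \<noteq> k" using embedsD(3)[OF f i(1) i(1)] i(3) irrefl by blast
  have fk: "f k \<in> A f k" by (rule embeds_in_twin_class[OF f i(2)])
  then show "f k \<in> V - A f i" using twin_class_disjoint[OF _ fk i(1,2)] ne twin_classD(1) by blast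
  fix x assume "x \<in> A f i"
  then have "E x (f k)" using twin_class_adjacent[OF f i(1,2) ne _ fk] i(3) by blast
  then show "E (f k) x" by (rule sym)
qed

text \<open>Vertices of the empty type see no twin either, so they are cut off from the rest. A
  critical graph cannot be split in this way, hence the twin classes cover it.\<close>

lemma expansion_if_critical:
  assumes crit: "critical E q V" and fin: "finite V" and P5: "P5_free E V" and gem: "gem_free E V"
    and f: "embeds E V B f" and X: "X = [[]]" and B: "no_isolated B"
  shows "\<exists>cl. expansion_of E V B cl"
proof -
  let ?n = "length B"
  have iso: "\<not> regular_type B X [j]" "\<exists>k<?n. k \<in> set (B ! j)" if "j < ?n" for j
  proof -
    have "j \<in> set [0..<?n]" using that by simp
    from bspec[OF conjunct2[OF B[unfolded no_isolated_def list_all_iff]] this]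
    show "\<not> regular_type B X [j]" "\<exists>k<?n. k \<in> set (B ! j)" using X by (auto simp: list_ex_iff)
  qed
  define Z where "Z = {x \<in> V. \<forall>j<?n. \<not> E x (f j)}"
  have Zor: "x \<in> Z \<or> (\<exists>i<?n. x \<in> A f i)" if "x \<in> V" for x
    using twin_class_or_exceptional[OF f that] that unfolding X Z_def by auto
  have Zanti: "\<not> E z y" if z: "z \<in> Z" and y: "y \<in> V - Z" for z y
  proof -
    obtain j where j: "j < ?n" "y \<in> A f j" using Zor y by blast
    have "type_of E B f z = []" using z unfolding type_of_def Z_def by (simp add: filter_empty_conv)
    then have "\<not> regular_type B X (flip j (type_of E B f z))" using iso(1)[OF j(1)] by (simp add: flip_def)
    then have "E z y \<longleftrightarrow> E z (f j)"
      using twin_class_homogeneous_pair[OF f j, of z] z unfolding Z_def by blast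
    then show ?thesis using z j(1) unfolding Z_def by blast
  qed
  have "Z = {}"
  proof (rule ccontr)
    assume "Z \<noteq> {}"
    have n0: "0 < ?n" using B unfolding no_isolated_def by simp
    have "f 0 \<in> V - Z"
      using iso(2)[OF n0] embedsD(2)[OF f n0] embedsD(3)[OF f n0] unfolding Z_def by blast
    moreover have ZV: "Z \<subseteq> V" unfolding Z_def by blast
    ultimately have "Z \<subset> V" "V - Z \<subset> V" using \<open>Z \<noteq> {}\<close> by blast+
    then have "colourable E q Z" "colourable E q (V - Z)" using crit unfolding critical_def by simp_all
    then obtain c d where c: "colouring E q Z c" and d: "colouring E q (V - Z) d"
      unfolding colourable_def by blast
    define e where "e = (\<lambda>x. if x \<in> Z then c x else d x)"
    have "colouring E q V e"
      unfolding colouring_def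
    proof (intro conjI ballI impI)
      fix v assume "v \<in> V"
      then show "e v < q" using colouring_lt[OF c, of v] colouring_lt[OF d, of v] unfolding e_def by auto
    next
      fix u v assume uv: "u \<in> V" "v \<in> V" "E u v"
      then have "u \<in> Z \<longleftrightarrow> v \<in> Z" using Zanti sym by blast
      then show "e u \<noteq> e v"
        using colouring_neq[OF c, of u v] colouring_neq[OF d, of u v] uv unfolding e_def by auto
    qed
    then show False using crit unfolding critical_def colourable_def by blast
  qed
  then have cover: "\<exists>i. i < ?n \<and> x \<in> A f i" if "x \<in> V" for x using Zor that by blast
  define cl where "cl = (\<lambda>x. SOME i. i < ?n \<and> x \<in> A f i)"
  have cl: "cl x < ?n" "x \<in> A f (cl x)" if "x \<in> V" for x
    using someI_ex[OF cover[OF that]] unfolding cl_def by blast+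
  have cl_eq: "cl x = i" if "x \<in> A f i" "i < ?n" for x i
    using twin_class_disjoint[OF cl(2) that(1) cl(1) that(2)] twin_classD(1)[OF that(1)] by blast
  have clique: "clique E (A f i)" if i: "i < ?n" for i
  proof -
    obtain k where k: "k < ?n" "k \<in> set (B ! i)" using iso(2)[OF i] by blast
    show ?thesis
    proof (rule twin_class_clique[OF crit fin P5 gem f i k])
      fix x a assume x: "x \<in> V - A f i" "a \<in> A f i"
      then have "cl x \<noteq> i" "x \<in> V" using cl(2)[of x] by auto
      then show "E x a \<longleftrightarrow> E x (f i)"
        using twin_class_adjacent[OF f cl(1) i _ cl(2) x(2)]
          twin_class_adjacent[OF f cl(1) i _ cl(2) embeds_in_twin_class[OF f i]] by blast
    qed
  qed
  have "expansion_of E V B cl"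
    unfolding expansion_of_def
  proof (intro conjI ballI allI impI)
    show "cl x < ?n" if "x \<in> V" for x by (rule cl(1)[OF that])
    show "\<exists>x\<in>V. cl x = i" if "i < ?n" for i
      using cl_eq[OF embeds_in_twin_class[OF f that] that] embedsD(2)[OF f that] by blast
    show "E x y \<longleftrightarrow> x \<noteq> y \<and> (cl x = cl y \<or> cl y \<in> set (B ! cl x))" if xy: "x \<in> V" "y \<in> V" for x y
    proof (cases "cl x = cl y")
      case True
      then show ?thesis
        using clique[OF cl(1)[OF xy(1)]] cl(2)[OF xy(1)] cl(2)[OF xy(2)] irrefl
        unfolding clique_def by auto
    next
      case False
      then show ?thesis
        using twin_class_adjacent[OF f cl(1)[OF xy(1)] cl(1)[OF xy(2)] False cl(2)[OF xy(1)] cl(2)[OF xy(2)]]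
        by auto
    qed
  qed
  then show ?thesis by blast
qed

end

section \<open>The patterns around the five-cycle\<close>

text \<open>In \<open>pattern6\<close> a vertex adjacent to \<open>0\<close>, \<open>2\<close> and \<open>3\<close> is added to the cycle; \<open>pattern7a\<close> is \<open>G7\<close>
  without its vertex 8, and \<open>pattern9b\<close> is the circulant graph on 9 vertices with distances 1 and 3.
  The decision trees were found by a computer search.\<close>

definition path5 :: pattern where
  "path5 = [[1], [0, 2], [1, 3], [2, 4], [3]]"

definition gem_pattern :: pattern where
  "gem_pattern = [[1, 4], [0, 2, 4], [1, 3, 4], [2, 4], [0, 1, 2, 3]]"

definition cycle5 :: pattern where
  "cycle5 = [[1, 4], [0, 2], [1, 3], [2, 4], [0, 3]]"

definition pattern6 :: pattern where
  "pattern6 = [[1, 4, 5], [0, 2], [1, 3, 5], [2, 4, 5], [0, 3], [0, 2, 3]]"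

definition pattern7a :: pattern where
  "pattern7a = [[1, 4, 5, 6], [0, 2], [1, 3, 5, 6], [2, 4, 5], [0, 3, 6], [0, 2, 3], [0, 2, 4]]"

definition pattern7b :: pattern where
  "pattern7b = [[1, 5, 6], [0, 2, 4], [1, 3, 4, 5], [2, 6], [1, 2, 6], [0, 2], [0, 3, 4]]"

definition pattern8a :: pattern where
  "pattern8a = [[1, 5, 6, 7], [0, 2, 4], [1, 3, 5, 6], [2, 6, 7], [1, 6, 7], [0, 2, 7], [0, 2, 3, 4], [0, 3, 4, 5]]"

definition pattern8b :: pattern where
  "pattern8b = [[1, 5, 6, 7], [0, 2, 4], [1, 3, 4, 5, 7], [2, 6], [1, 2, 6], [0, 2], [0, 3, 4, 7], [0, 2, 6]]"

definition pattern_G7 :: pattern where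
  "pattern_G7 = [[1, 2, 3, 6], [0, 2, 4, 7], [0, 1, 5], [0, 4, 5, 7], [1, 3, 5, 6], [2, 3, 4], [0, 4], [1, 3]]"

definition pattern9a :: pattern where
  "pattern9a = [[1, 6, 7, 8], [0, 2, 4, 5], [1, 3, 4, 6, 7], [2, 8], [1, 2, 8], [1, 7, 8], [0, 2, 8], [0, 2, 5], [0, 3, 4, 5, 6]]"

definition pattern9b :: pattern where
  "pattern9b = [[1, 3, 6, 8], [0, 2, 4, 7], [1, 3, 5, 8], [0, 2, 4, 6], [1, 3, 5, 7], [2, 4, 6, 8], [0, 3, 5, 7], [1, 4, 6, 8], [0, 2, 5, 7]]"

text \<open>P5 and the gem alone leave only regular types here and for \<open>pattern9a\<close> and
  \<open>pattern9b\<close>, so the elimination can start with these three graphs. In a list of an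
  \<open>Excluded\<close> leaf the entry 8, the length of the pattern, stands for the new
  vertex.\<close>

lemma check_pattern_G7:
  "check_tree [path5, gem_pattern] pattern_G7 [[]] [] []
   (Split 2 (Split 3 (Split 4 (Split 0 (Excluded 1 [2, 0, 3, 4, 8]) (Split 1 (Excluded 1 [0, 2,
    8, 4, 1]) (Split 6 (Split 7 (Excluded 1 [6, 4, 3, 7, 8]) (Excluded 0 [7, 1, 0, 6, 8]))
    (Split 7 (Excluded 0 [6, 0, 1, 7, 8]) (Split 5 (Regular) (Regular)))))) (Split 5 (Excluded 1
    [2, 8, 3, 4, 5]) (Split 6 (Split 7 (Excluded 0 [4, 5, 2, 8, 7]) (Split 1 (Split 0 (Regular)
    (Regular)) (Excluded 0 [7, 1, 4, 6, 8]))) (Excluded 0 [6, 4, 5, 2, 8])))) (Split 4 (Split 5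
    (Excluded 1 [2, 8, 4, 3, 5]) (Split 7 (Split 6 (Excluded 0 [3, 5, 2, 8, 6]) (Split 0 (Split
    1 (Regular) (Regular)) (Excluded 0 [6, 0, 3, 7, 8]))) (Excluded 0 [7, 3, 5, 2, 8]))) (Split
    6 (Excluded 0 [2, 8, 6, 4, 3]) (Split 7 (Excluded 0 [6, 4, 3, 7, 8]) (Split 0 (Split 1
    (Split 5 (Regular) (Excluded 0 [5, 4, 6, 0, 8])) (Excluded 0 [3, 4, 1, 2, 8])) (Excluded 0
    [4, 3, 0, 2, 8])))))) (Split 5 (Split 0 (Split 1 (Split 3 (Excluded 1 [2, 1, 8, 3, 0])
    (Split 4 (Excluded 1 [2, 0, 8, 4, 1]) (Split 6 (Excluded 1 [2, 1, 8, 6, 0]) (Split 7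
    (Excluded 0 [6, 4, 3, 7, 8]) (Regular))))) (Split 7 (Split 6 (Excluded 0 [1, 2, 5, 8, 6])
    (Split 4 (Split 3 (Regular) (Regular)) (Excluded 0 [6, 4, 1, 7, 8]))) (Excluded 0 [7, 1, 2,
    5, 8]))) (Split 6 (Split 7 (Excluded 0 [0, 2, 5, 8, 7]) (Split 1 (Split 3 (Split 4 (Regular)
    (Regular)) (Excluded 0 [7, 3, 0, 6, 8])) (Excluded 0 [7, 1, 2, 5, 8]))) (Excluded 0 [6, 0,
    2, 5, 8]))) (Split 0 (Split 4 (Split 7 (Excluded 0 [5, 2, 0, 8, 7]) (Split 1 (Excluded 1 [2,
    0, 8, 4, 1]) (Split 3 (Excluded 0 [1, 2, 5, 3, 8]) (Split 6 (Regular) (Regular)))))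
    (Excluded 0 [4, 5, 2, 0, 8])) (Split 6 (Excluded 0 [5, 2, 0, 6, 8]) (Split 4 (Excluded 0 [0,
    2, 5, 4, 8]) (Split 1 (Split 3 (Split 7 (Regular) (Regular)) (Excluded 0 [3, 5, 2, 1, 8]))
    (Split 7 (Excluded 0 [5, 2, 1, 7, 8]) (Split 3 (Excluded 0 [1, 2, 5, 3, 8]) (Regular)))))))))"
  by code_simp

lemma rigid_pattern_G7: "rigid pattern_G7 [[]]"
  by code_simp

lemma no_isolated_pattern_G7: "no_isolated pattern_G7"
  by code_simp

lemma check_pattern9a:
  "check_tree [path5, gem_pattern] pattern9a [[]] [] []
   (Split 2 (Split 8 (Split 0 (Split 1 (Excluded 1 [2, 1, 0, 8, 9]) (Split 4 (Excluded 1 [1, 2,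
    9, 8, 4]) (Split 3 (Excluded 0 [3, 9, 0, 1, 4]) (Split 7 (Excluded 0 [1, 4, 8, 9, 7]) (Split
    5 (Split 6 (Excluded 0 [4, 1, 5, 9, 6]) (Excluded 1 [5, 9, 0, 6, 8])) (Split 6 (Regular)
    (Regular))))))) (Split 6 (Excluded 1 [0, 8, 9, 2, 6]) (Split 5 (Excluded 0 [0, 6, 2, 9, 5])
    (Split 1 (Split 3 (Excluded 0 [3, 9, 1, 0, 6]) (Split 4 (Split 7 (Excluded 0 [4, 9, 7, 0,
    6]) (Regular)) (Split 7 (Excluded 1 [4, 1, 9, 7, 2]) (Regular)))) (Split 4 (Excluded 0 [6,
    0, 1, 4, 9]) (Split 7 (Excluded 0 [4, 1, 0, 7, 9]) (Split 3 (Regular) (Regular))))))))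
    (Split 5 (Split 0 (Split 6 (Excluded 1 [2, 9, 0, 8, 6]) (Split 4 (Split 7 (Excluded 0 [6, 8,
    4, 9, 7]) (Split 1 (Split 3 (Excluded 0 [1, 9, 3, 8, 6]) (Regular)) (Split 3 (Excluded 1 [1,
    4, 9, 3, 2]) (Regular)))) (Split 1 (Excluded 0 [6, 8, 4, 1, 9]) (Split 3 (Excluded 0 [1, 4,
    8, 3, 9]) (Split 7 (Regular) (Regular)))))) (Excluded 0 [0, 8, 5, 9, 2])) (Split 7 (Split 4
    (Split 6 (Split 1 (Split 0 (Excluded 0 [2, 9, 0, 8, 5]) (Split 3 (Regular) (Excluded 0 [3,
    8, 0, 1, 9]))) (Excluded 0 [8, 5, 1, 2, 9])) (Excluded 0 [5, 8, 6, 2, 9])) (Excluded 0 [5,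
    8, 4, 2, 9])) (Excluded 0 [8, 5, 7, 2, 9])))) (Split 8 (Split 7 (Split 1 (Split 4 (Excluded
    1 [2, 1, 9, 8, 4]) (Split 6 (Split 5 (Excluded 0 [4, 2, 6, 9, 5]) (Split 0 (Split 3
    (Excluded 0 [0, 9, 3, 2, 4]) (Regular)) (Split 3 (Excluded 1 [0, 6, 9, 3, 8]) (Regular))))
    (Split 0 (Excluded 0 [4, 2, 6, 0, 9]) (Split 3 (Excluded 0 [0, 6, 2, 3, 9]) (Split 5
    (Regular) (Regular)))))) (Excluded 0 [1, 2, 7, 9, 8])) (Split 5 (Split 6 (Split 4 (Split 0
    (Split 1 (Excluded 0 [7, 2, 1, 9, 8]) (Split 3 (Regular) (Excluded 0 [3, 2, 1, 0, 9])))
    (Excluded 0 [0, 7, 2, 4, 9])) (Excluded 0 [4, 2, 7, 5, 9])) (Excluded 0 [6, 2, 7, 5, 9]))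
    (Excluded 0 [2, 7, 5, 8, 9]))) (Split 3 (Split 5 (Split 4 (Split 6 (Split 0 (Split 1
    (Excluded 1 [0, 9, 4, 2, 1]) (Split 7 (Excluded 1 [7, 9, 6, 8, 0]) (Regular))) (Split 7
    (Split 1 (Excluded 1 [2, 4, 9, 5, 1]) (Excluded 0 [0, 1, 2, 3, 9])) (Excluded 0 [0, 7, 2, 3,
    9]))) (Excluded 0 [2, 6, 8, 5, 9])) (Excluded 0 [2, 4, 8, 5, 9])) (Split 7 (Split 1 (Split 6
    (Split 4 (Split 0 (Excluded 1 [0, 9, 4, 2, 1]) (Regular)) (Excluded 0 [4, 8, 5, 7, 9]))
    (Excluded 0 [6, 8, 5, 1, 9])) (Excluded 0 [1, 5, 8, 3, 9])) (Excluded 0 [5, 7, 2, 3, 9])))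
    (Split 5 (Excluded 0 [2, 3, 8, 5, 9]) (Split 7 (Excluded 0 [3, 8, 5, 7, 9]) (Split 0
    (Excluded 0 [2, 3, 8, 0, 9]) (Split 1 (Excluded 0 [3, 8, 0, 1, 9]) (Split 4 (Excluded 0 [0,
    7, 2, 4, 9]) (Split 6 (Excluded 0 [1, 4, 8, 6, 9]) (Regular))))))))))"
  by code_simp

lemma rigid_pattern9a: "rigid pattern9a [[]]"
  by code_simp

lemma no_isolated_pattern9a: "no_isolated pattern9a"
  by code_simp

lemma check_pattern9b:
  "check_tree [path5, gem_pattern] pattern9b [[]] [] []
   (Split 0 (Split 4 (Split 5 (Split 1 (Excluded 1 [0, 1, 4, 5, 9]) (Split 7 (Excluded 1 [1, 7,
    9, 5, 4]) (Excluded 0 [5, 9, 0, 1, 7]))) (Split 2 (Split 8 (Excluded 1 [0, 9, 2, 5, 8])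
    (Split 6 (Split 1 (Excluded 0 [1, 9, 6, 5, 8]) (Split 7 (Excluded 1 [1, 4, 9, 6, 7]) (Split
    3 (Regular) (Regular)))) (Split 7 (Split 3 (Excluded 0 [8, 5, 6, 3, 9]) (Split 1 (Regular)
    (Regular))) (Excluded 0 [6, 7, 8, 2, 9])))) (Excluded 0 [0, 9, 4, 5, 2]))) (Split 5 (Split 7
    (Split 1 (Excluded 1 [0, 9, 7, 4, 1]) (Split 2 (Split 6 (Excluded 0 [4, 1, 2, 9, 6]) (Split
    3 (Excluded 1 [2, 9, 0, 6, 3]) (Split 8 (Regular) (Regular)))) (Split 3 (Split 8 (Excluded 0
    [4, 1, 2, 8, 9]) (Split 6 (Regular) (Regular))) (Excluded 0 [2, 3, 4, 7, 9])))) (Excluded 0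
    [0, 9, 5, 4, 7])) (Split 2 (Excluded 0 [0, 9, 2, 5, 4]) (Split 1 (Split 6 (Split 7 (Excluded
    0 [2, 5, 4, 7, 9]) (Split 8 (Split 3 (Regular) (Excluded 0 [5, 2, 3, 0, 9])) (Excluded 0 [4,
    5, 8, 0, 9]))) (Excluded 0 [2, 5, 6, 0, 9])) (Excluded 0 [5, 2, 1, 0, 9]))))) (Split 1
    (Split 5 (Split 3 (Split 6 (Excluded 1 [0, 3, 9, 5, 6]) (Split 7 (Split 2 (Excluded 0 [0, 6,
    7, 9, 2]) (Split 8 (Excluded 1 [2, 5, 9, 7, 8]) (Split 4 (Regular) (Regular)))) (Split 8
    (Split 4 (Excluded 0 [0, 6, 7, 4, 9]) (Split 2 (Regular) (Regular))) (Excluded 0 [7, 8, 0,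
    3, 9])))) (Excluded 0 [3, 0, 1, 9, 5])) (Split 6 (Split 8 (Split 3 (Split 2 (Excluded 1 [0,
    6, 9, 2, 3]) (Split 7 (Excluded 0 [5, 2, 3, 9, 7]) (Split 4 (Excluded 1 [3, 9, 1, 7, 4])
    (Regular)))) (Split 4 (Split 2 (Excluded 1 [1, 9, 8, 5, 2]) (Split 7 (Regular) (Regular)))
    (Excluded 0 [3, 4, 5, 8, 9]))) (Excluded 0 [5, 8, 0, 1, 9])) (Excluded 0 [5, 6, 0, 1, 9])))
    (Split 4 (Split 6 (Split 2 (Split 8 (Split 3 (Excluded 1 [0, 6, 9, 2, 3]) (Split 7 (Excluded
    0 [3, 0, 1, 7, 9]) (Split 5 (Regular) (Regular)))) (Excluded 0 [8, 0, 1, 4, 9])) (Excluded 0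
    [2, 1, 0, 6, 9])) (Excluded 0 [6, 0, 1, 4, 9])) (Split 5 (Excluded 0 [0, 1, 4, 5, 9]) (Split
    6 (Excluded 0 [1, 4, 5, 6, 9]) (Split 2 (Excluded 0 [0, 6, 5, 2, 9]) (Split 7 (Excluded 0
    [2, 5, 4, 7, 9]) (Split 3 (Excluded 0 [1, 7, 6, 3, 9]) (Split 8 (Excluded 0 [1, 4, 5, 8, 9])
    (Regular))))))))))"
  by code_simp

lemma rigid_pattern9b: "rigid pattern9b [[]]"
  by code_simp

lemma no_isolated_pattern9b: "no_isolated pattern9b"
  by code_simp

lemma check_pattern8a:
  "check_tree [path5, gem_pattern, pattern9a, pattern9b] pattern8a [[]] [] []
   (Split 2 (Split 7 (Split 3 (Split 0 (Excluded 1 [0, 7, 3, 2, 8]) (Split 5 (Excluded 1 [0, 7,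
    8, 2, 5]) (Split 1 (Excluded 0 [3, 8, 1, 0, 5]) (Split 4 (Excluded 0 [5, 0, 1, 4, 8]) (Split
    6 (Regular) (Excluded 0 [1, 0, 6, 3, 8])))))) (Split 6 (Split 5 (Excluded 1 [3, 6, 8, 5, 2])
    (Split 0 (Excluded 1 [0, 8, 2, 3, 6]) (Split 4 (Excluded 0 [0, 5, 2, 8, 4]) (Split 1
    (Excluded 1 [1, 8, 6, 3, 2]) (Regular))))) (Split 1 (Excluded 0 [1, 8, 7, 3, 6]) (Split 5
    (Split 0 (Split 4 (Excluded 0 [3, 6, 4, 8, 5]) (Regular)) (Excluded 0 [3, 6, 0, 5, 8]))
    (Split 0 (Split 4 (Excluded 1 [4, 8, 0, 5, 7]) (Regular)) (Split 4 (Excluded 0 [5, 0, 1, 4,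
    8]) (Excluded 2 [0, 6, 2, 8, 3, 4, 5, 1, 7]))))))) (Split 4 (Split 0 (Split 5 (Excluded 1
    [2, 8, 0, 7, 5]) (Split 3 (Split 1 (Excluded 0 [1, 8, 3, 7, 5]) (Split 6 (Regular)
    (Regular))) (Split 6 (Excluded 0 [5, 7, 3, 6, 8]) (Split 1 (Regular) (Regular))))) (Excluded
    0 [0, 7, 4, 8, 2])) (Split 1 (Split 3 (Split 5 (Split 6 (Split 0 (Excluded 0 [2, 8, 0, 7,
    4]) (Regular)) (Excluded 0 [7, 4, 6, 2, 8])) (Excluded 0 [5, 7, 4, 1, 8])) (Excluded 0 [3,
    7, 4, 1, 8])) (Excluded 0 [7, 4, 1, 2, 8])))) (Split 7 (Split 1 (Split 6 (Split 3 (Excluded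
    1 [2, 6, 8, 7, 3]) (Split 5 (Split 4 (Excluded 0 [3, 2, 5, 8, 4]) (Split 0 (Regular)
    (Regular))) (Split 0 (Excluded 0 [3, 2, 5, 0, 8]) (Split 4 (Regular) (Regular))))) (Excluded
    0 [6, 2, 1, 8, 7])) (Split 4 (Split 5 (Split 3 (Split 0 (Split 6 (Excluded 0 [1, 2, 6, 8,
    7]) (Regular)) (Excluded 0 [0, 1, 2, 3, 8])) (Excluded 0 [3, 2, 1, 4, 8])) (Excluded 0 [5,
    2, 1, 4, 8])) (Excluded 0 [2, 1, 4, 7, 8]))) (Split 3 (Split 5 (Split 1 (Split 6 (Split 0
    (Excluded 1 [1, 8, 5, 7, 0]) (Split 4 (Excluded 1 [2, 3, 8, 4, 6]) (Regular))) (Split 4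
    (Split 0 (Excluded 1 [1, 8, 5, 7, 0]) (Excluded 3 [0, 1, 2, 5, 8, 3, 7, 4, 6])) (Excluded 0
    [4, 6, 2, 5, 8]))) (Split 4 (Split 0 (Split 6 (Excluded 1 [0, 8, 3, 2, 6]) (Regular))
    (Excluded 0 [0, 1, 2, 3, 8])) (Excluded 0 [1, 4, 7, 3, 8]))) (Split 4 (Excluded 0 [2, 5, 7,
    4, 8]) (Split 1 (Excluded 0 [5, 7, 4, 1, 8]) (Excluded 0 [1, 4, 7, 3, 8])))) (Split 1
    (Excluded 0 [7, 3, 2, 1, 8]) (Split 4 (Excluded 0 [2, 3, 7, 4, 8]) (Split 5 (Excluded 0 [1,
    4, 7, 5, 8]) (Split 0 (Excluded 0 [2, 3, 7, 0, 8]) (Split 6 (Excluded 0 [5, 7, 3, 6, 8])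
    (Regular)))))))))"
  by code_simp

lemma rigid_pattern8a: "rigid pattern8a [[]]"
  by code_simp

lemma no_isolated_pattern8a: "no_isolated pattern8a"
  by code_simp

lemma check_pattern8b:
  "check_tree [path5, gem_pattern, pattern9a, pattern8a] pattern8b [[]] [] []
   (Split 0 (Split 2 (Split 6 (Split 1 (Excluded 1 [2, 1, 0, 6, 8]) (Split 4 (Excluded 1 [1, 2,
    8, 6, 4]) (Split 3 (Excluded 0 [3, 8, 0, 1, 4]) (Split 5 (Excluded 0 [1, 4, 6, 8, 5]) (Split
    7 (Regular) (Regular)))))) (Split 7 (Excluded 1 [2, 8, 0, 6, 7]) (Split 4 (Split 5 (Excluded
    0 [5, 8, 4, 6, 7]) (Split 1 (Split 3 (Excluded 0 [1, 8, 3, 6, 7]) (Regular)) (Split 3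
    (Excluded 1 [1, 4, 8, 3, 2]) (Regular)))) (Split 1 (Excluded 0 [7, 6, 4, 1, 8]) (Split 3
    (Excluded 0 [1, 4, 6, 3, 8]) (Split 5 (Regular) (Regular))))))) (Split 4 (Split 1 (Excluded
    1 [0, 8, 4, 2, 1]) (Split 3 (Split 6 (Split 5 (Excluded 0 [1, 2, 5, 8, 6]) (Split 7
    (Regular) (Excluded 0 [1, 2, 7, 6, 8]))) (Split 5 (Split 7 (Excluded 1 [5, 8, 7, 6, 0])
    (Excluded 0 [6, 7, 2, 5, 8])) (Split 7 (Regular) (Excluded 2 [4, 6, 0, 5, 7, 3, 1, 8, 2]))))
    (Excluded 0 [3, 2, 1, 0, 8]))) (Split 6 (Split 5 (Split 1 (Split 3 (Excluded 0 [0, 8, 3, 2,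
    4]) (Split 7 (Regular) (Excluded 0 [3, 2, 7, 0, 8]))) (Excluded 0 [1, 2, 5, 8, 6]))
    (Excluded 0 [4, 2, 5, 0, 8])) (Excluded 0 [2, 4, 6, 0, 8])))) (Split 6 (Split 2 (Split 7
    (Excluded 1 [0, 6, 8, 2, 7]) (Split 1 (Split 3 (Excluded 0 [3, 8, 1, 0, 7]) (Split 4 (Split
    5 (Excluded 0 [4, 8, 5, 0, 7]) (Regular)) (Split 5 (Excluded 1 [4, 1, 8, 5, 2]) (Regular))))
    (Split 4 (Excluded 0 [7, 0, 1, 4, 8]) (Split 5 (Excluded 0 [4, 1, 0, 5, 8]) (Split 3
    (Regular) (Regular)))))) (Split 5 (Split 1 (Split 4 (Excluded 1 [2, 1, 8, 6, 4]) (Split 3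
    (Split 7 (Excluded 1 [0, 7, 8, 3, 6]) (Excluded 0 [0, 7, 2, 3, 8])) (Split 7 (Regular)
    (Excluded 2 [0, 1, 2, 3, 4, 8, 7, 5, 6])))) (Excluded 0 [2, 1, 0, 6, 8])) (Excluded 0 [2, 5,
    0, 6, 8]))) (Split 3 (Split 5 (Split 1 (Split 7 (Split 4 (Split 2 (Regular) (Regular))
    (Excluded 0 [4, 6, 0, 5, 8])) (Excluded 0 [1, 8, 3, 6, 7])) (Excluded 0 [1, 0, 6, 3, 8]))
    (Excluded 0 [5, 0, 6, 3, 8])) (Split 5 (Excluded 0 [3, 6, 0, 5, 8]) (Split 2 (Excluded 0 [0,
    6, 3, 2, 8]) (Split 1 (Excluded 0 [3, 6, 0, 1, 8]) (Split 4 (Excluded 0 [0, 5, 2, 4, 8])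
    (Split 7 (Excluded 0 [1, 4, 6, 7, 8]) (Regular)))))))))"
  by code_simp

lemma rigid_pattern8b: "rigid pattern8b [[]]"
  by code_simp

lemma no_isolated_pattern8b: "no_isolated pattern8b"
  by code_simp

lemma check_pattern7b:
  "check_tree [path5, gem_pattern, pattern8a, pattern8b] pattern7b [[]] [] []
   (Split 2 (Split 0 (Split 6 (Split 1 (Excluded 1 [2, 1, 0, 6, 7]) (Split 4 (Excluded 1 [1, 2,
    7, 6, 4]) (Split 3 (Excluded 0 [3, 7, 0, 1, 4]) (Split 5 (Excluded 0 [1, 4, 6, 7, 5])
    (Excluded 3 [0, 1, 2, 3, 4, 5, 6, 7]))))) (Split 4 (Split 5 (Excluded 1 [0, 5, 2, 4, 7])
    (Split 1 (Split 3 (Excluded 1 [0, 1, 2, 3, 7]) (Regular)) (Split 3 (Excluded 1 [1, 4, 7, 3,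
    2]) (Regular)))) (Split 1 (Excluded 1 [0, 7, 2, 4, 1]) (Split 3 (Excluded 0 [1, 4, 6, 3, 7])
    (Split 5 (Regular) (Regular)))))) (Split 6 (Split 1 (Split 3 (Excluded 1 [1, 2, 3, 6, 7])
    (Split 4 (Split 5 (Excluded 1 [5, 2, 4, 6, 7]) (Regular)) (Split 5 (Excluded 1 [4, 1, 7, 5,
    2]) (Regular)))) (Split 4 (Excluded 1 [1, 2, 7, 6, 4]) (Split 5 (Excluded 0 [4, 1, 0, 5, 7])
    (Split 3 (Regular) (Regular))))) (Split 3 (Split 1 (Split 5 (Split 4 (Regular) (Excluded 0
    [0, 6, 4, 2, 7])) (Excluded 0 [6, 0, 5, 2, 7])) (Excluded 0 [6, 0, 1, 2, 7])) (Excluded 0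
    [0, 6, 3, 2, 7])))) (Split 0 (Split 3 (Split 4 (Split 1 (Excluded 1 [0, 7, 4, 2, 1]) (Split
    5 (Split 6 (Excluded 0 [1, 2, 5, 7, 6]) (Excluded 2 [4, 6, 0, 5, 3, 1, 7, 2])) (Split 6
    (Regular) (Regular)))) (Excluded 0 [0, 7, 3, 2, 4])) (Split 6 (Split 5 (Split 1 (Split 4
    (Excluded 0 [0, 7, 4, 2, 3]) (Regular)) (Excluded 0 [3, 2, 1, 0, 7])) (Excluded 0 [3, 2, 5,
    0, 7])) (Excluded 0 [2, 3, 6, 0, 7]))) (Split 5 (Split 6 (Split 1 (Split 4 (Excluded 1 [2,
    1, 7, 6, 4]) (Split 3 (Excluded 2 [1, 0, 6, 3, 5, 4, 7, 2]) (Regular))) (Excluded 0 [2, 1,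
    0, 6, 7])) (Split 3 (Split 1 (Split 4 (Regular) (Excluded 0 [4, 6, 0, 5, 7])) (Excluded 0
    [0, 1, 2, 3, 7])) (Excluded 0 [3, 6, 0, 5, 7]))) (Split 6 (Excluded 0 [2, 5, 0, 6, 7])
    (Split 3 (Excluded 0 [0, 5, 2, 3, 7]) (Split 1 (Excluded 0 [3, 6, 0, 1, 7]) (Split 4
    (Excluded 0 [0, 5, 2, 4, 7]) (Regular))))))))"
  by code_simp

lemma rigid_pattern7b: "rigid pattern7b [[]]"
  by code_simp

lemma no_isolated_pattern7b: "no_isolated pattern7b"
  by code_simp

lemma check_pattern7a:
  "check_tree [path5, gem_pattern, pattern_G7, pattern7b] pattern7a [[]] [] []
   (Split 3 (Split 0 (Split 2 (Split 4 (Excluded 1 [0, 4, 3, 2, 7]) (Split 6 (Excluded 1 [2, 7,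
    0, 4, 6]) (Split 1 (Excluded 0 [1, 7, 3, 4, 6]) (Split 5 (Regular) (Regular))))) (Split 5
    (Excluded 1 [0, 7, 3, 2, 5]) (Split 4 (Split 1 (Excluded 0 [4, 7, 1, 2, 5]) (Split 6
    (Regular) (Excluded 0 [1, 2, 6, 4, 7]))) (Split 1 (Split 6 (Excluded 1 [1, 7, 6, 4, 0])
    (Excluded 0 [4, 6, 2, 1, 7])) (Split 6 (Regular) (Excluded 3 [2, 6, 0, 7, 4, 1, 3]))))))
    (Split 1 (Split 6 (Split 4 (Excluded 1 [0, 6, 7, 3, 4]) (Split 2 (Split 5 (Regular)
    (Excluded 0 [4, 0, 5, 2, 7])) (Split 5 (Regular) (Excluded 3 [0, 5, 3, 7, 2, 4, 1]))))
    (Excluded 0 [3, 7, 1, 0, 6])) (Split 2 (Split 4 (Split 6 (Excluded 0 [1, 0, 6, 7, 3]) (Split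
    5 (Regular) (Excluded 0 [1, 0, 5, 3, 7]))) (Excluded 0 [4, 0, 1, 2, 7])) (Excluded 0 [0, 1,
    2, 3, 7])))) (Split 4 (Split 2 (Split 5 (Split 0 (Excluded 1 [0, 7, 2, 3, 5]) (Split 6
    (Excluded 1 [0, 4, 7, 2, 6]) (Split 1 (Excluded 1 [1, 7, 5, 3, 2]) (Regular)))) (Split 1
    (Excluded 0 [1, 7, 4, 3, 5]) (Split 0 (Split 6 (Regular) (Regular)) (Excluded 3 [0, 5, 2, 7,
    3, 1, 4])))) (Split 1 (Split 5 (Split 0 (Split 6 (Regular) (Excluded 0 [3, 2, 6, 0, 7]))
    (Split 6 (Regular) (Excluded 3 [1, 0, 4, 3, 6, 7, 2]))) (Excluded 0 [1, 7, 4, 3, 5]))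
    (Excluded 0 [1, 2, 3, 4, 7]))) (Split 0 (Split 2 (Split 5 (Excluded 1 [0, 7, 2, 3, 5])
    (Split 6 (Excluded 0 [5, 3, 4, 6, 7]) (Split 1 (Regular) (Regular)))) (Excluded 0 [2, 3, 4,
    0, 7])) (Split 1 (Excluded 0 [3, 4, 0, 1, 7]) (Split 2 (Excluded 0 [0, 4, 3, 2, 7]) (Split 5
    (Split 6 (Excluded 2 [0, 6, 4, 5, 2, 3, 1, 7]) (Excluded 0 [4, 6, 2, 5, 7])) (Split 6
    (Excluded 0 [3, 5, 0, 6, 7]) (Regular))))))))"
  by code_simp

lemma rigid_pattern7a: "rigid pattern7a [[]]"
  by code_simp

lemma no_isolated_pattern7a: "no_isolated pattern7a"
  by code_simp

text \<open>A vertex whose only neighbour in the copy is 5 completes none of the excluded graphs,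
  hence the second exceptional type. It puts this pattern outside the scope of
  \<open>expansion_if_critical\<close>.\<close>

lemma check_pattern6:
  "check_tree [path5, gem_pattern, pattern7b, pattern7a] pattern6 [[], [5]] [] []
   (Split 2 (Split 3 (Split 1 (Split 0 (Excluded 1 [0, 1, 2, 3, 6]) (Split 4 (Excluded 1 [1, 2,
    3, 4, 6]) (Split 5 (Regular) (Excluded 0 [4, 0, 5, 2, 6])))) (Split 0 (Split 4 (Excluded 1
    [0, 4, 3, 2, 6]) (Split 5 (Regular) (Regular))) (Split 4 (Split 5 (Regular) (Excluded 0 [1,
    0, 5, 3, 6])) (Excluded 0 [4, 0, 1, 2, 6])))) (Split 0 (Split 5 (Excluded 1 [0, 6, 2, 3, 5])
    (Split 1 (Split 4 (Excluded 0 [1, 6, 4, 3, 5]) (Regular)) (Split 4 (Excluded 3 [0, 1, 2, 3,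
    4, 5, 6]) (Regular)))) (Split 4 (Split 1 (Split 5 (Excluded 1 [1, 6, 5, 3, 2]) (Excluded 0
    [3, 5, 0, 1, 6])) (Split 5 (Regular) (Excluded 2 [0, 5, 2, 6, 3, 1, 4]))) (Excluded 0 [0, 4,
    3, 2, 6])))) (Split 4 (Split 1 (Split 5 (Split 3 (Excluded 1 [2, 5, 6, 4, 3]) (Split 0
    (Regular) (Regular))) (Excluded 0 [4, 6, 1, 2, 5])) (Split 0 (Split 3 (Split 5 (Excluded 0
    [1, 2, 5, 6, 4]) (Regular)) (Excluded 0 [3, 2, 1, 0, 6])) (Excluded 0 [2, 1, 0, 4, 6])))
    (Split 3 (Split 0 (Split 5 (Excluded 1 [0, 6, 3, 2, 5]) (Split 1 (Excluded 3 [0, 4, 3, 2, 1,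
    5, 6]) (Regular))) (Split 1 (Split 5 (Regular) (Excluded 2 [0, 5, 3, 6, 2, 4, 1])) (Excluded
    0 [0, 1, 2, 3, 6]))) (Split 1 (Excluded 0 [4, 3, 2, 1, 6]) (Split 0 (Excluded 0 [2, 3, 4, 0,
    6]) (Split 5 (Regular) (Regular)))))))"
  by code_simp

lemma rigid_pattern6: "rigid pattern6 [[], [5]]"
  by code_simp

lemma check_cycle5:
  "check_tree [path5, gem_pattern, pattern6] cycle5 [[]] [] []
   (Split 0 (Split 2 (Split 1 (Split 3 (Excluded 1 [0, 1, 2, 3, 5]) (Split 4 (Excluded 1 [2, 1,
    0, 4, 5]) (Regular))) (Split 3 (Split 4 (Excluded 1 [0, 4, 3, 2, 5]) (Excluded 2 [0, 1, 2,
    3, 4, 5])) (Split 4 (Excluded 2 [2, 1, 0, 4, 3, 5]) (Regular)))) (Split 3 (Split 1 (Split 4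
    (Excluded 1 [1, 0, 4, 3, 5]) (Excluded 2 [3, 2, 1, 0, 4, 5])) (Split 4 (Regular) (Regular)))
    (Split 1 (Split 4 (Regular) (Excluded 0 [2, 3, 4, 0, 5])) (Excluded 0 [3, 2, 1, 0, 5]))))
    (Split 1 (Split 3 (Split 2 (Split 4 (Excluded 1 [1, 2, 3, 4, 5]) (Regular)) (Split 4
    (Excluded 2 [1, 0, 4, 3, 2, 5]) (Regular))) (Split 4 (Split 2 (Excluded 2 [4, 0, 1, 2, 3,
    5]) (Regular)) (Excluded 0 [3, 4, 0, 1, 5]))) (Split 2 (Split 4 (Split 3 (Regular)
    (Regular)) (Excluded 0 [4, 0, 1, 2, 5])) (Split 3 (Excluded 0 [0, 1, 2, 3, 5]) (Split 4
    (Excluded 0 [1, 2, 3, 4, 5]) (Regular))))))"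
  by code_simp

lemma rigid_cycle5: "rigid cycle5 [[]]"
  by code_simp

lemma no_isolated_cycle5: "no_isolated cycle5"
  by code_simp

section \<open>Recolouring clique expansions\<close>

text \<open>A permutation of all colours is needed because a whole colouring is renamed when two
  colourings are glued.\<close>

lemma ex_bij_into:
  fixes X Y :: "nat set"
  assumes "X \<subseteq> {..<q}" "Y \<subseteq> {..<q}" "card X \<le> card Y"
  obtains \<pi> where "bij_betw \<pi> {..<q} {..<q}" "\<pi> ` X \<subseteq> Y"
proof -
  have fin: "finite X" "finite Y" using assms finite_subset by blast+
  obtain Y' where Y': "Y' \<subseteq> Y" "card Y' = card X" using obtain_subset_with_card_n[OF assms(3)] by metis
  have fin': "finite Y'" using Y' fin finite_subset by blast
  obtain g where g: "bij_betw g X Y'" using finite_same_card_bij[OF fin(1) fin'] Y' by auto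
  have "card ({..<q} - X) = card ({..<q} - Y')"
    using assms Y' fin fin' by (simp add: card_Diff_subset order_trans[OF Y'(1) assms(2)])
  then obtain h where h: "bij_betw h ({..<q} - X) ({..<q} - Y')"
    using finite_same_card_bij[of "{..<q} - X" "{..<q} - Y'"] by auto
  define \<pi> where "\<pi> = (\<lambda>x. if x \<in> X then g x else h x)"
  have g': "bij_betw \<pi> X Y'" using g by (rule bij_betw_cong[THEN iffD1, rotated]) (simp add: \<pi>_def)
  have h': "bij_betw \<pi> ({..<q} - X) ({..<q} - Y')"
    using h by (rule bij_betw_cong[THEN iffD1, rotated]) (simp add: \<pi>_def)
  have "bij_betw \<pi> (X \<union> ({..<q} - X)) (Y' \<union> ({..<q} - Y'))"
    by (rule bij_betw_combine[OF g' h']) blast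
  moreover have "X \<union> ({..<q} - X) = {..<q}" "Y' \<union> ({..<q} - Y') = {..<q}"
    using assms Y' by auto
  ultimately have "bij_betw \<pi> {..<q} {..<q}" by simp
  moreover have "\<pi> ` X \<subseteq> Y" using bij_betw_imp_surj_on[OF g'] Y' by simp
  ultimately show ?thesis using that by blast
qed

section \<open>Kempe swaps on unions of classes\<close>

context adjacency
begin

text \<open>\<open>S\<close> may be a union of Kempe chains; all that matters is that no chain
  crosses its boundary. Unions of whole classes can therefore be used.\<close>

lemma swap_colouring:
  assumes c: "colouring E q U c" and ab: "\<alpha> < q" "\<beta> < q"
    and S: "\<And>x y. x \<in> S \<Longrightarrow> x \<in> U \<Longrightarrow> y \<in> U - S \<Longrightarrow> E x y \<Longrightarrow> c y \<noteq> \<alpha> \<and> c y \<noteq> \<beta>"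
  shows "colouring E q U (\<lambda>x. if x \<in> S then (id(\<alpha> := \<beta>, \<beta> := \<alpha>)) (c x) else c x)"
  unfolding colouring_def
proof (intro conjI ballI impI)
  fix v assume "v \<in> U"
  then show "(if v \<in> S then (id(\<alpha> := \<beta>, \<beta> := \<alpha>)) (c v) else c v) < q"
    using colouring_lt[OF c, of v] ab by auto
next
  fix u v assume uv: "u \<in> U" "v \<in> U" "E u v"
  have n: "c u \<noteq> c v" by (rule colouring_neq[OF c uv])
  show "(if u \<in> S then (id(\<alpha> := \<beta>, \<beta> := \<alpha>)) (c u) else c u) \<noteq> (if v \<in> S then (id(\<alpha> := \<beta>, \<beta> := \<alpha>)) (c v) else c v)"
    using n S[of u v] S[of v u] uv sym[OF uv(3)] by (auto split: if_splits)
qed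

text \<open>The number of colours on \<open>N\<close> is minimised. The conclusion is stated by
  inclusion because a Kempe swap produces a smaller palette as a set.\<close>

lemma minimal_colouring:
  assumes "colourable E q U" "finite N"
  obtains c where "colouring E q U c"
    "\<And>c'. colouring E q U c' \<Longrightarrow> c' ` N \<subseteq> c ` N \<Longrightarrow> c' ` N = c ` N"
proof -
  obtain c0 where "colouring E q U c0" using assms unfolding colourable_def by blast
  then obtain c where c: "colouring E q U c" "\<And>c'. colouring E q U c' \<Longrightarrow> card (c ` N) \<le> card (c' ` N)"
    using ex_has_least_nat[of "colouring E q U" c0 "\<lambda>c. card (c ` N)"] by blast
  have "c' ` N = c ` N" if "colouring E q U c'" "c' ` N \<subseteq> c ` N" for c'
    using card_seteq[OF _ that(2)] c(2)[OF that(1)] assms(2) by simp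
  then show ?thesis using that c(1) by blast
qed

end

locale critical_expansion = adjacency E for E :: "'a \<Rightarrow> 'a \<Rightarrow> bool" +
  fixes V :: "'a set" and q :: nat and B :: pattern and cl :: "'a \<Rightarrow> nat"
  assumes fin: "finite V" and crit: "critical E q V" and exp: "expansion_of E V B cl"
begin

definition K :: "nat \<Rightarrow> 'a set" where "K i = {x \<in> V. cl x = i}"

lemma K_subset: "K i \<subseteq> V"
  unfolding K_def by blast

lemma finite_K: "finite (K i)"
  using finite_subset[OF K_subset fin] .

lemma K_nonempty: "i < length B \<Longrightarrow> K i \<noteq> {}"
  using exp unfolding expansion_of_def K_def by blast

lemma V_eq: "x \<in> V \<Longrightarrow> cl x < length B \<and> x \<in> K (cl x)"
  using exp unfolding expansion_of_def K_def by blast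

lemma K_adj: "x \<in> K i \<Longrightarrow> y \<in> K j \<Longrightarrow> E x y \<longleftrightarrow> x \<noteq> y \<and> (i = j \<or> j \<in> set (B ! i))"
  using exp unfolding expansion_of_def K_def by auto

lemma clique_K: "clique E (\<Union>i\<in>Q. K i)" if "\<And>i j. i \<in> Q \<Longrightarrow> j \<in> Q \<Longrightarrow> i \<noteq> j \<Longrightarrow> j \<in> set (B ! i)"
  unfolding clique_def using K_adj that by blast

abbreviation rest :: "nat \<Rightarrow> 'a set" where "rest p \<equiv> V - K p"

definition nb :: "nat \<Rightarrow> 'a set" where "nb p = (\<Union>i\<in>set (B ! p) - {p}. K i)"

lemma colourable_rest: "p < length B \<Longrightarrow> colourable E q (rest p)"
  using K_nonempty[of p] K_subset[of p] crit unfolding critical_def by blast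

lemma nb_subset: "nb p \<subseteq> rest p"
  unfolding nb_def K_def by blast

lemma finite_nb: "finite (nb p)"
  using finite_subset[OF _ fin] nb_subset by blast

lemma colours_too_many:
  assumes c: "colouring E q (rest p) c" and card: "card (c ` nb p) + card (K p) \<le> q"
  shows False
proof -
  have "colourable E q (rest p \<union> K p)"
  proof (rule extend_colouring[OF c finite_K _ nb_subset finite_nb _ card])
    show "u \<in> nb p" if w: "w \<in> K p" "u \<in> rest p" "E w u" for w u
    proof -
      have u: "u \<in> K (cl u)" "cl u \<noteq> p" using w(2) unfolding K_def by auto
      then have "cl u \<in> set (B ! p)" using K_adj[OF w(1) u(1)] w(3) by auto
      then show ?thesis using u unfolding nb_def by blast
    qed
  qed blast
  moreover have "rest p \<union> K p = V" using K_subset by blast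
  ultimately show False using crit unfolding critical_def by simp
qed

lemma colour_classes_disjoint:
  assumes "colouring E q (rest p) c" "i \<noteq> p" "j \<noteq> p" "i \<noteq> j" "j \<in> set (B ! i)" "a \<in> c ` K i"
  shows "a \<notin> c ` K j"
proof
  assume "a \<in> c ` K j"
  then obtain x y where xy: "x \<in> K i" "y \<in> K j" "a = c x" "a = c y" using assms(6) by blast
  then have "E x y" using K_adj[OF xy(1,2)] assms(4,5) unfolding K_def by auto
  moreover have "x \<in> rest p" "y \<in> rest p" using xy assms(2,3) unfolding K_def by auto
  ultimately show False using colouring_neq[OF assms(1)] xy by fastforce
qed

text \<open>The colours of the clique \<open>K w\<close> are absent around \<open>p\<close> and at
  least as many as \<open>K p\<close> requires.\<close>

lemma witness_class:
  assumes c: "colouring E q (rest p) c" and w: "w \<noteq> p" "card (K p) \<le> card (K w)"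
    and disj: "c ` nb p \<inter> c ` K w = {}"
  shows False
proof (rule colours_too_many[OF c])
  have Kw: "K w \<subseteq> rest p" using w unfolding K_def by blast
  have "clique E (\<Union>i\<in>{w}. K i)" by (rule clique_K) simp
  then have "card (c ` K w) = card (K w)" using colouring_clique_card[OF c _ Kw] by simp
  moreover have "card (c ` nb p) + card (c ` K w) = card (c ` nb p \<union> c ` K w)"
    by (rule card_Un_disjoint[symmetric]) (use finite_nb finite_K disj in auto)
  moreover have "card (c ` nb p \<union> c ` K w) \<le> card {..<q}"
    by (rule card_mono) (use colouring_lt[OF c] nb_subset Kw in fastforce)+
  ultimately show "card (c ` nb p) + card (K p) \<le> q" using w(2) by simp
qed

text \<open>The classes of \<open>Q\<close> and \<open>p\<close> form one clique, and class
  \<open>k\<close> shows that it is a proper part of the graph. It is thus colourable, so its size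
  is at most \<open>q\<close>, which leaves room for \<open>K p\<close> beside the colours of
  \<open>Q\<close>.\<close>

lemma witness_clique:
  assumes c: "colouring E q (rest p) c"
    and sub: "c ` nb p \<subseteq> c ` (\<Union>i\<in>Q. K i)" and pQ: "p \<notin> Q"
    and Q: "\<And>i j. i \<in> insert p Q \<Longrightarrow> j \<in> insert p Q \<Longrightarrow> i \<noteq> j \<Longrightarrow> j \<in> set (B ! i)"
    and k: "k < length B" "k \<notin> insert p Q"
  shows False
proof (rule colours_too_many[OF c])
  let ?Q = "\<Union>i\<in>Q. K i"
  have V: "?Q \<union> K p \<subset> V" using K_nonempty[OF k(1)] k(2) unfolding K_def by blast
  have "?Q \<inter> K p = {}" using pQ unfolding K_def by blast
  moreover have finQ: "finite ?Q" using finite_subset[OF _ fin, of ?Q] K_subset by blast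
  ultimately have "card (?Q \<union> K p) = card ?Q + card (K p)" using finite_K by (intro card_Un_disjoint)
  moreover have "clique E (?Q \<union> K p)"
    using clique_K[of "insert p Q"] Q by (simp add: Un_commute)
  moreover have "colourable E q (?Q \<union> K p)" using crit V unfolding critical_def by simp
  then obtain d where "colouring E q (?Q \<union> K p) d" unfolding colourable_def by blast
  ultimately have "card ?Q + card (K p) \<le> q" using colouring_clique_le[of E q "?Q \<union> K p"] by force
  moreover have "card (c ` nb p) \<le> card ?Q"
    using card_mono[OF _ sub] card_image_le[OF finQ, of c] finQ by fastforce
  ultimately show "card (c ` nb p) + card (K p) \<le> q" by simp
qed

text \<open>The swap on \<open>S\<close> removes \<alpha> around \<open>p\<close>: neighbour classes
  inside \<open>S\<close> have no \<beta> that could become \<alpha>, those outside have no \<alpha>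
  to begin with. Only \<beta> can appear instead, and it was present already, so the palette
  shrinks.\<close>

lemma kempe_reduce:
  assumes c: "colouring E q (rest p) c"
    and min: "\<And>c'. colouring E q (rest p) c' \<Longrightarrow> c' ` nb p \<subseteq> c ` nb p \<Longrightarrow> c' ` nb p = c ` nb p"
    and ab: "\<alpha> \<in> c ` nb p" "\<beta> \<in> c ` nb p"
    and S: "\<And>i j. i \<in> S \<Longrightarrow> j \<in> set (B ! i) \<Longrightarrow> j \<notin> S \<Longrightarrow> j \<noteq> p \<Longrightarrow> \<alpha> \<notin> c ` K j \<and> \<beta> \<notin> c ` K j"
    and N: "\<And>i. i \<in> set (B ! p) \<Longrightarrow> i \<noteq> p \<Longrightarrow> i \<in> S \<Longrightarrow> \<beta> \<notin> c ` K i"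
      "\<And>i. i \<in> set (B ! p) \<Longrightarrow> i \<noteq> p \<Longrightarrow> i \<notin> S \<Longrightarrow> \<alpha> \<notin> c ` K i"
  shows False
proof -
  let ?S = "\<Union>i\<in>S. K i"
  define c' where "c' = (\<lambda>x. if x \<in> ?S then (id(\<alpha> := \<beta>, \<beta> := \<alpha>)) (c x) else c x)"
  have lt: "\<alpha> < q" "\<beta> < q" using ab colouring_lt[OF c] nb_subset by blast+
  have "colouring E q (rest p) c'"
    unfolding c'_def
  proof (rule swap_colouring[OF c lt])
    fix x y assume xy: "x \<in> ?S" "x \<in> rest p" "y \<in> rest p - ?S" "E x y"
    then obtain i where i: "i \<in> S" "x \<in> K i" by blast
    have y: "y \<in> K (cl y)" "cl y \<noteq> p" "cl y \<notin> S" using xy(3) unfolding K_def by auto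
    have "cl y \<in> set (B ! i)" using K_adj[OF i(2) y(1)] xy(4) i(1) y(3) by auto
    then show "c y \<noteq> \<alpha> \<and> c y \<noteq> \<beta>" using S[OF i(1) _ y(3,2)] y(1) by blast
  qed
  moreover have *: "c' x \<noteq> \<alpha> \<and> c' x \<in> c ` nb p" if x: "x \<in> nb p" for x
  proof -
    obtain i where i: "i \<in> set (B ! p)" "i \<noteq> p" "x \<in> K i" using x unfolding nb_def by blast
    have "x \<in> ?S \<longleftrightarrow> i \<in> S" using i(3) unfolding K_def by auto
    moreover have "i \<in> S \<Longrightarrow> c x \<noteq> \<beta>" "i \<notin> S \<Longrightarrow> c x \<noteq> \<alpha>"
      using N[OF i(1,2)] i(3) by (metis imageI)+
    moreover have "c x \<in> c ` nb p" using x by (rule imageI)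
    ultimately show ?thesis
      using ab(2) unfolding c'_def by (cases "i \<in> S"; cases "c x = \<alpha>") simp_all
  qed
  ultimately have "c' ` nb p = c ` nb p" using min by blast
  then have "\<alpha> \<in> c' ` nb p" using ab(1) by simp
  then obtain x where "x \<in> nb p" "c' x = \<alpha>" by blast
  then show False using * by blast
qed

end

context adjacency
begin

lemma critical_expansionI:
  "finite V \<Longrightarrow> critical E q V \<Longrightarrow> expansion_of E V B cl \<Longrightarrow> critical_expansion E V q B cl"
  by (unfold_locales)

text \<open>If class \<open>j\<close> were at least as large, its colours would do for class
  \<open>i\<close>: every neighbour class of \<open>i\<close> is also one of \<open>j\<close> and
  therefore avoids them.\<close>

lemma inclusion_card_less:
  assumes ce: "critical_expansion E V q B cl" and ij: "i < length B" "j \<noteq> i" "j \<notin> set (B ! i)"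
    and sub: "set (B ! i) \<subseteq> set (B ! j)"
  shows "card (critical_expansion.K V cl j) < card (critical_expansion.K V cl i)"
proof (rule ccontr)
  interpret critical_expansion E V q B cl by (rule ce)
  assume "\<not> card (K j) < card (K i)"
  then have le: "card (K i) \<le> card (K j)" by simp
  obtain c where c: "colouring E q (rest i) c"
    using colourable_rest[OF ij(1)] unfolding colourable_def by blast
  show False
  proof (rule witness_class[OF c ij(2) le])
    show "c ` nb i \<inter> c ` K j = {}"
    proof (rule ccontr)
      assume "c ` nb i \<inter> c ` K j \<noteq> {}"
      then obtain a k where k: "k \<in> set (B ! i)" "k \<noteq> i" "a \<in> c ` K k" "a \<in> c ` K j"
        unfolding nb_def by blast
      have "k \<noteq> j" using k ij by blast
      then show False using colour_classes_disjoint[OF c ij(2) k(2) _ _ k(4)] k sub by blast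
    qed
  qed
qed

end

text \<open>In each case the swapped classes form the largest Kempe chain that can arise. If no swap is possible,
  the colours around \<open>p\<close> either all occur on a clique together with \<open>p\<close>, or miss the colours of a class at
  least as large as that of \<open>p\<close>.\<close>

lemma (in critical_expansion) no_critical_pattern7b:
  assumes B: "B = pattern7b"
    and card: "card (K 1) \<le> card (K 5)"
  shows False
proof -
  have N: "set (B ! 0) = {1, 5, 6}" "set (B ! 1) = {0, 2, 4}" "set (B ! 2) = {1, 3, 4, 5}" "set (B ! 3) = {2, 6}" "set (B ! 4) = {1, 2, 6}" "set (B ! 5) = {0, 2}" "set (B ! 6) = {0, 3, 4}"
    unfolding B pattern7b_def by auto
  note N = N N[unfolded One_nat_def]
  have len: "length B = 7" unfolding B pattern7b_def by simp
  then have p: "1 < length B" by simp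
  obtain c where c: "colouring E q (rest 1) c"
    and min: "\<And>c'. colouring E q (rest 1) c' \<Longrightarrow> c' ` nb 1 \<subseteq> c ` nb 1 \<Longrightarrow> c' ` nb 1 = c ` nb 1"
    by (rule minimal_colouring[OF colourable_rest[OF p] finite_nb]) (rule that)
  have nb: "nb 1 = K 0 \<union> K 2 \<union> K 4"
    unfolding nb_def N by auto
  define C where "C i = c ` K i" for i
  have nbC: "c ` nb 1 = C 0 \<union> C 2 \<union> C 4" unfolding nb C_def by auto
  have d: "a \<notin> C j" if "i \<noteq> 1" "j \<noteq> 1" "i \<noteq> j" "j \<in> set (B ! i)" "a \<in> C i" for i j a
    using colour_classes_disjoint[OF c that(1-4)] that(5) unfolding C_def by blast
  have swap0: False if a: "\<alpha> \<in> C 0" "\<alpha> \<notin> C 2" "\<alpha> \<notin> C 4" and b: "\<beta> \<in> C 4" "\<beta> \<notin> C 0" for \<alpha> \<beta>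
  proof -
    have a6: "\<alpha> \<notin> C 6" by (rule d[OF _ _ _ _ a(1)]) (simp_all add: N)
    have b2: "\<beta> \<notin> C 2" by (rule d[OF _ _ _ _ b(1)]) (simp_all add: N)
    have b6: "\<beta> \<notin> C 6" by (rule d[OF _ _ _ _ b(1)]) (simp_all add: N)
    \<comment> \<open>Besides the deleted class 1, class 0 is adjacent to 5 and 6. Class 6 avoids
      both colours, and so does 2, the other neighbour of 5; chains through 0 stay in 0 and
      5.\<close>
    show False
      by (rule kempe_reduce[OF c min, of \<alpha> \<beta> "{0, 5}"])
        (use a b a6 b2 b6 in \<open>auto simp: nbC nbC[unfolded One_nat_def] N C_def[symmetric]\<close>)
  qed
  have t0: False if "(\<forall>a. a \<in> C 0 \<longrightarrow> a \<in> C 2 \<or> a \<in> C 4)"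
    by (rule witness_clique[OF c, of "{2, 4}" 0])
      (use that in \<open>auto simp: nbC nbC[unfolded One_nat_def] N len image_Un C_def[symmetric]\<close>)
  \<comment> \<open>All colours around 1 now occur on classes 0 and 2, both adjacent to class 5,
    which is the witness.\<close>
  have t1: False if "(\<forall>a. a \<in> C 4 \<longrightarrow> a \<in> C 0)"
  proof (rule witness_class[OF c _ card])
    have "a \<notin> C 5" if "a \<in> c ` nb 1" for a
    proof -
      have "a \<in> C 0 \<or> a \<in> C 2" using that \<open>(\<forall>a. a \<in> C 4 \<longrightarrow> a \<in> C 0)\<close> unfolding nbC by blast
      then show ?thesis using d[of 0 5 a] d[of 2 5 a] by (auto simp: N)
    qed
    then show "c ` nb 1 \<inter> c ` K 5 = {}" unfolding C_def by blast
  qed simp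
  \<comment> \<open>If neither inclusion holds, the two failures supply the colours \<alpha> and
    \<beta> of the swap.\<close>
  show False using swap0 t0 t1 by blast
qed

text \<open>The argument for \<open>pattern7b\<close> with the additional class 7. It joins the
  swapped set, as its neighbours 2 and 6 avoid both colours.\<close>

lemma (in critical_expansion) no_critical_pattern8b:
  assumes B: "B = pattern8b"
    and card: "card (K 1) \<le> card (K 5)"
  shows False
proof -
  have N: "set (B ! 0) = {1, 5, 6, 7}" "set (B ! 1) = {0, 2, 4}" "set (B ! 2) = {1, 3, 4, 5, 7}" "set (B ! 3) = {2, 6}" "set (B ! 4) = {1, 2, 6}" "set (B ! 5) = {0, 2}" "set (B ! 6) = {0, 3, 4, 7}" "set (B ! 7) = {0, 2, 6}"
    unfolding B pattern8b_def by auto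
  note N = N N[unfolded One_nat_def]
  have len: "length B = 8" unfolding B pattern8b_def by simp
  then have p: "1 < length B" by simp
  obtain c where c: "colouring E q (rest 1) c"
    and min: "\<And>c'. colouring E q (rest 1) c' \<Longrightarrow> c' ` nb 1 \<subseteq> c ` nb 1 \<Longrightarrow> c' ` nb 1 = c ` nb 1"
    by (rule minimal_colouring[OF colourable_rest[OF p] finite_nb]) (rule that)
  have nb: "nb 1 = K 0 \<union> K 2 \<union> K 4"
    unfolding nb_def N by auto
  define C where "C i = c ` K i" for i
  have nbC: "c ` nb 1 = C 0 \<union> C 2 \<union> C 4" unfolding nb C_def by auto
  have d: "a \<notin> C j" if "i \<noteq> 1" "j \<noteq> 1" "i \<noteq> j" "j \<in> set (B ! i)" "a \<in> C i" for i j a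
    using colour_classes_disjoint[OF c that(1-4)] that(5) unfolding C_def by blast
  have swap0: False if a: "\<alpha> \<in> C 0" "\<alpha> \<notin> C 2" "\<alpha> \<notin> C 4" and b: "\<beta> \<in> C 4" "\<beta> \<notin> C 0" for \<alpha> \<beta>
  proof -
    have a6: "\<alpha> \<notin> C 6" by (rule d[OF _ _ _ _ a(1)]) (simp_all add: N)
    have b2: "\<beta> \<notin> C 2" by (rule d[OF _ _ _ _ b(1)]) (simp_all add: N)
    have b6: "\<beta> \<notin> C 6" by (rule d[OF _ _ _ _ b(1)]) (simp_all add: N)
    show False
      by (rule kempe_reduce[OF c min, of \<alpha> \<beta> "{0, 5, 7}"])
        (use a b a6 b2 b6 in \<open>auto simp: nbC nbC[unfolded One_nat_def] N C_def[symmetric]\<close>)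
  qed
  have t0: False if "(\<forall>a. a \<in> C 0 \<longrightarrow> a \<in> C 2 \<or> a \<in> C 4)"
    by (rule witness_clique[OF c, of "{2, 4}" 0])
      (use that in \<open>auto simp: nbC nbC[unfolded One_nat_def] N len image_Un C_def[symmetric]\<close>)
  have t1: False if "(\<forall>a. a \<in> C 4 \<longrightarrow> a \<in> C 0)"
  proof (rule witness_class[OF c _ card])
    have "a \<notin> C 5" if "a \<in> c ` nb 1" for a
    proof -
      have "a \<in> C 0 \<or> a \<in> C 2" using that \<open>(\<forall>a. a \<in> C 4 \<longrightarrow> a \<in> C 0)\<close> unfolding nbC by blast
      then show ?thesis using d[of 0 5 a] d[of 2 5 a] by (auto simp: N)
    qed
    then show "c ` nb 1 \<inter> c ` K 5 = {}" unfolding C_def by blast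
  qed simp
  show False using swap0 t0 t1 by blast
qed

text \<open>The neighbours of 5 consist of the cliques of classes 0 and 2, 3. The swaps show that
  one of the two palettes contains the other, and the larger one lies on a clique through 5.\<close>

lemma (in critical_expansion) no_critical_pattern7a:
  assumes B: "B = pattern7a"
  shows False
proof -
  have N: "set (B ! 0) = {1, 4, 5, 6}" "set (B ! 1) = {0, 2}" "set (B ! 2) = {1, 3, 5, 6}" "set (B ! 3) = {2, 4, 5}" "set (B ! 4) = {0, 3, 6}" "set (B ! 5) = {0, 2, 3}" "set (B ! 6) = {0, 2, 4}"
    unfolding B pattern7a_def by auto
  note N = N N[unfolded One_nat_def]
  have len: "length B = 7" unfolding B pattern7a_def by simp
  then have p: "5 < length B" by simp
  obtain c where c: "colouring E q (rest 5) c"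
    and min: "\<And>c'. colouring E q (rest 5) c' \<Longrightarrow> c' ` nb 5 \<subseteq> c ` nb 5 \<Longrightarrow> c' ` nb 5 = c ` nb 5"
    by (rule minimal_colouring[OF colourable_rest[OF p] finite_nb]) (rule that)
  have nb: "nb 5 = K 0 \<union> K 2 \<union> K 3"
    unfolding nb_def N by auto
  define C where "C i = c ` K i" for i
  have nbC: "c ` nb 5 = C 0 \<union> C 2 \<union> C 3" unfolding nb C_def by auto
  have d: "a \<notin> C j" if "i \<noteq> 5" "j \<noteq> 5" "i \<noteq> j" "j \<in> set (B ! i)" "a \<in> C i" for i j a
    using colour_classes_disjoint[OF c that(1-4)] that(5) unfolding C_def by blast
  have swap0: False if a: "\<alpha> \<in> C 0" "\<alpha> \<notin> C 2" "\<alpha> \<notin> C 3" and b: "\<beta> \<in> C 2" "\<beta> \<notin> C 0" for \<alpha> \<beta>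
  proof -
    have a1: "\<alpha> \<notin> C 1" by (rule d[OF _ _ _ _ a(1)]) (simp_all add: N)
    have a6: "\<alpha> \<notin> C 6" by (rule d[OF _ _ _ _ a(1)]) (simp_all add: N)
    have b1: "\<beta> \<notin> C 1" by (rule d[OF _ _ _ _ b(1)]) (simp_all add: N)
    have b3: "\<beta> \<notin> C 3" by (rule d[OF _ _ _ _ b(1)]) (simp_all add: N)
    have b6: "\<beta> \<notin> C 6" by (rule d[OF _ _ _ _ b(1)]) (simp_all add: N)
    show False
      by (rule kempe_reduce[OF c min, of \<alpha> \<beta> "{0, 4}"])
        (use a b a1 a6 b1 b3 b6 in \<open>auto simp: nbC nbC[unfolded One_nat_def] N C_def[symmetric]\<close>)
  qed
  have swap1: False if a: "\<alpha> \<in> C 0" "\<alpha> \<notin> C 2" "\<alpha> \<notin> C 3" and b: "\<beta> \<in> C 3" "\<beta> \<notin> C 0" for \<alpha> \<beta>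
  proof -
    have a4: "\<alpha> \<notin> C 4" by (rule d[OF _ _ _ _ a(1)]) (simp_all add: N)
    have b2: "\<beta> \<notin> C 2" by (rule d[OF _ _ _ _ b(1)]) (simp_all add: N)
    have b4: "\<beta> \<notin> C 4" by (rule d[OF _ _ _ _ b(1)]) (simp_all add: N)
    show False
      by (rule kempe_reduce[OF c min, of \<alpha> \<beta> "{0, 1, 6}"])
        (use a b a4 b2 b4 in \<open>auto simp: nbC nbC[unfolded One_nat_def] N C_def[symmetric]\<close>)
  qed
  have t0: False if "(\<forall>a. a \<in> C 0 \<longrightarrow> a \<in> C 2 \<or> a \<in> C 3)"
    by (rule witness_clique[OF c, of "{2, 3}" 0])
      (use that in \<open>auto simp: nbC nbC[unfolded One_nat_def] N len image_Un C_def[symmetric]\<close>)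
  have t1: False if "(\<forall>a. a \<in> C 2 \<longrightarrow> a \<in> C 0) \<and> (\<forall>a. a \<in> C 3 \<longrightarrow> a \<in> C 0)"
    by (rule witness_clique[OF c, of "{0}" 1])
      (use that in \<open>auto simp: nbC nbC[unfolded One_nat_def] N len image_Un C_def[symmetric]\<close>)
  show False using swap0 swap1 t0 t1 by blast
qed

text \<open>Classes 3 and 5 are witnesses for each other. Here the one that is not larger is 5; the
  next lemma treats the opposite comparison, so together they cover all cases.\<close>

lemma (in critical_expansion) no_critical_pattern8a_5:
  assumes B: "B = pattern8a"
    and card: "card (K 5) \<le> card (K 3)"
  shows False
proof -
  have N: "set (B ! 0) = {1, 5, 6, 7}" "set (B ! 1) = {0, 2, 4}" "set (B ! 2) = {1, 3, 5, 6}" "set (B ! 3) = {2, 6, 7}" "set (B ! 4) = {1, 6, 7}" "set (B ! 5) = {0, 2, 7}" "set (B ! 6) = {0, 2, 3, 4}" "set (B ! 7) = {0, 3, 4, 5}"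
    unfolding B pattern8a_def by auto
  note N = N N[unfolded One_nat_def]
  have len: "length B = 8" unfolding B pattern8a_def by simp
  then have p: "5 < length B" by simp
  obtain c where c: "colouring E q (rest 5) c"
    and min: "\<And>c'. colouring E q (rest 5) c' \<Longrightarrow> c' ` nb 5 \<subseteq> c ` nb 5 \<Longrightarrow> c' ` nb 5 = c ` nb 5"
    by (rule minimal_colouring[OF colourable_rest[OF p] finite_nb]) (rule that)
  have nb: "nb 5 = K 0 \<union> K 2 \<union> K 7"
    unfolding nb_def N by auto
  define C where "C i = c ` K i" for i
  have nbC: "c ` nb 5 = C 0 \<union> C 2 \<union> C 7" unfolding nb C_def by auto
  have d: "a \<notin> C j" if "i \<noteq> 5" "j \<noteq> 5" "i \<noteq> j" "j \<in> set (B ! i)" "a \<in> C i" for i j a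
    using colour_classes_disjoint[OF c that(1-4)] that(5) unfolding C_def by blast
  have swap0: False if a: "\<alpha> \<in> C 0" "\<alpha> \<notin> C 2" and b: "\<beta> \<in> C 2" "\<beta> \<notin> C 0" "\<beta> \<notin> C 7" for \<alpha> \<beta>
  proof -
    have a1: "\<alpha> \<notin> C 1" by (rule d[OF _ _ _ _ a(1)]) (simp_all add: N)
    have a6: "\<alpha> \<notin> C 6" by (rule d[OF _ _ _ _ a(1)]) (simp_all add: N)
    have a7: "\<alpha> \<notin> C 7" by (rule d[OF _ _ _ _ a(1)]) (simp_all add: N)
    have b1: "\<beta> \<notin> C 1" by (rule d[OF _ _ _ _ b(1)]) (simp_all add: N)
    have b6: "\<beta> \<notin> C 6" by (rule d[OF _ _ _ _ b(1)]) (simp_all add: N)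
    show False
      by (rule kempe_reduce[OF c min, of \<alpha> \<beta> "{0}"])
        (use a b a1 a6 a7 b1 b6 in \<open>auto simp: nbC nbC[unfolded One_nat_def] N C_def[symmetric]\<close>)
  qed
  have t0: False if "(\<forall>a. a \<in> C 0 \<longrightarrow> a \<in> C 2)"
  proof (rule witness_class[OF c _ card])
    have "a \<notin> C 3" if "a \<in> c ` nb 5" for a
    proof -
      have "a \<in> C 2 \<or> a \<in> C 7" using that \<open>(\<forall>a. a \<in> C 0 \<longrightarrow> a \<in> C 2)\<close> unfolding nbC by blast
      then show ?thesis using d[of 2 3 a] d[of 7 3 a] by (auto simp: N)
    qed
    then show "c ` nb 5 \<inter> c ` K 3 = {}" unfolding C_def by blast
  qed simp
  have t1: False if "(\<forall>a. a \<in> C 2 \<longrightarrow> a \<in> C 0 \<or> a \<in> C 7)"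
    by (rule witness_clique[OF c, of "{0, 7}" 1])
      (use that in \<open>auto simp: nbC nbC[unfolded One_nat_def] N len image_Un C_def[symmetric]\<close>)
  show False using swap0 t0 t1 by blast
qed

lemma (in critical_expansion) no_critical_pattern8a_3:
  assumes B: "B = pattern8a"
    and card: "card (K 3) \<le> card (K 5)"
  shows False
proof -
  have N: "set (B ! 0) = {1, 5, 6, 7}" "set (B ! 1) = {0, 2, 4}" "set (B ! 2) = {1, 3, 5, 6}" "set (B ! 3) = {2, 6, 7}" "set (B ! 4) = {1, 6, 7}" "set (B ! 5) = {0, 2, 7}" "set (B ! 6) = {0, 2, 3, 4}" "set (B ! 7) = {0, 3, 4, 5}"
    unfolding B pattern8a_def by auto
  note N = N N[unfolded One_nat_def]
  have len: "length B = 8" unfolding B pattern8a_def by simp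
  then have p: "3 < length B" by simp
  obtain c where c: "colouring E q (rest 3) c"
    and min: "\<And>c'. colouring E q (rest 3) c' \<Longrightarrow> c' ` nb 3 \<subseteq> c ` nb 3 \<Longrightarrow> c' ` nb 3 = c ` nb 3"
    by (rule minimal_colouring[OF colourable_rest[OF p] finite_nb]) (rule that)
  have nb: "nb 3 = K 2 \<union> K 6 \<union> K 7"
    unfolding nb_def N by auto
  define C where "C i = c ` K i" for i
  have nbC: "c ` nb 3 = C 2 \<union> C 6 \<union> C 7" unfolding nb C_def by auto
  have d: "a \<notin> C j" if "i \<noteq> 3" "j \<noteq> 3" "i \<noteq> j" "j \<in> set (B ! i)" "a \<in> C i" for i j a
    using colour_classes_disjoint[OF c that(1-4)] that(5) unfolding C_def by blast
  have swap0: False if a: "\<alpha> \<in> C 6" "\<alpha> \<notin> C 7" and b: "\<beta> \<in> C 7" "\<beta> \<notin> C 2" "\<beta> \<notin> C 6" for \<alpha> \<beta>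
  proof -
    have a0: "\<alpha> \<notin> C 0" by (rule d[OF _ _ _ _ a(1)]) (simp_all add: N)
    have a2: "\<alpha> \<notin> C 2" by (rule d[OF _ _ _ _ a(1)]) (simp_all add: N)
    have a4: "\<alpha> \<notin> C 4" by (rule d[OF _ _ _ _ a(1)]) (simp_all add: N)
    have b0: "\<beta> \<notin> C 0" by (rule d[OF _ _ _ _ b(1)]) (simp_all add: N)
    have b4: "\<beta> \<notin> C 4" by (rule d[OF _ _ _ _ b(1)]) (simp_all add: N)
    show False
      by (rule kempe_reduce[OF c min, of \<alpha> \<beta> "{6}"])
        (use a b a0 a2 a4 b0 b4 in \<open>auto simp: nbC nbC[unfolded One_nat_def] N C_def[symmetric]\<close>)
  qed
  have t0: False if "(\<forall>a. a \<in> C 6 \<longrightarrow> a \<in> C 7)"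
  proof (rule witness_class[OF c _ card])
    have "a \<notin> C 5" if "a \<in> c ` nb 3" for a
    proof -
      have "a \<in> C 2 \<or> a \<in> C 7" using that \<open>(\<forall>a. a \<in> C 6 \<longrightarrow> a \<in> C 7)\<close> unfolding nbC by blast
      then show ?thesis using d[of 2 5 a] d[of 7 5 a] by (auto simp: N)
    qed
    then show "c ` nb 3 \<inter> c ` K 5 = {}" unfolding C_def by blast
  qed simp
  have t1: False if "(\<forall>a. a \<in> C 7 \<longrightarrow> a \<in> C 2 \<or> a \<in> C 6)"
    by (rule witness_clique[OF c, of "{2, 6}" 0])
      (use that in \<open>auto simp: nbC nbC[unfolded One_nat_def] N len image_Un C_def[symmetric]\<close>)
  show False using swap0 t0 t1 by blast
qed

text \<open>Swapping class 1 alone is enough, since its remaining neighbours 0, 2 and 5 avoid both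
  colours. The witness is 3, whose neighbours 2 and 8 are also neighbours of 4.\<close>

lemma (in critical_expansion) no_critical_pattern9a:
  assumes B: "B = pattern9a"
    and card: "card (K 4) \<le> card (K 3)"
  shows False
proof -
  have N: "set (B ! 0) = {1, 6, 7, 8}" "set (B ! 1) = {0, 2, 4, 5}" "set (B ! 2) = {1, 3, 4, 6, 7}" "set (B ! 3) = {2, 8}" "set (B ! 4) = {1, 2, 8}" "set (B ! 5) = {1, 7, 8}" "set (B ! 6) = {0, 2, 8}" "set (B ! 7) = {0, 2, 5}" "set (B ! 8) = {0, 3, 4, 5, 6}"
    unfolding B pattern9a_def by auto
  note N = N N[unfolded One_nat_def]
  have len: "length B = 9" unfolding B pattern9a_def by simp
  then have p: "4 < length B" by simp
  obtain c where c: "colouring E q (rest 4) c"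
    and min: "\<And>c'. colouring E q (rest 4) c' \<Longrightarrow> c' ` nb 4 \<subseteq> c ` nb 4 \<Longrightarrow> c' ` nb 4 = c ` nb 4"
    by (rule minimal_colouring[OF colourable_rest[OF p] finite_nb]) (rule that)
  have nb: "nb 4 = K 1 \<union> K 2 \<union> K 8"
    unfolding nb_def N by auto
  define C where "C i = c ` K i" for i
  have nbC: "c ` nb 4 = C 1 \<union> C 2 \<union> C 8" unfolding nb C_def by auto
  have d: "a \<notin> C j" if "i \<noteq> 4" "j \<noteq> 4" "i \<noteq> j" "j \<in> set (B ! i)" "a \<in> C i" for i j a
    using colour_classes_disjoint[OF c that(1-4)] that(5) unfolding C_def by blast
  have swap0: False if a: "\<alpha> \<in> C 1" "\<alpha> \<notin> C 8" and b: "\<beta> \<in> C 8" "\<beta> \<notin> C 1" "\<beta> \<notin> C 2" for \<alpha> \<beta>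
  proof -
    have a0: "\<alpha> \<notin> C 0" by (rule d[OF _ _ _ _ a(1)]) (simp_all add: N)
    have a2: "\<alpha> \<notin> C 2" by (rule d[OF _ _ _ _ a(1)]) (simp_all add: N)
    have a5: "\<alpha> \<notin> C 5" by (rule d[OF _ _ _ _ a(1)]) (simp_all add: N)
    have b0: "\<beta> \<notin> C 0" by (rule d[OF _ _ _ _ b(1)]) (simp_all add: N)
    have b5: "\<beta> \<notin> C 5" by (rule d[OF _ _ _ _ b(1)]) (simp_all add: N)
    show False
      by (rule kempe_reduce[OF c min, of \<alpha> \<beta> "{1}"])
        (use a b a0 a2 a5 b0 b5 in \<open>auto simp: nbC nbC[unfolded One_nat_def] N C_def[symmetric]\<close>)
  qed
  have t0: False if "(\<forall>a. a \<in> C 1 \<longrightarrow> a \<in> C 8)"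
  proof (rule witness_class[OF c _ card])
    have "a \<notin> C 3" if "a \<in> c ` nb 4" for a
    proof -
      have "a \<in> C 2 \<or> a \<in> C 8" using that \<open>(\<forall>a. a \<in> C 1 \<longrightarrow> a \<in> C 8)\<close> unfolding nbC by blast
      then show ?thesis using d[of 2 3 a] d[of 8 3 a] by (auto simp: N)
    qed
    then show "c ` nb 4 \<inter> c ` K 3 = {}" unfolding C_def by blast
  qed simp
  have t1: False if "(\<forall>a. a \<in> C 8 \<longrightarrow> a \<in> C 1 \<or> a \<in> C 2)"
    by (rule witness_clique[OF c, of "{1, 2}" 0])
      (use that in \<open>auto simp: nbC nbC[unfolded One_nat_def] N len image_Un C_def[symmetric]\<close>)
  show False using swap0 t0 t1 by blast
qed

text \<open>Around 0, compare the palettes of 1, 8 with those of 3, 6. The first swap forces class 1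
  or class 3 into the opposite palettes, the second swap class 6 or class 8. The four combinations
  are \<open>t0\<close> to \<open>t3\<close>.\<close>

lemma (in critical_expansion) no_critical_pattern9b_0:
  assumes B: "B = pattern9b"
    and card: "card (K 0) \<le> card (K 2)" "card (K 0) \<le> card (K 7)"
  shows False
proof -
  have N: "set (B ! 0) = {1, 3, 6, 8}" "set (B ! 1) = {0, 2, 4, 7}" "set (B ! 2) = {1, 3, 5, 8}" "set (B ! 3) = {0, 2, 4, 6}" "set (B ! 4) = {1, 3, 5, 7}" "set (B ! 5) = {2, 4, 6, 8}" "set (B ! 6) = {0, 3, 5, 7}" "set (B ! 7) = {1, 4, 6, 8}" "set (B ! 8) = {0, 2, 5, 7}"
    unfolding B pattern9b_def by auto
  note N = N N[unfolded One_nat_def]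
  have len: "length B = 9" unfolding B pattern9b_def by simp
  then have p: "0 < length B" by simp
  obtain c where c: "colouring E q (rest 0) c"
    and min: "\<And>c'. colouring E q (rest 0) c' \<Longrightarrow> c' ` nb 0 \<subseteq> c ` nb 0 \<Longrightarrow> c' ` nb 0 = c ` nb 0"
    by (rule minimal_colouring[OF colourable_rest[OF p] finite_nb]) (rule that)
  have nb: "nb 0 = K 1 \<union> K 3 \<union> K 6 \<union> K 8"
    unfolding nb_def N by auto
  define C where "C i = c ` K i" for i
  have nbC: "c ` nb 0 = C 1 \<union> C 3 \<union> C 6 \<union> C 8" unfolding nb C_def by auto
  have d: "a \<notin> C j" if "i \<noteq> 0" "j \<noteq> 0" "i \<noteq> j" "j \<in> set (B ! i)" "a \<in> C i" for i j a
    using colour_classes_disjoint[OF c that(1-4)] that(5) unfolding C_def by blast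
  have swap0: False if a: "\<alpha> \<in> C 3" "\<alpha> \<notin> C 1" "\<alpha> \<notin> C 8" and b: "\<beta> \<in> C 1" "\<beta> \<notin> C 3" "\<beta> \<notin> C 6" for \<alpha> \<beta>
  proof -
    have a2: "\<alpha> \<notin> C 2" by (rule d[OF _ _ _ _ a(1)]) (simp_all add: N)
    have a4: "\<alpha> \<notin> C 4" by (rule d[OF _ _ _ _ a(1)]) (simp_all add: N)
    have a6: "\<alpha> \<notin> C 6" by (rule d[OF _ _ _ _ a(1)]) (simp_all add: N)
    have b2: "\<beta> \<notin> C 2" by (rule d[OF _ _ _ _ b(1)]) (simp_all add: N)
    have b4: "\<beta> \<notin> C 4" by (rule d[OF _ _ _ _ b(1)]) (simp_all add: N)
    show False
      by (rule kempe_reduce[OF c min, of \<alpha> \<beta> "{3}"])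
        (use a b a2 a4 a6 b2 b4 in \<open>auto simp: nbC nbC[unfolded One_nat_def] N C_def[symmetric]\<close>)
  qed
  have swap1: False if a: "\<alpha> \<in> C 6" "\<alpha> \<notin> C 1" "\<alpha> \<notin> C 8" and b: "\<beta> \<in> C 8" "\<beta> \<notin> C 3" "\<beta> \<notin> C 6" for \<alpha> \<beta>
  proof -
    have a3: "\<alpha> \<notin> C 3" by (rule d[OF _ _ _ _ a(1)]) (simp_all add: N)
    have a5: "\<alpha> \<notin> C 5" by (rule d[OF _ _ _ _ a(1)]) (simp_all add: N)
    have a7: "\<alpha> \<notin> C 7" by (rule d[OF _ _ _ _ a(1)]) (simp_all add: N)
    have b5: "\<beta> \<notin> C 5" by (rule d[OF _ _ _ _ b(1)]) (simp_all add: N)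
    have b7: "\<beta> \<notin> C 7" by (rule d[OF _ _ _ _ b(1)]) (simp_all add: N)
    show False
      by (rule kempe_reduce[OF c min, of \<alpha> \<beta> "{6}"])
        (use a b a3 a5 a7 b5 b7 in \<open>auto simp: nbC nbC[unfolded One_nat_def] N C_def[symmetric]\<close>)
  qed
  have t0: False if "(\<forall>a. a \<in> C 1 \<longrightarrow> a \<in> C 3 \<or> a \<in> C 6) \<and> (\<forall>a. a \<in> C 8 \<longrightarrow> a \<in> C 3 \<or> a \<in> C 6)"
    by (rule witness_clique[OF c, of "{3, 6}" 1])
      (use that in \<open>auto simp: nbC nbC[unfolded One_nat_def] N len image_Un C_def[symmetric]\<close>)
  have t1: False if "(\<forall>a. a \<in> C 3 \<longrightarrow> a \<in> C 1 \<or> a \<in> C 8) \<and> (\<forall>a. a \<in> C 6 \<longrightarrow> a \<in> C 1 \<or> a \<in> C 8)"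
  proof (rule witness_class[OF c _ card(1)])
    have "a \<notin> C 2" if "a \<in> c ` nb 0" for a
    proof -
      have "a \<in> C 1 \<or> a \<in> C 8" using that \<open>(\<forall>a. a \<in> C 3 \<longrightarrow> a \<in> C 1 \<or> a \<in> C 8) \<and> (\<forall>a. a \<in> C 6 \<longrightarrow> a \<in> C 1 \<or> a \<in> C 8)\<close> unfolding nbC by blast
      then show ?thesis using d[of 1 2 a] d[of 8 2 a] by (auto simp: N)
    qed
    then show "c ` nb 0 \<inter> c ` K 2 = {}" unfolding C_def by blast
  qed simp
  have t2: False if "(\<forall>a. a \<in> C 3 \<longrightarrow> a \<in> C 1 \<or> a \<in> C 8) \<and> (\<forall>a. a \<in> C 8 \<longrightarrow> a \<in> C 3 \<or> a \<in> C 6)"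
  proof (rule witness_class[OF c _ card(2)])
    have "a \<notin> C 7" if "a \<in> c ` nb 0" for a
    proof -
      have "a \<in> C 1 \<or> a \<in> C 6 \<or> a \<in> C 8" using that \<open>(\<forall>a. a \<in> C 3 \<longrightarrow> a \<in> C 1 \<or> a \<in> C 8) \<and> (\<forall>a. a \<in> C 8 \<longrightarrow> a \<in> C 3 \<or> a \<in> C 6)\<close> unfolding nbC by blast
      then show ?thesis using d[of 1 7 a] d[of 6 7 a] d[of 8 7 a] by (auto simp: N)
    qed
    then show "c ` nb 0 \<inter> c ` K 7 = {}" unfolding C_def by blast
  qed simp
  have t3: False if "(\<forall>a. a \<in> C 6 \<longrightarrow> a \<in> C 1 \<or> a \<in> C 8) \<and> (\<forall>a. a \<in> C 1 \<longrightarrow> a \<in> C 3 \<or> a \<in> C 6)"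
  proof (rule witness_class[OF c _ card(1)])
    have "a \<notin> C 2" if "a \<in> c ` nb 0" for a
    proof -
      have "a \<in> C 1 \<or> a \<in> C 3 \<or> a \<in> C 8" using that \<open>(\<forall>a. a \<in> C 6 \<longrightarrow> a \<in> C 1 \<or> a \<in> C 8) \<and> (\<forall>a. a \<in> C 1 \<longrightarrow> a \<in> C 3 \<or> a \<in> C 6)\<close> unfolding nbC by blast
      then show ?thesis using d[of 1 2 a] d[of 3 2 a] d[of 8 2 a] by (auto simp: N)
    qed
    then show "c ` nb 0 \<inter> c ` K 2 = {}" unfolding C_def by blast
  qed simp
  show False using swap0 swap1 t0 t1 t2 t3 by blast
qed

context adjacency
begin

text \<open>A rotation of the circulant graph moves a smallest class to position 0, where it is
  compared with classes 2 and 7.\<close>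

lemma no_critical_pattern9b:
  assumes ce: "critical_expansion E V q pattern9b cl"
  shows False
proof -
  interpret ce: critical_expansion E V q pattern9b cl by (rule ce)
  have len: "length pattern9b = 9" by (simp add: pattern9b_def)
  obtain p where p: "p < 9" "\<And>i. i < 9 \<Longrightarrow> card (ce.K p) \<le> card (ce.K i)"
    using ex_has_least_nat[of "\<lambda>i. i < 9" 0 "\<lambda>i. card (ce.K i)"] by auto
  define rot where "rot i = (if p \<le> i then i - p else i + 9 - p)" for i
  define cl' where "cl' x = rot (cl x)" for x
  have rot_inv: "rot ((i + p) mod 9) = i" if "i < 9" for i
    using that p(1) unfolding rot_def by (cases "i + p < 9") (auto simp: mod_if)
  have rot_lt: "rot i < 9" and rot_eq: "rot i = k \<longleftrightarrow> i = (k + p) mod 9" if "i < 9" "k < 9" for i k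
    using that p(1) unfolding rot_def by (auto simp: mod_if)
  have rot_inj: "rot i = rot j \<longleftrightarrow> i = j" if "i < 9" "j < 9" for i j
    using that p(1) unfolding rot_def by auto
  have "list_all (\<lambda>s. list_all (\<lambda>i. list_all (\<lambda>j.
      (j \<in> set (pattern9b ! i)) \<longleftrightarrow>
      ((if s \<le> j then j - s else j + 9 - s) \<in> set (pattern9b ! (if s \<le> i then i - s else i + 9 - s))))
      [0..<9]) [0..<9]) [0..<9]"
    by code_simp
  note table = this[unfolded list_all_iff]
  have rot_adj: "j \<in> set (pattern9b ! i) \<longleftrightarrow> rot j \<in> set (pattern9b ! rot i)" if "i < 9" "j < 9" for i j
  proof -
    have m: "p \<in> set [0..<9]" "i \<in> set [0..<9]" "j \<in> set [0..<9]" using that p(1) by simp_all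
    show ?thesis unfolding rot_def by (rule bspec[OF bspec[OF bspec[OF table m(1)] m(2)] m(3)])
  qed
  have clV: "cl x < 9" if "x \<in> V" for x using ce.V_eq[OF that] len by simp
  have "expansion_of E V pattern9b cl'"
    unfolding expansion_of_def
  proof (intro conjI ballI allI impI)
    show "cl' x < length pattern9b" if "x \<in> V" for x
      using rot_lt[OF clV[OF that], of 0] len unfolding cl'_def by simp
    show "\<exists>x\<in>V. cl' x = i" if "i < length pattern9b" for i
    proof -
      have "(i + p) mod 9 < length pattern9b" using len by simp
      then obtain x where "x \<in> ce.K ((i + p) mod 9)" using ce.K_nonempty by blast
      then have "x \<in> V" "cl' x = i" using rot_inv[of i] that len unfolding ce.K_def cl'_def by auto
      then show ?thesis by blast
    qed
    show "E x y \<longleftrightarrow> x \<noteq> y \<and> (cl' x = cl' y \<or> cl' y \<in> set (pattern9b ! cl' x))" if "x \<in> V" "y \<in> V" for x y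
      using ce.K_adj[of x "cl x" y "cl y"] ce.V_eq[OF that(1)] ce.V_eq[OF that(2)]
        rot_inj[OF clV[OF that(1)] clV[OF that(2)]] rot_adj[OF clV[OF that(1)] clV[OF that(2)]]
      unfolding cl'_def by simp
  qed
  then interpret ce': critical_expansion E V q pattern9b cl'
    using critical_expansionI[OF ce.fin ce.crit] by blast
  have K': "ce'.K i = ce.K ((i + p) mod 9)" if "i < 9" for i
    unfolding ce'.K_def ce.K_def cl'_def using rot_eq[OF clV that] by auto
  have "card (ce'.K 0) \<le> card (ce'.K i)" if "i < 9" for i
    using p(2)[of "(i + p) mod 9"] p(1) K'[OF that] K'[of 0] by simp
  then show False using ce'.no_critical_pattern9b_0[OF refl] by simp
qed

text \<open>The twins of \<open>5\<close> and the exceptional vertices \<open>Z\<close> need not form a clique. They are attached to the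
  rest only along the classes 0 and 2, 3, so two colourings can be glued once the first one has been
  changed by Kempe swaps so as to use as few colours as possible on these classes.\<close>

lemma no_critical_pattern6:
  assumes rp: "rigid_pattern E V pattern6 [[], [5]]" and f: "embeds E V pattern6 f"
    and crit: "critical E q V" and fin: "finite V" and P5: "P5_free E V" and gem: "gem_free E V"
  shows False
proof -
  interpret rigid_pattern E V pattern6 "[[], [5]]" by (rule rp)
  have len: "length pattern6 = 6" by (simp add: pattern6_def)
  have N: "set (pattern6 ! 0) = {1, 4, 5}" "set (pattern6 ! 1) = {0, 2}" "set (pattern6 ! 2) = {1, 3, 5}"
    "set (pattern6 ! 3) = {2, 4, 5}" "set (pattern6 ! 4) = {0, 3}" "set (pattern6 ! 5) = {0, 2, 3}"
    unfolding pattern6_def by auto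
  note N = N N[unfolded One_nat_def]
  define T where "T i = A f i" for i
  define Z where "Z = V - (\<Union>i<6. T i)"
  have TV: "T i \<subseteq> V" for i unfolding T_def using twin_classD(1) by blast
  have adj: "E x y \<longleftrightarrow> j \<in> set (pattern6 ! i)" if "x \<in> T i" "y \<in> T j" "i < 6" "j < 6" "i \<noteq> j" for x y i j
    using twin_class_adjacent[OF f, of i j x y] that len unfolding T_def by simp
  have disj: "T i \<inter> T j = {}" if "i < 6" "j < 6" "i \<noteq> j" for i j
    using twin_class_disjoint[of _ f i j] that len unfolding T_def by auto
  have fT: "f i \<in> T i" if "i < 6" for i using embeds_in_twin_class[OF f] that len unfolding T_def by simp
  have exc: "\<not> E z (f i)" if "z \<in> Z" "i < 5" for z i
  proof -
    have "z \<in> V" "\<And>i. i < 6 \<Longrightarrow> z \<notin> T i" using that unfolding Z_def by auto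
    then have "\<exists>s\<in>{[], [5]}. \<forall>j<6. E z (f j) \<longleftrightarrow> j \<in> set s"
      using twin_class_or_exceptional[OF f, of z] len unfolding T_def by auto
    then show ?thesis using that(2) by auto
  qed
  \<comment> \<open>Hence exceptional vertices see no twin of 0 to 4. Position 5 is left out because
    flipping it interchanges the two exceptional types.\<close>
  have irreg: "list_all (\<lambda>j. \<not> regular_type pattern6 [[], [5]] (flip j []) \<and>
      \<not> regular_type pattern6 [[], [5]] (flip j [5])) [0..<5]"
    by code_simp
  have ZT: "\<not> E z y" if z: "z \<in> Z" "y \<in> T j" "j < 5" for z y j
  proof -
    have zV: "z \<in> V" using z unfolding Z_def by blast
    have "type_of E pattern6 f z = (if E z (f 5) then [5] else [])"
    proof -
      have "[0..<length pattern6] = [0..<5] @ [5]" unfolding len by (simp add: upt_conv_Cons)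
      moreover have "filter (\<lambda>i. E z (f i)) [0..<5] = []" using exc[OF z(1)] by (simp add: filter_empty_conv)
      ultimately show ?thesis unfolding type_of_def by simp
    qed
    moreover have "\<not> regular_type pattern6 [[], [5]] (flip j [])" "\<not> regular_type pattern6 [[], [5]] (flip j [5])"
      using irreg z(3) unfolding list_all_iff by simp_all
    ultimately have "\<not> regular_type pattern6 [[], [5]] (flip j (type_of E pattern6 f z))" by simp
    then show ?thesis
      using twin_class_homogeneous_pair[OF f _ _ zV, of j y] z(2,3) len exc[OF z(1,3)] unfolding T_def by simp
  qed
  have unmixed: "E x a \<longleftrightarrow> E x (f i)" if i: "i < 5" and xa: "x \<in> V - T i" "a \<in> T i" for x a i
  proof (cases "x \<in> Z")
    case True
    then show ?thesis using ZT[OF True xa(2) i] exc[OF True i] by simp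
  next
    case False
    then obtain j where j: "j < 6" "x \<in> T j" using xa(1) unfolding Z_def by auto
    then have "j \<noteq> i" using xa(1) by blast
    then show ?thesis using adj[OF j(2) xa(2) j(1)] adj[OF j(2) fT j(1)] i by simp
  qed
  have cl: "clique E (T i)" if "i < 5" "k < 6" "k \<in> set (pattern6 ! i)" for i k
    unfolding T_def
    by (rule twin_class_clique[OF crit fin P5 gem f, of i k])
      (use that len unmixed[OF that(1)] in \<open>auto simp: T_def\<close>)
  have cliques: "clique E (T 0)" "clique E (T 2)" "clique E (T 3)"
    using cl[of 0 1] cl[of 2 1] cl[of 3 2] by (simp_all add: N)
  then have clique23: "clique E (T 2 \<union> T 3)"
    using adj[of _ 2 _ 3] adj[of _ 3 _ 2] unfolding clique_def by (auto simp: N)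
  define U where "U = T 0 \<union> T 1 \<union> T 2 \<union> T 3 \<union> T 4"
  define N0 where "N0 = T 0 \<union> T 2 \<union> T 3"
  define P where "P = T 5 \<union> Z"
  have six: "{..<6} = {0, 1, 2, 3, 4, 5 :: nat}" by auto
  have Vp: "V = U \<union> P" "U \<inter> P = {}"
  proof -
    show "V = U \<union> P" using TV unfolding U_def P_def Z_def six by auto
    show "U \<inter> P = {}"
      using disj[of 0 5] disj[of 1 5] disj[of 2 5] disj[of 3 5] disj[of 4 5]
      unfolding U_def P_def Z_def six by auto
  qed
  have "f 5 \<in> P" "f 1 \<in> T 1" using fT unfolding P_def by auto
  then have sub: "U \<subset> V" "V - T 1 \<subset> V" using Vp TV[of 1] by blast+
  have finN: "finite N0" unfolding N0_def using TV fin finite_subset by (metis finite_UnI)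
  have "colourable E q U" "colourable E q (V - T 1)" using crit sub unfolding critical_def by simp_all
  from minimal_colouring[OF this(1) finN]
  obtain c where c: "colouring E q U c"
    and min: "\<And>c'. colouring E q U c' \<Longrightarrow> c' ` N0 \<subseteq> c ` N0 \<Longrightarrow> c' ` N0 = c ` N0"
    by metis
  \<comment> \<open>\<open>d\<close> colours \<open>T 5\<close> and \<open>Z\<close> together with
    \<open>N0\<close>. The presence of \<open>N0\<close> is what limits the number of colours that
    \<open>d\<close> can use on \<open>T 5\<close>.\<close>
  obtain d where d: "colouring E q (V - T 1) d"
    using \<open>colourable E q (V - T 1)\<close> unfolding colourable_def by blast
  define C where "C i = c ` T i" for i
  have TU: "T i \<subseteq> U" if "i < 5" for i
    using that unfolding U_def by (auto simp: less_Suc_eq numeral_eq_Suc)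
  have dj: "a \<notin> C j" if "i < 5" "j < 5" "i \<noteq> j" "j \<in> set (pattern6 ! i)" and aC: "a \<in> C i" for i j a
  proof
    assume "a \<in> C j"
    then obtain x y where xy: "x \<in> T i" "y \<in> T j" "a = c x" "a = c y" using aC unfolding C_def by blast
    then have "E x y" using adj[OF xy(1,2)] that by simp
    moreover have "x \<in> U" "y \<in> U" using xy TU that(1,2) by blast+
    ultimately show False using colouring_neq[OF c] xy by fastforce
  qed
  have swap: False
    if a: "\<alpha> \<in> C 0" "\<alpha> \<notin> C 2" "\<alpha> \<notin> C 3" and b: "\<beta> \<in> C 2 \<union> C 3" "\<beta> \<notin> C 0"
      and S: "0 \<in> S" "2 \<notin> S" "3 \<notin> S" "S \<subseteq> {..<5}"
        "\<And>i j. i \<in> S \<Longrightarrow> j < 5 \<Longrightarrow> j \<in> set (pattern6 ! i) \<Longrightarrow> j \<notin> S \<Longrightarrow> \<alpha> \<notin> C j \<and> \<beta> \<notin> C j"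
    for \<alpha> \<beta> S
  proof -
    let ?S = "\<Union>i\<in>S. T i"
    define c' where "c' = (\<lambda>x. if x \<in> ?S then (id(\<alpha> := \<beta>, \<beta> := \<alpha>)) (c x) else c x)"
    have "\<alpha> \<in> c ` U" "\<beta> \<in> c ` U" using a(1) b(1) TU[of 0] TU[of 2] TU[of 3] unfolding C_def by auto
    then have lt: "\<alpha> < q" "\<beta> < q" using colouring_lt[OF c] by auto
    have inS: "x \<in> ?S \<longleftrightarrow> i \<in> S" if "x \<in> T i" "i < 5" for x i
    proof
      assume "x \<in> ?S"
      then obtain j where j: "j \<in> S" "x \<in> T j" by blast
      then have "j < 5" using S(4) by auto
      then show "i \<in> S" using disj[of i j] that j by fastforce
    qed (use that in blast)
    have "colouring E q U c'"
      unfolding c'_def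
    proof (rule swap_colouring[OF c lt])
      fix x y assume xy: "x \<in> ?S" "x \<in> U" "y \<in> U - ?S" "E x y"
      then obtain i where i: "i \<in> S" "x \<in> T i" by blast
      have i5: "i < 5" using i S(4) by auto
      obtain j where j: "j < 5" "y \<in> T j"
        using xy(3) unfolding U_def by (auto intro: that[of 0] that[of 1] that[of 2] that[of 3] that[of 4])
      have "j \<notin> S" using inS[OF j(2,1)] xy(3) by blast
      moreover have "j \<in> set (pattern6 ! i)" using adj[OF i(2) j(2)] i5 j(1) xy(4) i(1) \<open>j \<notin> S\<close> by auto
      ultimately have "\<alpha> \<notin> C j \<and> \<beta> \<notin> C j" using S(5)[OF i(1) j(1)] by blast
      then show "c y \<noteq> \<alpha> \<and> c y \<noteq> \<beta>" using j(2) unfolding C_def by blast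
    qed
    moreover have N0C: "c ` N0 = C 0 \<union> C 2 \<union> C 3" unfolding N0_def C_def by auto
    have *: "c' x \<noteq> \<alpha> \<and> c' x \<in> c ` N0" if x: "x \<in> N0" for x
    proof -
      consider "x \<in> T 0" | "x \<in> T 2" | "x \<in> T 3" using x unfolding N0_def by blast
      then show ?thesis
      proof cases
        case 1
        then have cx: "c x \<in> C 0" "x \<in> ?S" using S(1) unfolding C_def by auto
        then have "c x \<noteq> \<beta>" using b(2) by auto
        then show ?thesis using cx b unfolding c'_def N0C by (cases "c x = \<alpha>") auto
      next
        case 2
        then have cx: "c x \<in> C 2" "x \<notin> ?S" using inS[OF 2] S(2) unfolding C_def by auto
        then have "c x \<noteq> \<alpha>" using a(2) by auto
        then show ?thesis using cx unfolding c'_def N0C by auto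
      next
        case 3
        then have cx: "c x \<in> C 3" "x \<notin> ?S" using inS[OF 3] S(3) unfolding C_def by auto
        then have "c x \<noteq> \<alpha>" using a(3) by auto
        then show ?thesis using cx unfolding c'_def N0C by auto
      qed
    qed
    ultimately have "c' ` N0 = c ` N0" using min[of c'] by blast
    moreover have "\<alpha> \<in> c ` N0" using a(1) unfolding N0C by blast
    ultimately have "\<alpha> \<in> c' ` N0" by simp
    then obtain x where "x \<in> N0" "c' x = \<alpha>" by blast
    then show False using * by blast
  qed
  \<comment> \<open>Otherwise a swap reduces the colours on \<open>N0\<close>: a \<beta> on class 2
    cannot reach 1, so the chains stay in 0 and 4; a \<beta> on class 3 cannot reach 4, so they stay
    in 0 and 1.\<close>
  have nested: "C 0 \<subseteq> C 2 \<union> C 3 \<or> C 2 \<union> C 3 \<subseteq> C 0"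
  proof (rule ccontr)
    assume "\<not> ?thesis"
    then obtain \<alpha> \<beta> where a: "\<alpha> \<in> C 0" "\<alpha> \<notin> C 2" "\<alpha> \<notin> C 3" and b: "\<beta> \<in> C 2 \<union> C 3" "\<beta> \<notin> C 0" by blast
    have a14: "\<alpha> \<notin> C 1" "\<alpha> \<notin> C 4" using dj[OF _ _ _ _ a(1)] by (simp_all add: N)
    from b(1) show False
    proof
      assume b2: "\<beta> \<in> C 2"
      have b13: "\<beta> \<notin> C 1" "\<beta> \<notin> C 3" using dj[OF _ _ _ _ b2] by (simp_all add: N)
      show False
        by (rule swap[OF a b, of "{0, 4}"]) (use a a14 b b13 in \<open>auto simp: N\<close>)
    next
      assume b3: "\<beta> \<in> C 3"
      have b24: "\<beta> \<notin> C 2" "\<beta> \<notin> C 4" using dj[OF _ _ _ _ b3] by (simp_all add: N)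
      show False
        by (rule swap[OF a b, of "{0, 1}"]) (use a a14 b b24 in \<open>auto simp: N\<close>)
    qed
  qed
  have dT: "card (d ` T 5) + card Q \<le> q" if Q: "clique E Q" "Q \<subseteq> N0" "\<And>x y. x \<in> Q \<Longrightarrow> y \<in> T 5 \<Longrightarrow> E x y" for Q
  proof -
    have T5: "T 5 \<subseteq> V - T 1" using disj[of 1 5] TV by auto
    have QV: "Q \<subseteq> V - T 1"
    proof -
      have "N0 \<inter> T 1 = {}"
        unfolding N0_def using disj[of 0 1] disj[of 2 1] disj[of 3 1] by (simp add: Int_Un_distrib2)
      moreover have "N0 \<subseteq> V" unfolding N0_def using TV[of 0] TV[of 2] TV[of 3] by simp
      ultimately show ?thesis using Q(2) by blast
    qed
    have fin': "finite (T 5)" "finite Q"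
      using finite_subset[OF T5] finite_subset[OF QV] fin by simp_all
    have "card (d ` T 5) + card (d ` Q) = card (d ` T 5 \<union> d ` Q)"
    proof (rule card_Un_disjoint[symmetric])
      show "d ` T 5 \<inter> d ` Q = {}"
      proof (rule ccontr)
        assume "d ` T 5 \<inter> d ` Q \<noteq> {}"
        then obtain x y where "x \<in> Q" "y \<in> T 5" "d x = d y" by force
        then show False using colouring_neq[OF d, of x y] Q(3) T5 QV by blast
      qed
    qed (use fin' in auto)
    also have "\<dots> \<le> card {..<q}"
      by (rule card_mono) (use colouring_lt[OF d] T5 QV in fastforce)+
    finally show ?thesis using colouring_clique_card[OF d Q(1) QV] by simp
  qed
  have "card (c ` N0) + card (d ` T 5) \<le> q"
  proof -
    have N0C: "c ` N0 = C 0 \<union> C 2 \<union> C 3" unfolding N0_def C_def by auto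
    from nested show ?thesis
    proof
      assume "C 0 \<subseteq> C 2 \<union> C 3"
      then have "c ` N0 = c ` (T 2 \<union> T 3)" unfolding N0C C_def by auto
      then have "card (c ` N0) = card (T 2 \<union> T 3)"
        using colouring_clique_card[OF c clique23] TU[of 2] TU[of 3] by simp
      moreover have "card (d ` T 5) + card (T 2 \<union> T 3) \<le> q"
        by (rule dT[OF clique23]) (use adj[of _ 2 _ 5] adj[of _ 3 _ 5] in \<open>auto simp: N N0_def\<close>)
      ultimately show ?thesis by simp
    next
      assume "C 2 \<union> C 3 \<subseteq> C 0"
      then have "c ` N0 = c ` T 0" unfolding N0C C_def by auto
      then have "card (c ` N0) = card (T 0)"
        using colouring_clique_card[OF c cliques(1)] TU[of 0] by simp
      moreover have "card (d ` T 5) + card (T 0) \<le> q"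
        by (rule dT[OF cliques(1)]) (use adj[of _ 0 _ 5] in \<open>auto simp: N N0_def\<close>)
      ultimately show ?thesis by simp
    qed
  qed
  moreover have dP: "P \<subseteq> V - T 1" using disj[of 1 5] TV unfolding P_def Z_def by auto
  have c_lt: "c ` N0 \<subseteq> {..<q}" using colouring_lt[OF c] TU[of 0] TU[of 2] TU[of 3] unfolding N0_def by fastforce
  have d_lt: "d ` T 5 \<subseteq> {..<q}" using colouring_lt[OF d] dP unfolding P_def by fastforce
  have "card ({..<q} - c ` N0) = q - card (c ` N0)"
    using c_lt finN by (simp add: card_Diff_subset)
  ultimately have "card (d ` T 5) \<le> card ({..<q} - c ` N0)" by simp
  \<comment> \<open>Renaming the colours of \<open>d\<close> by \<pi> makes \<open>T 5\<close> avoid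
    everything that \<open>c\<close> uses on \<open>N0\<close>, the only place where the two parts
    are joined by edges.\<close>
  then obtain \<pi> where \<pi>: "bij_betw \<pi> {..<q} {..<q}" "\<pi> ` (d ` T 5) \<subseteq> {..<q} - c ` N0"
    using ex_bij_into[OF d_lt, of "{..<q} - c ` N0"] by auto
  define e where "e = (\<lambda>x. if x \<in> U then c x else \<pi> (d x))"
  have cross: "e x \<noteq> e y" if xy: "x \<in> U" "y \<in> P" "E x y" for x y
  proof -
    have "y \<in> T 5"
    proof (rule ccontr)
      assume "y \<notin> T 5"
      then have "y \<in> Z" using xy(2) unfolding P_def by blast
      moreover obtain j where "j < 5" "x \<in> T j"
        using xy(1) unfolding U_def by (auto intro: that[of 0] that[of 1] that[of 2] that[of 3] that[of 4])
      ultimately show False using ZT[of y x j] sym[OF xy(3)] by blast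
    qed
    moreover have "x \<in> N0"
      using xy(1,3) \<open>y \<in> T 5\<close> adj[of x 1 y 5] adj[of x 4 y 5] unfolding U_def N0_def by (auto simp: N)
    moreover have "y \<notin> U" using xy(2) Vp(2) by blast
    ultimately show ?thesis using xy(1) \<pi>(2) unfolding e_def by force
  qed
  have "colouring E q V e"
    unfolding colouring_def
  proof (intro conjI ballI impI)
    fix v assume "v \<in> V"
    show "e v < q"
    proof (cases "v \<in> U")
      case True
      then show ?thesis using colouring_lt[OF c] unfolding e_def by simp
    next
      case False
      then have "d v < q" using \<open>v \<in> V\<close> Vp(1) dP colouring_lt[OF d, of v] by blast
      then show ?thesis using bij_betwE[OF \<pi>(1)] False unfolding e_def by simp
    qed
  next
    fix x y assume xy: "x \<in> V" "y \<in> V" "E x y"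
    consider "x \<in> U" "y \<in> U" | "x \<in> U" "y \<in> P" "y \<notin> U" | "x \<in> P" "y \<in> U" | "x \<in> P" "y \<in> P"
      using xy Vp by blast
    then show "e x \<noteq> e y"
    proof cases
      case 1
      then show ?thesis using colouring_neq[OF c 1 xy(3)] unfolding e_def by simp
    next
      case 2
      then show ?thesis using cross xy(3) by blast
    next
      case 3
      then show ?thesis using cross[OF 3(2,1) sym[OF xy(3)]] by simp
    next
      case 4
      then have "d x \<noteq> d y" "d x < q" "d y < q"
        using colouring_neq[OF d, of x y] colouring_lt[OF d] xy(3) dP by blast+
      then have "\<pi> (d x) \<noteq> \<pi> (d y)" using bij_betw_imp_inj_on[OF \<pi>(1)] unfolding inj_on_def by auto
      moreover have "x \<notin> U" "y \<notin> U" using 4 Vp(2) by auto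
      ultimately show ?thesis unfolding e_def by simp
    qed
  qed
  then show False using crit unfolding critical_def colourable_def by blast
qed

end

context adjacency
begin

section \<open>Critical graphs are clique expansions\<close>

lemma containsI:
  assumes "distinct xs" "set xs \<subseteq> V" "length xs = length B"
    and "\<And>i j. i < length B \<Longrightarrow> j < length B \<Longrightarrow> E (xs ! i) (xs ! j) \<longleftrightarrow> j \<in> set (B ! i)"
  shows "contains E V B"
proof -
  have "embeds E V B ((!) xs)"
    unfolding embeds_def using assms by (auto simp: inj_on_def nth_eq_iff_index_eq)
  then show ?thesis unfolding contains_def by blast
qed

lemma P5_free_if_not_contains:
  assumes "\<not> contains E V path5"
  shows "P5_free E V"
  unfolding P5_free_def
proof (intro ballI impI, rule ccontr)
  fix a b c d e
  assume V: "a \<in> V" "b \<in> V" "c \<in> V" "d \<in> V" "e \<in> V"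
    and E: "E a b" "E b c" "E c d" "E d e" and "\<not> (E a c \<or> E a d \<or> E a e \<or> E b d \<or> E b e \<or> E c e)"
  then have nE: "\<not> E a c" "\<not> E a d" "\<not> E a e" "\<not> E b d" "\<not> E b e" "\<not> E c e" by auto
  have nE': "\<not> E c a" "\<not> E d a" "\<not> E e a" "\<not> E d b" "\<not> E e b" "\<not> E e c" using nE sym by blast+
  have "contains E V path5"
    by (rule containsI[where xs = "[a, b, c, d, e]"])
      (use V E nE nE' E[THEN sym] irrefl in \<open>auto simp: path5_def less_Suc_eq\<close>)
  then show False using assms by blast
qed

lemma gem_free_if_not_contains:
  assumes "\<not> contains E V gem_pattern"
  shows "gem_free E V"
  unfolding gem_free_def
proof (intro ballI impI, rule ccontr)
  fix a b c d z
  assume V: "a \<in> V" "b \<in> V" "c \<in> V" "d \<in> V" "z \<in> V"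
    and E: "E a b" "E b c" "E c d" "E z a" "E z b" "E z c" "E z d" and "\<not> (E a c \<or> E a d \<or> E b d)"
  then have nE: "\<not> E a c" "\<not> E a d" "\<not> E b d" by auto
  have nE': "\<not> E c a" "\<not> E d a" "\<not> E d b" using nE sym by blast+
  have "contains E V gem_pattern"
    by (rule containsI[where xs = "[a, b, c, d, z]"])
      (use V E nE nE' E[THEN sym] irrefl in \<open>auto simp: gem_pattern_def less_Suc_eq\<close>)
  then show False using assms by blast
qed

lemma C5_free_if_not_contains:
  assumes "\<not> contains E V cycle5"
  shows "C5_free E V"
  unfolding C5_free_def
proof (intro ballI impI, rule ccontr)
  fix a b c d e
  assume V: "a \<in> V" "b \<in> V" "c \<in> V" "d \<in> V" "e \<in> V"
    and E: "E a b" "E b c" "E c d" "E d e" "E e a" and "\<not> (E a c \<or> E a d \<or> E b d \<or> E b e \<or> E c e)"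
  then have nE: "\<not> E a c" "\<not> E a d" "\<not> E b d" "\<not> E b e" "\<not> E c e" by auto
  have nE': "\<not> E c a" "\<not> E d a" "\<not> E d b" "\<not> E e b" "\<not> E e c" using nE sym by blast+
  have "contains E V cycle5"
    by (rule containsI[where xs = "[a, b, c, d, e]"])
      (use V E nE nE' E[THEN sym] irrefl in \<open>auto simp: cycle5_def less_Suc_eq\<close>)
  then show False using assms by blast
qed

lemma critical_expansion_or_not_contains:
  assumes crit: "critical E q V" and fin: "finite V" and P5: "\<not> contains E V path5"
    and gem: "\<not> contains E V gem_pattern"
    and check: "check_tree F B [[]] [] [] T" "rigid B [[]]" "no_isolated B"
    and F: "\<And>H. H \<in> set F \<Longrightarrow> \<not> contains E V H"
  shows "\<not> contains E V B \<or> (\<exists>cl. critical_expansion E V q B cl)"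
proof (cases "contains E V B")
  case True
  then obtain f where f: "embeds E V B f" unfolding contains_def by blast
  interpret rigid_pattern E V B "[[]]"
    by unfold_locales (use regular_type_if_checked[OF check(1) F] check(2) in blast)+
  obtain cl where "expansion_of E V B cl"
    using expansion_if_critical[OF crit fin P5_free_if_not_contains[OF P5] gem_free_if_not_contains[OF gem]
        f refl check(3)] by blast
  then show ?thesis using critical_expansionI[OF fin crit] by blast
qed simp

text \<open>\<open>pattern_G7\<close> is set aside first because it may survive. The others are
  eliminated in an order in which each decision tree cites only graphs already known to be absent:
  the patterns with nine vertices, then \<open>pattern8a\<close>, \<open>pattern8b\<close>,
  \<open>pattern7b\<close>, \<open>pattern7a\<close> and \<open>pattern6\<close>. When even the
  five-cycle is absent, perfection forces a clique.\<close>

theorem critical_structure: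
  assumes crit: "critical E q V" and fin: "finite V" and P5: "\<not> contains E V path5"
    and gem: "\<not> contains E V gem_pattern"
  shows "clique E V \<or> (\<exists>cl. critical_expansion E V q cycle5 cl) \<or>
    (\<exists>cl. critical_expansion E V q pattern_G7 cl)"
proof (cases "\<exists>cl. critical_expansion E V q pattern_G7 cl")
  case False
  note step = critical_expansion_or_not_contains[OF crit fin P5 gem]
  have G7: "\<not> contains E V pattern_G7"
    using step[OF check_pattern_G7 rigid_pattern_G7 no_isolated_pattern_G7] P5 gem False by auto
  have B9a: "\<not> contains E V pattern9a"
  proof -
    \<comment> \<open>The comparison of classes 4 and 3 follows from the inclusion of their
      neighbourhoods. The patterns 8b and 7b are treated alike with classes 1 and 5.\<close>
    have False if "critical_expansion E V q pattern9a cl" for cl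
      using critical_expansion.no_critical_pattern9a[OF that refl]
        inclusion_card_less[OF that, of 3 4] by (simp add: pattern9a_def)
    then show ?thesis using step[OF check_pattern9a rigid_pattern9a no_isolated_pattern9a] P5 gem by auto
  qed
  have B9b: "\<not> contains E V pattern9b"
    using step[OF check_pattern9b rigid_pattern9b no_isolated_pattern9b] P5 gem
      no_critical_pattern9b by auto
  have B8a: "\<not> contains E V pattern8a"
  proof -
    have False if "critical_expansion E V q pattern8a cl" for cl
      using critical_expansion.no_critical_pattern8a_3[OF that refl]
        critical_expansion.no_critical_pattern8a_5[OF that refl] linear by blast
    then show ?thesis
      using step[OF check_pattern8a rigid_pattern8a no_isolated_pattern8a] P5 gem B9a B9b by auto
  qed
  have B8b: "\<not> contains E V pattern8b"
  proof -
    have False if "critical_expansion E V q pattern8b cl" for cl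
      using critical_expansion.no_critical_pattern8b[OF that refl]
        inclusion_card_less[OF that, of 5 1] by (simp add: pattern8b_def)
    then show ?thesis
      using step[OF check_pattern8b rigid_pattern8b no_isolated_pattern8b] P5 gem B9a B8a by auto
  qed
  have B7: "\<not> contains E V pattern7b"
  proof -
    have False if "critical_expansion E V q pattern7b cl" for cl
      using critical_expansion.no_critical_pattern7b[OF that refl]
        inclusion_card_less[OF that, of 5 1] by (simp add: pattern7b_def)
    then show ?thesis
      using step[OF check_pattern7b rigid_pattern7b no_isolated_pattern7b] P5 gem B8a B8b by auto
  qed
  have W2: "\<not> contains E V pattern7a"
    using step[OF check_pattern7a rigid_pattern7a no_isolated_pattern7a] P5 gem G7 B7
      critical_expansion.no_critical_pattern7a[OF _ refl] by auto
  have W1: "\<not> contains E V pattern6"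
  proof
    assume "contains E V pattern6"
    then obtain f where f: "embeds E V pattern6 f" unfolding contains_def by blast
    have F: "\<not> contains E V H" if "H \<in> set [path5, gem_pattern, pattern7b, pattern7a]" for H
      using that P5 gem B7 W2 by auto
    have "rigid_pattern E V pattern6 [[], [5]]"
      by unfold_locales (use regular_type_if_checked[OF check_pattern6 F] rigid_pattern6 in blast)+
    then show False
      by (rule no_critical_pattern6[OF _ f crit fin P5_free_if_not_contains[OF P5]
            gem_free_if_not_contains[OF gem]])
  qed
  have "\<not> contains E V cycle5 \<or> (\<exists>cl. critical_expansion E V q cycle5 cl)"
    using step[OF check_cycle5 rigid_cycle5 no_isolated_cycle5] P5 gem W1 by auto
  moreover have "clique E V" if C5: "\<not> contains E V cycle5"
  proof (rule ccontr)
    assume n: "\<not> clique E V"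
    have "card Q \<le> q" if Q: "Q \<subseteq> V" "clique E Q" for Q
    proof -
      have "Q \<subset> V" using Q n by blast
      then have "colourable E q Q" using crit unfolding critical_def by simp
      then obtain c where "colouring E q Q c" unfolding colourable_def by blast
      then show ?thesis using colouring_clique_le Q(2) by blast
    qed
    then have "colourable E q V"
      by (rule C5_free_colourable[OF fin P5_free_if_not_contains[OF P5] gem_free_if_not_contains[OF gem]
            C5_free_if_not_contains[OF C5]])
    then show False using crit unfolding critical_def by blast
  qed
  ultimately show ?thesis by blast
qed simp

end

section \<open>The clique sizes\<close>

definition stable_in :: "pattern \<Rightarrow> nat list \<Rightarrow> bool" where
  "stable_in B S \<longleftrightarrow> list_all (\<lambda>i. list_all (\<lambda>j. j \<notin> set (B ! i)) S) S"

text \<open>Truncated subtraction lets a stable set contain classes that are already exhausted, so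
  maximal stable sets suffice for covering.\<close>

definition deduct :: "nat list \<Rightarrow> nat list \<Rightarrow> nat list" where
  "deduct S n = map (\<lambda>i. if i \<in> set S then n ! i - 1 else n ! i) [0..<length n]"

text \<open>\<open>cover a sts ord q n\<close> searches for \<open>q\<close> sets from \<open>sts\<close> covering each vertex \<open>i\<close> at least
  \<open>n ! i\<close> times; the next set has to contain the first uncovered vertex in the order \<open>ord\<close>, and
  \<open>a\<close> bounds the sizes of the sets.\<close>

fun cover :: "nat \<Rightarrow> nat list list \<Rightarrow> nat list \<Rightarrow> nat \<Rightarrow> nat list \<Rightarrow> bool" where
  "cover a sts ord 0 n \<longleftrightarrow> list_all (\<lambda>x. x = 0) n"
| "cover a sts ord (Suc q) n \<longleftrightarrow>
     (case find (\<lambda>i. n ! i \<noteq> 0) ord of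
        None \<Rightarrow> list_all (\<lambda>x. x = 0) n
      | Some i \<Rightarrow> sum_list n \<le> a * Suc q \<and>
          list_ex (\<lambda>S. i \<in> set S \<and> cover a sts ord q (deduct S n)) sts)"

text \<open>All maximal stable sets of \<open>G7\<close>; each has three elements.\<close>

definition stable_G7 :: "nat list list" where
  "stable_G7 = [[5, 6, 7], [2, 6, 7], [0, 5, 7], [2, 4, 7], [0, 4, 7], [1, 5, 6], [2, 3, 6], [1, 3, 6]]"

text \<open>Classes with the fewest alternatives come first: 0, 1, 3, 4 lie in two of the stable
  sets, 2 and 5 in three, 6 and 7 in five.\<close>

definition order_G7 :: "nat list" where
  "order_G7 = [0, 1, 3, 4, 2, 5, 6, 7]"

definition critical_weights_G7 :: "nat list list" where
  "critical_weights_G7 =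
     [[1, 4, 1, 4, 1, 1, 5, 2], [1, 3, 2, 4, 1, 1, 5, 2], [1, 2, 3, 4, 1, 1, 5, 2],
      [1, 1, 4, 4, 1, 1, 5, 2], [1, 3, 2, 3, 1, 2, 5, 2], [1, 2, 3, 3, 1, 2, 5, 2],
      [2, 3, 1, 3, 2, 1, 4, 3], [2, 2, 2, 3, 2, 1, 4, 3], [1, 3, 2, 3, 2, 1, 4, 3],
      [2, 1, 3, 3, 2, 1, 4, 3], [1, 2, 3, 3, 2, 1, 4, 3], [1, 1, 4, 3, 2, 1, 4, 3],
      [2, 2, 2, 3, 1, 2, 4, 3], [2, 1, 3, 3, 1, 2, 4, 3], [2, 2, 2, 2, 2, 2, 4, 3],
      [1, 2, 3, 2, 2, 2, 4, 3], [1, 3, 2, 3, 1, 1, 5, 3], [1, 2, 3, 3, 1, 1, 5, 3],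
      [1, 1, 4, 3, 1, 1, 5, 3], [1, 3, 2, 2, 1, 2, 5, 3], [1, 2, 3, 2, 1, 2, 5, 3],
      [1, 1, 3, 3, 1, 2, 5, 3], [2, 2, 2, 2, 2, 1, 4, 4], [2, 1, 3, 2, 2, 1, 4, 4],
      [1, 1, 4, 2, 2, 1, 4, 4], [2, 2, 2, 2, 1, 2, 4, 4], [2, 1, 3, 2, 1, 2, 4, 4],
      [1, 1, 3, 2, 2, 2, 4, 4], [1, 2, 3, 2, 1, 1, 5, 4], [1, 1, 4, 2, 1, 1, 5, 4],
      [1, 2, 3, 1, 1, 2, 5, 4], [1, 2, 2, 2, 1, 2, 5, 4], [1, 1, 3, 2, 1, 2, 5, 4],
      [1, 1, 4, 1, 1, 1, 5, 5], [1, 1, 3, 1, 1, 2, 5, 5]]"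

text \<open>A Klein four-group of automorphisms. The vector obtained from \<open>n\<close> by
  \<open>p\<close> has entry \<open>n ! (p ! i)\<close> at position \<open>i\<close>.\<close>

definition aut_G7 :: "nat list list" where
  "aut_G7 = [[0, 1, 2, 3, 4, 5, 6, 7], [1, 0, 2, 4, 3, 5, 7, 6], [3, 4, 5, 0, 1, 2, 7, 6], [4, 3, 5, 1, 0, 2, 6, 7]]"

text \<open>Here 18 is 3 times 6, the number of vertices that six stable sets can cover. Up to this
  order a colouring is exhibited, from 20 on \<open>total_bound\<close> gives a contradiction, and
  at 19 only the listed vectors remain.\<close>

definition weight_ok_G7 :: "nat list \<Rightarrow> bool" where
  "weight_ok_G7 n \<longleftrightarrow> sum_list n \<le> 18 \<and> cover 3 stable_G7 order_G7 6 n \<or>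
     20 \<le> sum_list n \<or> list_ex (\<lambda>p. map ((!) n) p \<in> set critical_weights_G7) aut_G7"

text \<open>The disjuncts negate necessary conditions: a clique has at most 6 vertices, a closed
  neighbourhood at least 7, and nested neighbourhoods force a strict comparison such as
  \<open>b < g\<close>. Each is tested as soon as its variables are bound. Sizes stop at 5 because
  every class forms a clique with another nonempty class.\<close>

lemma weights_G7_checked:
  "list_all (\<lambda>a. list_all (\<lambda>b. list_all (\<lambda>c. 6 < a + b + c \<or>
   list_all (\<lambda>d. 6 < a + d \<or> list_all (\<lambda>e. 6 < b + e \<or>
   list_all (\<lambda>f. 6 < d + e + f \<or> 6 < c + f \<or> a + b + c + f < 7 \<or> d + e + f + c < 7 \<or>
   list_all (\<lambda>g. 6 < a + g \<or> 6 < e + g \<or> g \<le> b \<or> g \<le> d \<or> a + g + e < 7 \<or>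
   list_all (\<lambda>h. 6 < b + h \<or> 6 < d + h \<or> h \<le> a \<or> h \<le> e \<or> b + h + d < 7 \<or>
      a + b + c + d + g < 7 \<or> a + b + c + e + h < 7 \<or> d + e + f + a + h < 7 \<or> d + e + f + b + g < 7 \<or>
      weight_ok_G7 [a, b, c, d, e, f, g, h])
   [1..<6]) [1..<6]) [1..<6]) [1..<6]) [1..<6]) [1..<6]) [1..<6]) [1..<6]"
  by code_simp

definition stable_cycle5 :: "nat list list" where
  "stable_cycle5 = [[0, 2], [0, 3], [1, 3], [1, 4], [2, 4]]"

definition critical_weights_cycle5 :: "nat list list" where
  "critical_weights_cycle5 =
     [[5, 1, 5, 1, 1], [5, 1, 4, 2, 1], [4, 2, 4, 2, 1],
      [5, 1, 3, 3, 1], [4, 2, 3, 3, 1], [3, 3, 3, 3, 1],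
      [4, 2, 2, 4, 1], [4, 2, 3, 2, 2], [3, 3, 3, 2, 2],
      [3, 3, 2, 3, 2]]"

definition aut_cycle5 :: "nat list list" where
  "aut_cycle5 = [[0, 1, 2, 3, 4], [1, 2, 3, 4, 0], [2, 3, 4, 0, 1], [3, 4, 0, 1, 2], [4, 0, 1, 2, 3],
     [4, 3, 2, 1, 0], [3, 2, 1, 0, 4], [2, 1, 0, 4, 3], [1, 0, 4, 3, 2], [0, 4, 3, 2, 1]]"

definition weight_ok_cycle5 :: "nat list \<Rightarrow> bool" where
  "weight_ok_cycle5 n \<longleftrightarrow> sum_list n \<le> 12 \<and> cover 2 stable_cycle5 [0..<5] 6 n \<or>
     14 \<le> sum_list n \<or> list_ex (\<lambda>p. map ((!) n) p \<in> set critical_weights_cycle5) aut_cycle5"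

lemma weights_cycle5_checked:
  "list_all (\<lambda>a. list_all (\<lambda>b. 6 < a + b \<or> list_all (\<lambda>c. 6 < b + c \<or> a + b + c < 7 \<or>
   list_all (\<lambda>d. 6 < c + d \<or> b + c + d < 7 \<or>
   list_all (\<lambda>e. 6 < d + e \<or> 6 < e + a \<or> c + d + e < 7 \<or> d + e + a < 7 \<or> e + a + b < 7 \<or>
      weight_ok_cycle5 [a, b, c, d, e])
   [1..<6]) [1..<6]) [1..<6]) [1..<6]) [1..<6]"
  by code_simp

text \<open>With \<open>a = 1\<close> this says that the classes in \<open>I\<close> form a clique,
  so one notion serves for cliques and for the independence number.\<close>

definition stable_bound :: "pattern \<Rightarrow> nat list \<Rightarrow> nat \<Rightarrow> bool" where
  "stable_bound B I a \<longleftrightarrow> distinct I \<and> list_all (\<lambda>s. \<not> stable_in B s \<or> length s \<le> a) (subseqs I)"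

definition loopless :: "pattern \<Rightarrow> bool" where
  "loopless B \<longleftrightarrow> list_all (\<lambda>i. i \<notin> set (B ! i) \<and> distinct (B ! i) \<and> list_all (\<lambda>j. j < length B) (B ! i))
     [0..<length B]"

definition automorphism :: "pattern \<Rightarrow> nat list \<Rightarrow> bool" where
  "automorphism B p \<longleftrightarrow> length p = length B \<and> distinct p \<and> list_all (\<lambda>i. i < length B) p \<and>
     list_all (\<lambda>i. list_all (\<lambda>j. j \<in> set (B ! i) \<longleftrightarrow> p ! j \<in> set (B ! (p ! i))) [0..<length B]) [0..<length B]"

lemma checks_G7:
  "list_all (stable_in pattern_G7) stable_G7" "list_all (automorphism pattern_G7) aut_G7"
  "loopless pattern_G7" "stable_bound pattern_G7 [0..<8] 3"
  "list_all (\<lambda>I. stable_bound pattern_G7 I 1)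
     [[0, 1, 2], [0, 3], [1, 4], [3, 4, 5], [2, 5], [0, 6], [4, 6], [1, 7], [3, 7]]"
  by code_simp+

lemma weights_G7_vertex_deleted:
  "list_all (\<lambda>n. length n = 8 \<and> list_all (\<lambda>x. x \<noteq> 0) n \<and> sum_list n = 19 \<and>
     list_all (\<lambda>i. cover 3 stable_G7 order_G7 6 (deduct [i] n)) [0..<8]) critical_weights_G7"
  by code_simp

lemma checks_cycle5:
  "list_all (stable_in cycle5) stable_cycle5" "list_all (automorphism cycle5) aut_cycle5"
  "loopless cycle5" "stable_bound cycle5 [0..<5] 2"
  "list_all (\<lambda>I. stable_bound cycle5 I 1) [[0, 1], [1, 2], [2, 3], [3, 4], [4, 0]]"
  by code_simp+

lemma weights_cycle5_vertex_deleted: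
  "list_all (\<lambda>n. length n = 5 \<and> list_all (\<lambda>x. x \<noteq> 0) n \<and> sum_list n = 13 \<and>
     list_all (\<lambda>i. cover 2 stable_cycle5 [0..<5] 6 (deduct [i] n)) [0..<5]) critical_weights_cycle5"
  by code_simp

lemma loopless_iff:
  "loopless B \<longleftrightarrow> (\<forall>i<length B. i \<notin> set (B ! i) \<and> distinct (B ! i) \<and> (\<forall>j\<in>set (B ! i). j < length B))"
  unfolding loopless_def list_all_iff by auto

lemma expansion_ofD:
  assumes "expansion_of E V B cl" "x \<in> V"
  shows "cl x < length B" "\<And>y. y \<in> V \<Longrightarrow> E x y \<longleftrightarrow> x \<noteq> y \<and> (cl x = cl y \<or> cl y \<in> set (B ! cl x))"
  using assms unfolding expansion_of_def by auto

context adjacency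
begin

text \<open>Each stable set found by the search becomes a colour class consisting of one
  representative of each of its classes that is still inhabited. Weights are only upper bounds,
  which absorbs the truncation in \<open>deduct\<close>.\<close>

lemma colourable_if_cover:
  assumes exp: "expansion_of E V B cl" and fin: "finite V" and sts: "list_all (stable_in B) sts"
  shows "U \<subseteq> V \<Longrightarrow> length n = length B \<Longrightarrow> (\<And>i. i < length B \<Longrightarrow> card {x \<in> U. cl x = i} \<le> n ! i)
    \<Longrightarrow> cover a sts ord q n \<Longrightarrow> colourable E q U"
proof (induction q arbitrary: U n)
  have empty: "U = {}" if "U \<subseteq> V" "length n = length B"
    "\<And>i. i < length B \<Longrightarrow> card {x \<in> U. cl x = i} \<le> n ! i" "list_all (\<lambda>x. x = 0) n" for U n
  proof (rule ccontr)
    assume "U \<noteq> {}"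
    then obtain x where x: "x \<in> U" by blast
    then have i: "cl x < length B" using expansion_ofD(1)[OF exp] that(1) by blast
    then have "n ! cl x = 0" using that(2,4) by (simp add: list_all_length)
    then have "card {y \<in> U. cl y = cl x} = 0" using that(3)[OF i] by simp
    moreover have "finite U" using that(1) fin finite_subset by blast
    ultimately show False using x by auto
  qed
  have triv: "colourable E q {}" for q unfolding colourable_def colouring_def by simp
  {
    case 0
    then show ?case using empty[of U n] triv by simp
  next
    case (Suc q)
    note prems = Suc.prems
    show ?case
    proof (cases "find (\<lambda>i. n ! i \<noteq> 0) ord")
      case None
      then show ?thesis using empty[of U n] triv prems by simp
    next
      case (Some i)
      then obtain S where S: "S \<in> set sts" "cover a sts ord q (deduct S n)"
        using prems(4) by (auto simp: list_ex_iff)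
      have st: "stable_in B S" using sts S(1) by (simp add: list_all_iff)
      \<comment> \<open>\<open>r\<close> fixes one representative per class, so that removing
        \<open>X\<close> lowers every inhabited class of \<open>S\<close> by exactly one.\<close>
      define r where "r = (\<lambda>i. SOME x. x \<in> U \<and> cl x = i)"
      have r: "r i \<in> U \<and> cl (r i) = i" if "x \<in> U" "cl x = i" for x i
        using someI[of "\<lambda>x. x \<in> U \<and> cl x = i" x] that unfolding r_def by blast
      define X where "X = {x \<in> U. cl x \<in> set S \<and> r (cl x) = x}"
      have finU: "finite U" using prems(1) fin finite_subset by blast
      have "colourable E q (U - X)"
      proof (rule Suc.IH[OF _ _ _ S(2)])
        show "U - X \<subseteq> V" using prems(1) by blast
        show "length (deduct S n) = length B" using prems(2) unfolding deduct_def by simp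
        fix i assume i: "i < length B"
        have nth: "deduct S n ! i = (if i \<in> set S then n ! i - 1 else n ! i)"
          using i prems(2) unfolding deduct_def by simp
        have le: "card {x \<in> U. cl x = i} \<le> n ! i" by (rule prems(3)[OF i])
        show "card {x \<in> U - X. cl x = i} \<le> deduct S n ! i"
        proof (cases "i \<in> set S \<and> (\<exists>x\<in>U. cl x = i)")
          case True
          then have ri: "r i \<in> U" "cl (r i) = i" using r by blast+
          then have "{x \<in> U - X. cl x = i} \<subseteq> {x \<in> U. cl x = i} - {r i}" using True unfolding X_def by auto
          then have "card {x \<in> U - X. cl x = i} \<le> card ({x \<in> U. cl x = i} - {r i})"
            using finU by (intro card_mono) auto
          also have "\<dots> = card {x \<in> U. cl x = i} - 1" using ri finU by (intro card_Diff_singleton) auto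
          finally show ?thesis using le nth True by simp
        next
          case False
          show ?thesis
          proof (cases "i \<in> set S")
            case True
            then have "{x \<in> U - X. cl x = i} = {}" using False by blast
            then show ?thesis by (metis card.empty le0)
          next
            case ns: False
            have "card {x \<in> U - X. cl x = i} \<le> card {x \<in> U. cl x = i}"
              using finU by (intro card_mono) auto
            then show ?thesis using le nth ns by simp
          qed
        qed
      qed
      then obtain c where c: "colouring E q (U - X) c" unfolding colourable_def by blast
      define d where "d = (\<lambda>x. if x \<in> X then q else c x)"
      have stX: "\<not> E x y" if "x \<in> X" "y \<in> X" for x y
      proof
        assume xy: "E x y"
        have "x \<in> V" "y \<in> V" using that prems(1) unfolding X_def by auto
        then have "x \<noteq> y" "cl x = cl y \<or> cl y \<in> set (B ! cl x)" using expansion_ofD(2)[OF exp] xy by blast+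
        then show False using that st unfolding X_def stable_in_def list_all_iff by auto
      qed
      have "colouring E (Suc q) U d"
        unfolding colouring_def
      proof (intro conjI ballI impI)
        fix v assume "v \<in> U"
        then show "d v < Suc q" using colouring_lt[OF c, of v] unfolding d_def by auto
      next
        fix u v assume uv: "u \<in> U" "v \<in> U" "E u v"
        show "d u \<noteq> d v"
          using stX[of u v] uv colouring_lt[OF c, of u] colouring_lt[OF c, of v] colouring_neq[OF c, of u v]
          unfolding d_def by auto
      qed
      then show ?thesis unfolding colourable_def by blast
    qed
  }
qed

text \<open>A colour class meets each clique of the expansion at most once and projects to a stable
  set of \<open>B\<close>, so it has at most \<open>a\<close> vertices.\<close>

lemma card_le_if_stable_bound:
  assumes exp: "expansion_of E V B cl" and fin: "finite V" and B: "loopless B"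
    and U: "U \<subseteq> V" "cl ` U \<subseteq> set I" and c: "colouring E q U c" and I: "stable_bound B I a"
  shows "card U \<le> a * q"
proof -
  have finU: "finite U" using U fin finite_subset by blast
  have "card {x \<in> U. c x = t} \<le> a" for t
  proof -
    let ?X = "{x \<in> U. c x = t}"
    have nE: "\<not> E x y" if "x \<in> ?X" "y \<in> ?X" for x y using that colouring_neq[OF c, of x y] by auto
    have inj: "inj_on cl ?X"
    proof (rule inj_onI)
      fix x y assume xy: "x \<in> ?X" "y \<in> ?X" "cl x = cl y"
      have "x \<in> V" "y \<in> V" using xy U(1) by auto
      then show "x = y" using nE[OF xy(1,2)] expansion_ofD(2)[OF exp] xy(3) by blast
    qed
    have "cl ` ?X \<in> Pow (set I)" using U(2) by blast
    then have "cl ` ?X \<in> set ` set (subseqs I)" unfolding subseqs_powset .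
    then obtain s where s': "cl ` ?X = set s" "s \<in> set (subseqs I)" by (rule imageE)
    note s = s'(2) s'(1)[symmetric]
    have "stable_in B s"
      unfolding stable_in_def list_all_iff
    proof (intro ballI)
      fix i j assume "i \<in> set s" "j \<in> set s"
      then obtain x y where xy: "x \<in> ?X" "y \<in> ?X" "i = cl x" "j = cl y" unfolding s(2) by blast
      have V: "x \<in> V" "y \<in> V" using xy U(1) by auto
      show "j \<notin> set (B ! i)"
      proof (cases "x = y")
        case True
        then show ?thesis
          using B expansion_ofD(1)[OF exp V(1)] xy(3,4) unfolding loopless_iff by blast
      next
        case False
        then show ?thesis using nE[OF xy(1,2)] expansion_ofD(2)[OF exp V] xy(3,4) by blast
      qed
    qed
    then have "length s \<le> a" using I s(1) unfolding stable_bound_def list_all_iff by blast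
    moreover have "card ?X = card (set s)" using card_image[OF inj] s(2) by simp
    ultimately show ?thesis using card_length[of s] by simp
  qed
  then have *: "(\<Sum>t<q. card {x \<in> U. c x = t}) \<le> (\<Sum>t<q. a)" by (intro sum_mono) simp
  have "U = (\<Union>t<q. {x \<in> U. c x = t})" using colouring_lt[OF c] by auto
  then have "card U \<le> (\<Sum>t<q. card {x \<in> U. c x = t})"
    using card_UN_le[of "{..<q}" "\<lambda>t. {x \<in> U. c x = t}"] by simp
  then show ?thesis using * by (simp add: mult.commute)
qed

end

section \<open>Inequalities for the class sizes\<close>

lemma (in critical_expansion) card_K_pos: "i < length B \<Longrightarrow> 1 \<le> card (K i)"
  using K_nonempty[of i] finite_K[of i] by (simp add: Suc_le_eq card_gt_0_iff)

lemma (in critical_expansion) card_Union_K: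
  "distinct I \<Longrightarrow> card (\<Union>i\<in>set I. K i) = sum_list (map (\<lambda>i. card (K i)) I)"
proof (induction I)
  case (Cons i I)
  have "K i \<inter> (\<Union>j\<in>set I. K j) = {}" using Cons.prems unfolding K_def by auto
  then have "card (K i \<union> (\<Union>j\<in>set I. K j)) = card (K i) + card (\<Union>j\<in>set I. K j)"
    by (intro card_Un_disjoint) (auto simp: finite_K)
  then show ?case using Cons by simp
qed simp

text \<open>Class \<open>k\<close> makes the union over \<open>I\<close> a proper part, which is
  therefore colourable.\<close>

lemma (in critical_expansion) part_bound:
  assumes B: "loopless B" and I: "stable_bound B I a" and k: "k < length B" "k \<notin> set I"
  shows "sum_list (map (\<lambda>i. card (K i)) I) \<le> a * q"
proof -
  let ?U = "\<Union>i\<in>set I. K i"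
  have U: "?U \<subseteq> V" using K_subset by blast
  moreover have "?U \<noteq> V" using K_nonempty[OF k(1)] k(2) unfolding K_def by blast
  ultimately have "colourable E q ?U" using crit unfolding critical_def by blast
  then obtain c where c: "colouring E q ?U c" unfolding colourable_def by blast
  have "card ?U \<le> a * q"
    by (rule card_le_if_stable_bound[OF exp fin B U _ c I]) (auto simp: K_def)
  then show ?thesis using card_Union_K I unfolding stable_bound_def by simp
qed

text \<open>The summand 1 is the vertex whose deletion makes the graph colourable.\<close>

lemma (in critical_expansion) total_bound:
  assumes B: "loopless B" and I: "stable_bound B [0..<length B] a"
  shows "sum_list (map (\<lambda>i. card (K i)) [0..<length B]) \<le> a * q + 1"
proof (cases "V = {}")
  case True
  have "K i = {}" for i using K_subset[of i] unfolding True by blast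
  then show ?thesis by simp
next
  case False
  then obtain x where x: "x \<in> V" by blast
  then have "V - {x} \<subset> V" by blast
  then have "colourable E q (V - {x})" using crit unfolding critical_def by simp
  then obtain c where c: "colouring E q (V - {x}) c" unfolding colourable_def by blast
  have "card (V - {x}) \<le> a * q"
    by (rule card_le_if_stable_bound[OF exp fin B _ _ c I]) (use V_eq in auto)
  then have "card V \<le> a * q + 1" using x fin by simp
  moreover have "(\<Union>i\<in>set [0..<length B]. K i) = V" using V_eq K_subset by fastforce
  ultimately show ?thesis using card_Union_K[of "[0..<length B]"] by simp
qed

text \<open>The minimum degree condition for critical graphs: otherwise \<open>K p\<close> could be
  coloured last.\<close>

lemma (in critical_expansion) closed_neighbourhood_bound:
  assumes B: "loopless B" and p: "p < length B"
  shows "q < sum_list (map (\<lambda>i. card (K i)) (p # B ! p))"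
proof (rule ccontr)
  assume "\<not> ?thesis"
  then have le: "card (K p) + sum_list (map (\<lambda>i. card (K i)) (B ! p)) \<le> q" by simp
  have d: "distinct (B ! p)" "p \<notin> set (B ! p)" using B p unfolding loopless_iff by auto
  obtain c where c: "colouring E q (rest p) c" using colourable_rest[OF p] unfolding colourable_def by blast
  have "nb p = (\<Union>i\<in>set (B ! p). K i)" using d(2) unfolding nb_def by auto
  then have "card (nb p) = sum_list (map (\<lambda>i. card (K i)) (B ! p))" using card_Union_K[OF d(1)] by simp
  then have "card (c ` nb p) + card (K p) \<le> q" using card_image_le[OF finite_nb, of c p] le by simp
  then show False by (rule colours_too_many[OF c])
qed

lemma (in critical_expansion) not_cover:
  assumes "list_all (stable_in B) sts" "cover a sts ord q (map (\<lambda>i. card (K i)) [0..<length B])"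
  shows False
proof -
  have "colourable E q V"
    by (rule colourable_if_cover[OF exp fin assms(1) subset_refl _ _ assms(2)]) (simp_all add: K_def)
  then show False using crit unfolding critical_def by blast
qed

lemma critical_weights_if_critical_G7:
  assumes ce: "critical_expansion E V 6 pattern_G7 cl"
  shows "\<exists>p\<in>set aut_G7. map (\<lambda>i. card {x \<in> V. cl x = i}) p \<in> set critical_weights_G7"
proof -
  interpret critical_expansion E V 6 pattern_G7 cl by (rule ce)
  define k where "k i = card (K i)" for i
  have len: "length pattern_G7 = 8" by (simp add: pattern_G7_def)
  note B = checks_G7(3)
  have pos: "1 \<le> k i" if "i < 8" for i using card_K_pos that len unfolding k_def by simp
  have clq: "sum_list (map k I) \<le> 6"
    if "I \<in> set [[0, 1, 2], [0, 3], [1, 4], [3, 4, 5], [2, 5], [0, 6], [4, 6], [1, 7], [3, 7]]" for I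
  proof -
    have "stable_bound pattern_G7 I 1" using checks_G7(5) that unfolding list_all_iff by blast
    \<comment> \<open>Classes 6 and 7 are not adjacent, so no listed clique contains both.\<close>
    moreover have "\<exists>j<8. j \<notin> set I" using that by (auto intro: exI[of _ 6] exI[of _ 7])
    ultimately show ?thesis using part_bound[OF B, of I 1] len unfolding k_def by auto
  qed
  have deg: "6 < sum_list (map k (p # pattern_G7 ! p))" if "p < 8" for p
    using closed_neighbourhood_bound[OF B, of p] that len unfolding k_def by simp
  have inc: "k j < k i" if "i < 8" "j \<noteq> i" "j \<notin> set (pattern_G7 ! i)" "set (pattern_G7 ! i) \<subseteq> set (pattern_G7 ! j)" for i j
    using inclusion_card_less[OF ce, of i j] that len unfolding k_def by simp
  have cl': "k 0 + k 1 + k 2 \<le> 6" "k 0 + k 3 \<le> 6" "k 1 + k 4 \<le> 6" "k 3 + k 4 + k 5 \<le> 6"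
    "k 2 + k 5 \<le> 6" "k 0 + k 6 \<le> 6" "k 4 + k 6 \<le> 6" "k 1 + k 7 \<le> 6" "k 3 + k 7 \<le> 6"
    using clq[of "[0, 1, 2]"] clq[of "[0, 3]"] clq[of "[1, 4]"] clq[of "[3, 4, 5]"] clq[of "[2, 5]"]
      clq[of "[0, 6]"] clq[of "[4, 6]"] clq[of "[1, 7]"] clq[of "[3, 7]"] by simp_all
  have dg: "6 < k 0 + k 1 + k 2 + k 3 + k 6" "6 < k 0 + k 1 + k 2 + k 4 + k 7" "6 < k 0 + k 1 + k 2 + k 5"
    "6 < k 3 + k 4 + k 5 + k 0 + k 7" "6 < k 3 + k 4 + k 5 + k 1 + k 6" "6 < k 3 + k 4 + k 5 + k 2"
    "6 < k 0 + k 6 + k 4" "6 < k 1 + k 7 + k 3"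
    using deg[of 0] deg[of 1] deg[of 2] deg[of 3] deg[of 4] deg[of 5] deg[of 6] deg[of 7]
    by (simp_all add: pattern_G7_def)
  have ic: "k 1 < k 6" "k 3 < k 6" "k 0 < k 7" "k 4 < k 7"
    using inc[of 6 1] inc[of 6 3] inc[of 7 0] inc[of 7 4] by (simp_all add: pattern_G7_def)
  have p: "1 \<le> k 0" "1 \<le> k 1" "1 \<le> k 2" "1 \<le> k 3" "1 \<le> k 4" "1 \<le> k 5" "1 \<le> k 6" "1 \<le> k 7"
    using pos by simp_all
  have mem: "k 0 \<in> set [1..<6]" "k 1 \<in> set [1..<6]" "k 2 \<in> set [1..<6]" "k 3 \<in> set [1..<6]"
    "k 4 \<in> set [1..<6]" "k 5 \<in> set [1..<6]" "k 6 \<in> set [1..<6]" "k 7 \<in> set [1..<6]"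
    using p cl' by simp_all
  have w: "weight_ok_G7 [k 0, k 1, k 2, k 3, k 4, k 5, k 6, k 7]"
  proof -
    \<comment> \<open>The script below descends through the nested disjunctions and refutes every
      disjunct but the last with an inequality from \<open>cl'\<close>, \<open>dg\<close> or
      \<open>ic\<close>.\<close>
    note w3 = weights_G7_checked[unfolded list_all_iff, THEN bspec, OF mem(1), THEN bspec, OF mem(2),
        THEN bspec, OF mem(3)]
    from w3 show ?thesis
    apply -
    apply (erule disjE, use cl' dg ic in linarith)
    apply (drule bspec, rule mem(4))
    apply (erule disjE, use cl' dg ic in linarith)
    apply (drule bspec, rule mem(5))
    apply (erule disjE, use cl' dg ic in linarith)
    apply (drule bspec, rule mem(6))
    apply (erule disjE, use cl' dg ic in linarith)
    apply (erule disjE, use cl' dg ic in linarith)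
    apply (erule disjE, use cl' dg ic in linarith)
    apply (erule disjE, use cl' dg ic in linarith)
    apply (drule bspec, rule mem(7))
    apply (erule disjE, use cl' dg ic in linarith)
    apply (erule disjE, use cl' dg ic in linarith)
    apply (erule disjE, use cl' dg ic in linarith)
    apply (erule disjE, use cl' dg ic in linarith)
    apply (erule disjE, use cl' dg ic in linarith)
    apply (drule bspec, rule mem(8))
    apply (erule disjE, use cl' dg ic in linarith)
    apply (erule disjE, use cl' dg ic in linarith)
    apply (erule disjE, use cl' dg ic in linarith)
    apply (erule disjE, use cl' dg ic in linarith)
    apply (erule disjE, use cl' dg ic in linarith)
    apply (erule disjE, use cl' dg ic in linarith)
    apply (erule disjE, use cl' dg ic in linarith)
    apply (erule disjE, use cl' dg ic in linarith)
    apply (erule disjE, use cl' dg ic in linarith)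
    apply assumption
    done
  qed
  have map_k: "map (\<lambda>i. card (K i)) [0..<length pattern_G7] = [k 0, k 1, k 2, k 3, k 4, k 5, k 6, k 7]"
    unfolding len k_def by (simp add: upt_rec eval_nat_numeral)
  have "\<not> cover 3 stable_G7 order_G7 6 [k 0, k 1, k 2, k 3, k 4, k 5, k 6, k 7]"
    using not_cover[OF checks_G7(1), of 3 order_G7] unfolding map_k by blast
  moreover have "sum_list [k 0, k 1, k 2, k 3, k 4, k 5, k 6, k 7] \<le> 19"
    using total_bound[OF B] checks_G7(4) len unfolding map_k by fastforce
  ultimately obtain p where p: "p \<in> set aut_G7"
      "map ((!) [k 0, k 1, k 2, k 3, k 4, k 5, k 6, k 7]) p \<in> set critical_weights_G7"
    using w unfolding weight_ok_G7_def list_ex_iff by auto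
  have "automorphism pattern_G7 p" using checks_G7(2) p(1) unfolding list_all_iff by blast
  then have "\<forall>i\<in>set p. i < 8" unfolding automorphism_def list_all_iff len by blast
  then have "map ((!) (map k [0..<8])) p = map k p" by (intro map_cong) auto
  then have eq: "map ((!) [k 0, k 1, k 2, k 3, k 4, k 5, k 6, k 7]) p = map k p" by (simp add: upt_rec eval_nat_numeral)
  have "k = (\<lambda>i. card {x \<in> V. cl x = i})" unfolding k_def K_def by (rule refl)
  then show ?thesis using p(1) p(2)[unfolded eq] by blast
qed

lemma critical_weights_if_critical_cycle5:
  assumes ce: "critical_expansion E V 6 cycle5 cl"
  shows "\<exists>p\<in>set aut_cycle5. map (\<lambda>i. card {x \<in> V. cl x = i}) p \<in> set critical_weights_cycle5"
proof -
  interpret critical_expansion E V 6 cycle5 cl by (rule ce)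
  define k where "k i = card (K i)" for i
  have len: "length cycle5 = 5" by (simp add: cycle5_def)
  note B = checks_cycle5(3)
  have pos: "1 \<le> k i" if "i < 5" for i using card_K_pos that len unfolding k_def by simp
  have clq: "sum_list (map k I) \<le> 6" if "I \<in> set [[0, 1], [1, 2], [2, 3], [3, 4], [4, 0]]" for I
  proof -
    have "stable_bound cycle5 I 1" using checks_cycle5(5) that unfolding list_all_iff by blast
    moreover have "\<exists>j<5. j \<notin> set I" using that by (auto intro: exI[of _ 0] exI[of _ 2] exI[of _ 3])
    ultimately show ?thesis using part_bound[OF B, of I 1] len unfolding k_def by auto
  qed
  have deg: "6 < sum_list (map k (p # cycle5 ! p))" if "p < 5" for p
    using closed_neighbourhood_bound[OF B, of p] that len unfolding k_def by simp
  have cl': "k 0 + k 1 \<le> 6" "k 1 + k 2 \<le> 6" "k 2 + k 3 \<le> 6" "k 3 + k 4 \<le> 6" "k 4 + k 0 \<le> 6"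
    using clq[of "[0, 1]"] clq[of "[1, 2]"] clq[of "[2, 3]"] clq[of "[3, 4]"] clq[of "[4, 0]"] by simp_all
  have dg: "6 < k 0 + k 1 + k 2" "6 < k 1 + k 2 + k 3" "6 < k 2 + k 3 + k 4" "6 < k 3 + k 4 + k 0"
    "6 < k 4 + k 0 + k 1"
    using deg[of 0] deg[of 1] deg[of 2] deg[of 3] deg[of 4] by (simp_all add: cycle5_def)
  have p: "1 \<le> k 0" "1 \<le> k 1" "1 \<le> k 2" "1 \<le> k 3" "1 \<le> k 4" using pos by simp_all
  have mem: "k 0 \<in> set [1..<6]" "k 1 \<in> set [1..<6]" "k 2 \<in> set [1..<6]" "k 3 \<in> set [1..<6]"
    "k 4 \<in> set [1..<6]"
    using p cl' by simp_all
  have w: "weight_ok_cycle5 [k 0, k 1, k 2, k 3, k 4]"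
  proof -
    note w3 = weights_cycle5_checked[unfolded list_all_iff, THEN bspec, OF mem(1), THEN bspec, OF mem(2)]
    from w3 show ?thesis
    apply -
    apply (erule disjE, use cl' dg in linarith)
    apply (drule bspec, rule mem(3))
    apply (erule disjE, use cl' dg in linarith)
    apply (erule disjE, use cl' dg in linarith)
    apply (drule bspec, rule mem(4))
    apply (erule disjE, use cl' dg in linarith)
    apply (erule disjE, use cl' dg in linarith)
    apply (drule bspec, rule mem(5))
    apply (erule disjE, use cl' dg in linarith)
    apply (erule disjE, use cl' dg in linarith)
    apply (erule disjE, use cl' dg in linarith)
    apply (erule disjE, use cl' dg in linarith)
    apply (erule disjE, use cl' dg in linarith)
    apply assumption
    done
  qed
  have map_k: "map (\<lambda>i. card (K i)) [0..<length cycle5] = [k 0, k 1, k 2, k 3, k 4]"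
    unfolding len k_def by (simp add: upt_rec eval_nat_numeral)
  have "\<not> cover 2 stable_cycle5 [0..<5] 6 [k 0, k 1, k 2, k 3, k 4]"
    using not_cover[OF checks_cycle5(1), of 2 "[0..<5]"] unfolding map_k by blast
  moreover have "sum_list [k 0, k 1, k 2, k 3, k 4] \<le> 13"
    using total_bound[OF B] checks_cycle5(4) len unfolding map_k by fastforce
  ultimately obtain p where p: "p \<in> set aut_cycle5"
      "map ((!) [k 0, k 1, k 2, k 3, k 4]) p \<in> set critical_weights_cycle5"
    using w unfolding weight_ok_cycle5_def list_ex_iff by auto
  have "automorphism cycle5 p" using checks_cycle5(2) p(1) unfolding list_all_iff by blast
  then have "\<forall>i\<in>set p. i < 5" unfolding automorphism_def list_all_iff len by blast
  then have "map ((!) (map k [0..<5])) p = map k p" by (intro map_cong) auto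
  then have eq: "map ((!) [k 0, k 1, k 2, k 3, k 4]) p = map k p" by (simp add: upt_rec eval_nat_numeral)
  have "k = (\<lambda>i. card {x \<in> V. cl x = i})" unfolding k_def K_def by (rule refl)
  then show ?thesis using p(1) p(2)[unfolded eq] by blast
qed

section \<open>Pair graphs\<close>

definition edge :: "'a pair_pre_digraph \<Rightarrow> 'a \<Rightarrow> 'a \<Rightarrow> bool" where
  "edge G u v \<longleftrightarrow> (u, v) \<in> parcs G"

lemma adjacency_edge: "pair_graph G \<Longrightarrow> adjacency (edge G)"
proof -
  assume "pair_graph G"
  then interpret pair_graph G .
  show ?thesis
  proof
    fix x y assume "edge G x y"
    then show "edge G y x" using pair_sym_arcs unfolding symmetric_def edge_def by (auto dest: symD)
  next
    fix x show "\<not> edge G x x" using pair_no_loops unfolding edge_def by fastforce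
  qed
qed

lemma digraph_isoI:
  assumes G: "pair_wf_digraph G" and H: "pair_wf_digraph H" and g: "bij_betw g (pverts G) (pverts H)"
    and arcs: "\<And>u v. u \<in> pverts G \<Longrightarrow> v \<in> pverts G \<Longrightarrow> (u, v) \<in> parcs G \<longleftrightarrow> (g u, g v) \<in> parcs H"
  shows "digraph_iso (with_proj G) (with_proj H)"
proof -
  interpret G: pair_wf_digraph G by (rule G)
  interpret H: pair_wf_digraph H by (rule H)
  define f where "f = \<lparr> iso_verts = g, iso_arcs = map_prod g g, iso_head = snd, iso_tail = fst \<rparr>"
  have inj: "inj_on g (pverts G)" by (rule bij_betw_imp_inj_on[OF g])
  have "inj_on (map_prod g g) (parcs G)"
    by (rule inj_on_subset[OF map_prod_inj_on[OF inj inj]]) (auto dest: G.in_arcsD1 G.in_arcsD2)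
  then have "pre_digraph.digraph_isomorphism (with_proj G) f"
    unfolding pre_digraph.digraph_isomorphism_def f_def using G.wf_digraph inj by auto
  moreover have "map_prod g g ` parcs G = parcs H"
  proof
    show "map_prod g g ` parcs G \<subseteq> parcs H"
    proof
      fix e assume "e \<in> map_prod g g ` parcs G"
      then obtain u v where e: "(u, v) \<in> parcs G" "e = (g u, g v)" by auto
      then show "e \<in> parcs H" using arcs[OF G.in_arcsD1[OF e(1)] G.in_arcsD2[OF e(1)]] by simp
    qed
    show "parcs H \<subseteq> map_prod g g ` parcs G"
    proof
      fix e assume e: "e \<in> parcs H"
      obtain a b where ab: "e = (a, b)" by (cases e)
      then have "a \<in> g ` pverts G" "b \<in> g ` pverts G"
        using e H.in_arcsD1 H.in_arcsD2 bij_betw_imp_surj_on[OF g] by auto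
      then obtain u v where uv: "u \<in> pverts G" "v \<in> pverts G" "a = g u" "b = g v" by blast
      then have "(u, v) \<in> parcs G" using arcs[OF uv(1,2)] e ab by simp
      moreover have "e = map_prod g g (u, v)" using ab uv by simp
      ultimately show "e \<in> map_prod g g ` parcs G" by (rule rev_image_eqI)
    qed
  qed
  then have "with_proj H = app_iso f (with_proj G)"
    unfolding app_iso_def f_def with_proj_def using bij_betw_imp_surj_on[OF g] by simp
  ultimately show ?thesis unfolding digraph_iso_def by blast
qed

text \<open>Head and tail are projections on both sides, so the arc part of the isomorphism is
  forced to be \<open>g\<close> in both components.\<close>

lemma digraph_isoE:
  assumes G: "pair_wf_digraph G" and iso: "digraph_iso (with_proj G) (with_proj H)"
  obtains g where "bij_betw g (pverts G) (pverts H)"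
    "\<And>u v. u \<in> pverts G \<Longrightarrow> v \<in> pverts G \<Longrightarrow> (u, v) \<in> parcs G \<longleftrightarrow> (g u, g v) \<in> parcs H"
proof -
  interpret G: pair_wf_digraph G by (rule G)
  obtain f where f: "pre_digraph.digraph_isomorphism (with_proj G) f" "with_proj H = app_iso f (with_proj G)"
    using iso unfolding digraph_iso_def by blast
  define g where "g = iso_verts f"
  have inj: "inj_on g (pverts G)"
    using f(1) unfolding pre_digraph.digraph_isomorphism_def g_def by simp
  have H: "pverts H = g ` pverts G" "parcs H = iso_arcs f ` parcs G" "iso_tail f = fst" "iso_head f = snd"
    using f(2) unfolding with_proj_def app_iso_def g_def by simp_all
  have arc: "iso_arcs f (u, v) = (g u, g v)" if "(u, v) \<in> parcs G" for u v
    using f(1) that H(3,4) unfolding pre_digraph.digraph_isomorphism_def g_def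
    by (metis fst_conv prod.collapse snd_conv with_proj_simps(2,4,5))
  show ?thesis
  proof (rule that[of g])
    show "bij_betw g (pverts G) (pverts H)" using inj H(1) unfolding bij_betw_def by simp
    fix u v assume uv: "u \<in> pverts G" "v \<in> pverts G"
    show "(u, v) \<in> parcs G \<longleftrightarrow> (g u, g v) \<in> parcs H"
    proof
      assume "(u, v) \<in> parcs G"
      then show "(g u, g v) \<in> parcs H" using arc H(2) by (metis image_eqI)
    next
      assume "(g u, g v) \<in> parcs H"
      then obtain u' v' where e: "(u', v') \<in> parcs G" "(g u, g v) = iso_arcs f (u', v')"
        unfolding H(2) by auto
      then have "g u = g u'" "g v = g v'" using arc by auto
      then have "u = u'" "v = v'" using inj uv G.in_arcsD1[OF e(1)] G.in_arcsD2[OF e(1)]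
        unfolding inj_on_def by auto
      then show "(u, v) \<in> parcs G" using e by simp
    qed
  qed
qed

definition represents :: "nat pair_pre_digraph \<Rightarrow> pattern \<Rightarrow> bool" where
  "represents H B \<longleftrightarrow> pair_wf_digraph H \<and> pverts H = Suc ` {..<length B} \<and>
     (\<forall>i<length B. \<forall>j<length B. (Suc i, Suc j) \<in> parcs H \<longleftrightarrow> j \<in> set (B ! i))"

lemma contains_induced_iff:
  assumes G: "pair_wf_digraph G" and H: "represents H B"
  shows "contains_induced (with_proj G) (with_proj H) \<longleftrightarrow> contains (edge G) (pverts G) B"
proof
  interpret G: pair_wf_digraph G by (rule G)
  have Hwf: "pair_wf_digraph H" and Hv: "pverts H = Suc ` {..<length B}"
    and Ha: "\<And>i j. i < length B \<Longrightarrow> j < length B \<Longrightarrow> (Suc i, Suc j) \<in> parcs H \<longleftrightarrow> j \<in> set (B ! i)"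
    using H unfolding represents_def by auto
  {
    assume "contains_induced (with_proj G) (with_proj H)"
    then obtain K where K: "induced_subgraph K (with_proj G)" "digraph_iso (with_proj H) K"
      unfolding contains_induced_def by blast
    define K' where "K' = \<lparr> pverts = verts K, parcs = arcs K \<rparr>"
    have sub: "subgraph K (with_proj G)" and ind: "arcs K = {e \<in> parcs G. tail (with_proj G) e \<in> verts K \<and> head (with_proj G) e \<in> verts K}"
      using K(1) unfolding induced_subgraph_def by simp_all
    \<comment> \<open>A subgraph inherits head and tail, so the a priori arbitrary digraph
      \<open>K\<close> is again a pair graph.\<close>
    then have comp: "tail K = fst" "head K = snd" and Kv: "verts K \<subseteq> pverts G"
      unfolding subgraph_def compatible_def by simp_all
    have "K = with_proj K'" unfolding K'_def with_proj_def using comp by simp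
    then obtain g where g: "bij_betw g (pverts H) (pverts K')"
      "\<And>u v. u \<in> pverts H \<Longrightarrow> v \<in> pverts H \<Longrightarrow> (u, v) \<in> parcs H \<longleftrightarrow> (g u, g v) \<in> parcs K'"
      using digraph_isoE[OF Hwf, of K'] K(2) by metis
    have "embeds (edge G) (pverts G) B (\<lambda>i. g (Suc i))"
      unfolding embeds_def
    proof (intro conjI allI impI)
      show "inj_on (\<lambda>i. g (Suc i)) {..<length B}"
        using bij_betw_imp_inj_on[OF g(1)] unfolding Hv inj_on_def by auto
      have gK: "g (Suc i) \<in> verts K" if "i < length B" for i
        using bij_betwE[OF g(1)] that unfolding Hv K'_def by auto
      then show "(\<lambda>i. g (Suc i)) ` {..<length B} \<subseteq> pverts G" using Kv by auto
      fix i j assume ij: "i < length B" "j < length B"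
      have "(g (Suc i), g (Suc j)) \<in> parcs K' \<longleftrightarrow> (g (Suc i), g (Suc j)) \<in> parcs G"
        unfolding K'_def using ind gK[OF ij(1)] gK[OF ij(2)] by simp
      then show "edge G (g (Suc i)) (g (Suc j)) \<longleftrightarrow> j \<in> set (B ! i)"
        using g(2)[of "Suc i" "Suc j"] Ha[OF ij] ij unfolding edge_def Hv by auto
    qed
    then show "contains (edge G) (pverts G) B" unfolding contains_def by blast
  next
    assume "contains (edge G) (pverts G) B"
    then obtain f where f: "embeds (edge G) (pverts G) B f" unfolding contains_def by blast
    define K' where "K' = \<lparr> pverts = f ` {..<length B},
      parcs = {(u, v) \<in> parcs G. u \<in> f ` {..<length B} \<and> v \<in> f ` {..<length B}} \<rparr>"
    have K'wf: "pair_wf_digraph K'" unfolding K'_def by unfold_locales auto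
    interpret K': pair_wf_digraph K' by (rule K'wf)
    have "induced_subgraph (with_proj K') (with_proj G)"
      unfolding induced_subgraph_def subgraph_def compatible_def
      using embedsD(2)[OF f] G.wf_digraph K'.wf_digraph by (auto simp: K'_def)
    moreover have "digraph_iso (with_proj H) (with_proj K')"
    proof (rule digraph_isoI[OF Hwf K'wf, of "\<lambda>v. f (v - 1)"])
      show "bij_betw (\<lambda>v. f (v - 1)) (pverts H) (pverts K')"
        unfolding bij_betw_def Hv K'_def using embedsD(1)[OF f] by (auto simp: inj_on_def image_image)
      fix u v assume "u \<in> pverts H" "v \<in> pverts H"
      then obtain i j where ij: "u = Suc i" "v = Suc j" "i < length B" "j < length B" unfolding Hv by auto
      then show "(u, v) \<in> parcs H \<longleftrightarrow> (f (u - 1), f (v - 1)) \<in> parcs K'"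
        using Ha[OF ij(3,4)] embedsD(3)[OF f ij(3,4)] unfolding K'_def edge_def by auto
    qed
    ultimately show "contains_induced (with_proj G) (with_proj H)" unfolding contains_induced_def by blast
  }
qed

lemma wf_graph_of_edges: "E \<subseteq> V \<times> V \<Longrightarrow> pair_wf_digraph (graph_of_edges V E)"
  unfolding graph_of_edges_def by unfold_locales auto

lemma represents_graph_of_edges:
  assumes "V = Suc ` {..<length B}" "E \<subseteq> V \<times> V"
    and "\<forall>i<length B. \<forall>j<length B. (Suc i, Suc j) \<in> E \<or> (Suc j, Suc i) \<in> E \<longleftrightarrow> j \<in> set (B ! i)"
  shows "represents (graph_of_edges V E) B"
  unfolding represents_def using assms wf_graph_of_edges by (auto simp: graph_of_edges_def)

lemma Suc_image: "Suc ` {..<n} = {1..n}"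
  by (auto simp: image_Suc_lessThan)

lemma represents_path5: "represents (path_graph 5) path5"
  unfolding path_graph_def
  by (rule represents_graph_of_edges) (auto simp: path5_def Suc_image less_Suc_eq numeral_eq_Suc)

lemma represents_gem: "represents gem gem_pattern"
  unfolding gem_def
  by (rule represents_graph_of_edges) (auto simp: gem_pattern_def Suc_image less_Suc_eq numeral_eq_Suc)

lemma represents_G1: "represents G1 cycle5"
  unfolding G1_def
  by (rule represents_graph_of_edges) (auto simp: cycle5_def Suc_image less_Suc_eq numeral_eq_Suc)

lemma represents_G7: "represents G7 pattern_G7"
  unfolding G7_def
  by (rule represents_graph_of_edges) (auto simp: pattern_G7_def Suc_image less_Suc_eq numeral_eq_Suc)

lemma P5_gem_free_iff:
  assumes "pair_wf_digraph G"
  shows "P5_gem_free (with_proj G) \<longleftrightarrow>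
    \<not> contains (edge G) (pverts G) path5 \<and> \<not> contains (edge G) (pverts G) gem_pattern"
  unfolding P5_gem_free_def using contains_induced_iff[OF assms represents_path5]
    contains_induced_iff[OF assms represents_gem] by simp

section \<open>Chromatic number and criticality\<close>

lemma colouring_mono: "colouring E q V c \<Longrightarrow> q \<le> r \<Longrightarrow> colouring E r V c"
  unfolding colouring_def by (meson order.strict_trans2)

text \<open>Colourability with some \<open>n\<close> ensures that the minimum defining the chromatic
  number is attained.\<close>

lemma chromatic_number_le_iff:
  assumes col: "\<And>k c. proper_colouring G k c \<longleftrightarrow> colouring E k V c" and "colourable E n V"
  shows "chromatic_number G \<le> k \<longleftrightarrow> colourable E k V"
proof
  have "\<exists>c. proper_colouring G (chromatic_number G) c"
    unfolding chromatic_number_def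
    by (rule LeastI_ex) (use assms in \<open>auto simp: colourable_def\<close>)
  then have *: "colourable E (chromatic_number G) V" unfolding col colourable_def .
  assume "chromatic_number G \<le> k"
  then show "colourable E k V" using * colouring_mono unfolding colourable_def by blast
next
  assume "colourable E k V"
  then have "\<exists>c. proper_colouring G k c" unfolding col colourable_def .
  then show "chromatic_number G \<le> k" unfolding chromatic_number_def by (rule Least_le)
qed

lemma vertex_critical_iff:
  assumes G: "pair_graph G"
  shows "vertex_critical (Suc q) (with_proj G) \<longleftrightarrow> critical (edge G) q (pverts G)"
proof -
  interpret G: pair_graph G by (rule G)
  interpret adjacency "edge G" by (rule adjacency_edge[OF G])
  have colG: "proper_colouring (with_proj G) k c \<longleftrightarrow> colouring (edge G) k (pverts G) c" for k c
    unfolding proper_colouring_def colouring_def edge_def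
    by (auto dest: G.in_arcsD1 G.in_arcsD2)
  have colD: "proper_colouring (pre_digraph.del_vert (with_proj G) v) k c \<longleftrightarrow>
      colouring (edge G) k (pverts G - {v}) c" for v k c
    unfolding proper_colouring_def colouring_def edge_def arcs_ends_conv
    by (auto simp: pre_digraph.del_vert_def dest: G.in_arcsD1 G.in_arcsD2 intro: rev_image_eqI)
  have "colourable (edge G) (card (pverts G)) ({} \<union> pverts G)"
    by (rule extend_colouring[where N = "{}" and c = "\<lambda>_. 0"])
      (use G.pair_finite_verts in \<open>auto simp: colouring_def\<close>)
  then have all: "colourable (edge G) (card (pverts G)) (pverts G)" by simp
  have le: "chromatic_number (with_proj G) \<le> k \<longleftrightarrow> colourable (edge G) k (pverts G)" for k
    by (rule chromatic_number_le_iff[OF colG all])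
  have leD: "chromatic_number (pre_digraph.del_vert (with_proj G) v) \<le> k \<longleftrightarrow>
      colourable (edge G) k (pverts G - {v})" for v k
    by (rule chromatic_number_le_iff[OF colD colourable_subset[OF all]]) blast
  \<comment> \<open>A fresh colour for \<open>v\<close> shows that the chromatic number is exactly
    \<open>Suc q\<close> and not merely larger than \<open>q\<close>.\<close>
  have up: "colourable (edge G) (Suc q) (pverts G)" if v: "v \<in> pverts G" "colourable (edge G) q (pverts G - {v})" for v
  proof -
    obtain c where c: "colouring (edge G) q (pverts G - {v}) c" using v(2) unfolding colourable_def by blast
    have "c ` (pverts G - {v}) \<subseteq> {..<q}" using colouring_lt[OF c] by auto
    then have "card (c ` (pverts G - {v})) \<le> q" using card_mono[of "{..<q}"] by fastforce
    then have "colourable (edge G) (Suc q) ((pverts G - {v}) \<union> {v})"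
      by (intro extend_colouring[OF colouring_mono[OF c], where N = "pverts G - {v}"])
        (use G.pair_finite_verts in auto)
    then show ?thesis using v(1) by (simp add: insert_absorb)
  qed
  have sub: "(\<forall>U. U \<subset> pverts G \<longrightarrow> colourable (edge G) q U) \<longleftrightarrow>
      (\<forall>v\<in>pverts G. colourable (edge G) q (pverts G - {v}))"
  proof (intro iffI allI impI ballI)
    fix U assume *: "\<forall>v\<in>pverts G. colourable (edge G) q (pverts G - {v})" and "U \<subset> pverts G"
    then obtain v where "v \<in> pverts G" "U \<subseteq> pverts G - {v}" by blast
    then show "colourable (edge G) q U" using * colourable_subset by blast
  qed blast
  show ?thesis
  proof
    assume vc: "vertex_critical (Suc q) (with_proj G)"
    then have "\<not> chromatic_number (with_proj G) \<le> q"
      and "\<forall>v\<in>pverts G. chromatic_number (pre_digraph.del_vert (with_proj G) v) \<le> q"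
      unfolding vertex_critical_def by auto
    then show "critical (edge G) q (pverts G)" unfolding critical_def sub le leD by blast
  next
    assume c: "critical (edge G) q (pverts G)"
    then have n: "\<not> colourable (edge G) q (pverts G)"
      and d: "\<forall>v\<in>pverts G. colourable (edge G) q (pverts G - {v})" unfolding critical_def sub by auto
    have "pverts G \<noteq> {}" using n unfolding colourable_def colouring_def by auto
    then have "chromatic_number (with_proj G) \<le> Suc q" using up d le by blast
    moreover have "\<not> chromatic_number (with_proj G) \<le> q" using n le by simp
    moreover have "\<forall>v\<in>pverts G. chromatic_number (pre_digraph.del_vert (with_proj G) v) \<le> q"
      using d leD by simp
    ultimately show "vertex_critical (Suc q) (with_proj G)"
      unfolding vertex_critical_def by (auto simp: less_Suc_eq_le)
  qed
qed

section \<open>Induced copies in clique expansions\<close>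

definition extends_embedding :: "pattern \<Rightarrow> pattern \<Rightarrow> nat list \<Rightarrow> nat \<Rightarrow> bool" where
  "extends_embedding B C l v \<longleftrightarrow> v \<notin> set l \<and>
     list_all (\<lambda>j. v \<in> set (B ! (l ! j)) \<longleftrightarrow> length l \<in> set (C ! j)) [0..<length l]"

text \<open>\<open>embeddable B C m l vs\<close>: the partial embedding \<open>l\<close> of \<open>C\<close> into \<open>B\<close> can be extended by \<open>m\<close> vertices,
  the first of them taken from \<open>vs\<close>.\<close>

fun embeddable :: "pattern \<Rightarrow> pattern \<Rightarrow> nat \<Rightarrow> nat list \<Rightarrow> nat list \<Rightarrow> bool" where
  "embeddable B C 0 l vs = True"
| "embeddable B C (Suc m) l [] = False"
| "embeddable B C (Suc m) l (v # vs) \<longleftrightarrow>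
     extends_embedding B C l v \<and> embeddable B C m (l @ [v]) [0..<length B] \<or> embeddable B C (Suc m) l vs"

lemma embeddable_Suc:
  "v \<in> set vs \<Longrightarrow> extends_embedding B C l v \<Longrightarrow> embeddable B C m (l @ [v]) [0..<length B]
    \<Longrightarrow> embeddable B C (Suc m) l vs"
  by (induction vs) auto

text \<open>No two adjacent vertices agree on all other vertices. Hence an induced copy of
  \<open>C\<close> in a clique expansion cannot use a class twice.\<close>

definition twin_free :: "pattern \<Rightarrow> bool" where
  "twin_free C \<longleftrightarrow> list_all (\<lambda>i. list_all (\<lambda>j. i = j \<or> j \<notin> set (C ! i) \<or>
     list_ex (\<lambda>k. k \<noteq> i \<and> k \<noteq> j \<and> (k \<in> set (C ! i)) \<noteq> (k \<in> set (C ! j))) [0..<length C])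
     [0..<length C]) [0..<length C]"

text \<open>The sum of \<open>f\<close> over the closed neighbourhood of a vertex in class
  \<open>i\<close>, where \<open>f\<close> depends only on the class. Integers allow the vertex
  itself to be subtracted again.\<close>

definition closed_sum :: "pattern \<Rightarrow> nat list \<Rightarrow> nat \<Rightarrow> (nat \<Rightarrow> int) \<Rightarrow> int" where
  "closed_sum B n i f =
     sum_list (map (\<lambda>j. if j = i \<or> j \<in> set (B ! i) then int (n ! j) * f j else 0) [0..<length B])"

definition class_degree :: "pattern \<Rightarrow> nat list \<Rightarrow> nat \<Rightarrow> int" where
  "class_degree B n i = closed_sum B n i (\<lambda>_. 1) - 1"

text \<open>The degrees are passed as a list so that evaluation computes each of them once.\<close>

definition degree_product_sum_from :: "pattern \<Rightarrow> nat list \<Rightarrow> int list \<Rightarrow> int" where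
  "degree_product_sum_from B n d =
     sum_list (map (\<lambda>i. int (n ! i) * (d ! i * (closed_sum B n i ((!) d) - d ! i))) [0..<length B])"

definition degree_product_sum :: "pattern \<Rightarrow> nat list \<Rightarrow> int" where
  "degree_product_sum B n = degree_product_sum_from B n (map (class_degree B n) [0..<length B])"

lemma checks_embeddable:
  "\<not> embeddable cycle5 path5 5 [] [0..<length cycle5]" "\<not> embeddable cycle5 gem_pattern 5 [] [0..<length cycle5]"
  "\<not> embeddable [[]] path5 5 [] [0..<length [[] :: nat list]]" "\<not> embeddable [[]] gem_pattern 5 [] [0..<length [[] :: nat list]]"
  "twin_free path5" "twin_free gem_pattern"
  by code_simp+

lemma checks_embeddable_G7:
  "\<not> embeddable pattern_G7 path5 5 [] [0..<length pattern_G7]" "\<not> embeddable pattern_G7 gem_pattern 5 [] [0..<length pattern_G7]"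
  by code_simp+

lemma checks_single:
  "loopless [[]]" "stable_bound [[]] [0..<1] 1" "list_all (stable_in [[]]) [[0]]"
  "cover 1 [[0]] [0] 6 (deduct [0] [7])"
  by code_simp+

lemma invariants_distinct:
  "distinct (map (\<lambda>(B, n). (sum_list n, degree_product_sum B n))
     (([[]], [7]) # map (Pair cycle5) critical_weights_cycle5 @ map (Pair pattern_G7) critical_weights_G7))"
  by code_simp

text \<open>The order and the sum of \<open>d x * d y\<close> over all arcs distinguish the 46 graphs.\<close>

definition graph_invariant :: "('a \<Rightarrow> 'a \<Rightarrow> bool) \<Rightarrow> 'a set \<Rightarrow> nat \<times> int" where
  "graph_invariant E V = (card V,
     \<Sum>x\<in>V. \<Sum>y\<in>{y \<in> V. E x y}. int (card {z \<in> V. E x z}) * int (card {z \<in> V. E y z}))"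

section \<open>Expansions with given class sizes and their invariant\<close>

definition weighted_expansion ::
  "('a \<Rightarrow> 'a \<Rightarrow> bool) \<Rightarrow> 'a set \<Rightarrow> pattern \<Rightarrow> ('a \<Rightarrow> nat) \<Rightarrow> nat list \<Rightarrow> bool" where
  "weighted_expansion E V B cl n \<longleftrightarrow> finite V \<and> expansion_of E V B cl \<and> loopless B \<and>
     length n = length B \<and> (\<forall>i<length B. card {x \<in> V. cl x = i} = n ! i)"

lemma weighted_expansionD:
  assumes "weighted_expansion E V B cl n"
  shows "finite V" "expansion_of E V B cl" "loopless B" "length n = length B"
    "\<And>i. i < length B \<Longrightarrow> card {x \<in> V. cl x = i} = n ! i"
  using assms unfolding weighted_expansion_def by auto

lemma sum_classes:
  fixes f :: "nat \<Rightarrow> int"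
  assumes W: "weighted_expansion E V B cl n"
  shows "(\<Sum>x\<in>V. f (cl x)) = sum_list (map (\<lambda>i. int (n ! i) * f i) [0..<length B])"
proof -
  note w = weighted_expansionD[OF W]
  have "(\<Sum>x\<in>V. f (cl x)) = (\<Sum>i<length B. \<Sum>x\<in>{x \<in> V. cl x = i}. f (cl x))"
    by (rule sum.group[symmetric]) (use w(1) expansion_ofD(1)[OF w(2)] in auto)
  also have "\<dots> = (\<Sum>i<length B. int (n ! i) * f i)"
    by (rule sum.cong) (simp_all add: w(5))
  finally show ?thesis by (simp add: sum_list_sum_nth atLeast0LessThan)
qed

lemma card_weighted_expansion:
  assumes W: "weighted_expansion E V B cl n"
  shows "card V = sum_list n"
proof -
  note w = weighted_expansionD[OF W]
  have "card V = (\<Sum>i<length B. \<Sum>x\<in>{x \<in> V. cl x = i}. 1)"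
    unfolding card_eq_sum
    by (rule sum.group[symmetric]) (use w(1) expansion_ofD(1)[OF w(2)] in auto)
  also have "\<dots> = (\<Sum>i<length B. n ! i)" by (rule sum.cong) (simp_all add: w(5))
  finally show ?thesis using w(4) by (simp add: sum_list_sum_nth atLeast0LessThan)
qed

lemma closed_neighbourhood_sum:
  fixes f :: "nat \<Rightarrow> int"
  assumes W: "weighted_expansion E V B cl n" and E: "adjacency E" and x: "x \<in> V"
  shows "closed_sum B n (cl x) f = (\<Sum>y\<in>{y \<in> V. E x y}. f (cl y)) + f (cl x)"
proof -
  note w = weighted_expansionD[OF W]
  interpret adjacency E by (rule E)
  let ?P = "\<lambda>j. j = cl x \<or> j \<in> set (B ! cl x)"
  have "closed_sum B n (cl x) f = (\<Sum>y\<in>V. if ?P (cl y) then f (cl y) else 0)"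
    unfolding sum_classes[OF W, of "\<lambda>j. if ?P j then f j else 0"] closed_sum_def
    by (intro arg_cong[where f = sum_list] map_cong) auto
  also have "\<dots> = (\<Sum>y\<in>{y \<in> V. ?P (cl y)}. f (cl y))"
    using w(1) by (simp add: sum.If_cases Int_def)
  also have "{y \<in> V. ?P (cl y)} = insert x {y \<in> V. E x y}"
    using expansion_ofD(2)[OF w(2) x] x by auto
  also have "(\<Sum>y\<in>insert x {y \<in> V. E x y}. f (cl y)) = f (cl x) + (\<Sum>y\<in>{y \<in> V. E x y}. f (cl y))"
    using w(1) irrefl by (intro sum.insert) auto
  finally show ?thesis by simp
qed

lemma graph_invariant_weighted_expansion:
  assumes W: "weighted_expansion E V B cl n" and E: "adjacency E"
  shows "graph_invariant E V = (sum_list n, degree_product_sum B n)"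
proof -
  note w = weighted_expansionD[OF W]
  let ?d = "class_degree B n"
  have deg: "int (card {z \<in> V. E x z}) = ?d (cl x)" if "x \<in> V" for x
    using closed_neighbourhood_sum[OF W E that, of "\<lambda>_. 1"] unfolding class_degree_def by simp
  have "(\<Sum>y\<in>{y \<in> V. E x y}. int (card {z \<in> V. E x z}) * int (card {z \<in> V. E y z})) =
      ?d (cl x) * (closed_sum B n (cl x) ?d - ?d (cl x))" if "x \<in> V" for x
  proof -
    have "(\<Sum>y\<in>{y \<in> V. E x y}. int (card {z \<in> V. E x z}) * int (card {z \<in> V. E y z})) =
        (\<Sum>y\<in>{y \<in> V. E x y}. ?d (cl x) * ?d (cl y))"
      by (rule sum.cong) (use deg that in auto)
    also have "\<dots> = ?d (cl x) * (\<Sum>y\<in>{y \<in> V. E x y}. ?d (cl y))" by (simp add: sum_distrib_left)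
    finally show ?thesis using closed_neighbourhood_sum[OF W E that, of ?d] by simp
  qed
  then have "snd (graph_invariant E V) = (\<Sum>x\<in>V. ?d (cl x) * (closed_sum B n (cl x) ?d - ?d (cl x)))"
    unfolding graph_invariant_def by simp
  also have "\<dots> = sum_list (map (\<lambda>i. int (n ! i) * (?d i * (closed_sum B n i ?d - ?d i))) [0..<length B])"
    by (rule sum_classes[OF W, of "\<lambda>i. ?d i * (closed_sum B n i ?d - ?d i)"])
  also have "\<dots> = degree_product_sum B n"
  proof -
    have "closed_sum B n i ((!) (map ?d [0..<length B])) = closed_sum B n i ?d" for i
      unfolding closed_sum_def by (intro arg_cong[where f = sum_list] map_cong) auto
    then show ?thesis
      unfolding degree_product_sum_def degree_product_sum_from_def by (intro arg_cong[where f = sum_list] map_cong) auto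
  qed
  finally show ?thesis using card_weighted_expansion[OF W] unfolding graph_invariant_def by simp
qed

lemma graph_invariant_iso:
  assumes G: "pair_wf_digraph G" and iso: "digraph_iso (with_proj G) (with_proj H)"
  shows "graph_invariant (edge G) (pverts G) = graph_invariant (edge H) (pverts H)"
proof -
  obtain g where g: "bij_betw g (pverts G) (pverts H)"
    "\<And>u v. u \<in> pverts G \<Longrightarrow> v \<in> pverts G \<Longrightarrow> (u, v) \<in> parcs G \<longleftrightarrow> (g u, g v) \<in> parcs H"
    using digraph_isoE[OF G iso] by blast
  have nb: "bij_betw g {y \<in> pverts G. edge G x y} {y \<in> pverts H. edge H (g x) y}" if x: "x \<in> pverts G" for x
    unfolding bij_betw_def
  proof
    show "inj_on g {y \<in> pverts G. edge G x y}"
      using bij_betw_imp_inj_on[OF g(1)] by (rule inj_on_subset) blast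
    show "g ` {y \<in> pverts G. edge G x y} = {y \<in> pverts H. edge H (g x) y}"
      using bij_betw_imp_surj_on[OF g(1)] g(2)[OF x] unfolding edge_def by force
  qed
  have deg: "card {z \<in> pverts G. edge G x z} = card {z \<in> pverts H. edge H (g x) z}" if "x \<in> pverts G" for x
    by (rule bij_betw_same_card[OF nb[OF that]])
  let ?f = "\<lambda>G x y. int (card {z \<in> pverts G. edge G x z}) * int (card {z \<in> pverts G. edge G y z})"
  have "(\<Sum>x\<in>pverts G. \<Sum>y\<in>{y \<in> pverts G. edge G x y}. ?f G x y) =
      (\<Sum>x\<in>pverts G. \<Sum>y\<in>{y \<in> pverts G. edge G x y}. ?f H (g x) (g y))"
    by (intro sum.cong refl) (simp add: deg)
  also have "\<dots> = (\<Sum>x\<in>pverts G. \<Sum>y\<in>{y \<in> pverts H. edge H (g x) y}. ?f H (g x) y)"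
    by (rule sum.cong[OF refl]) (rule sum.reindex_bij_betw[OF nb])
  also have "\<dots> = (\<Sum>x\<in>pverts H. \<Sum>y\<in>{y \<in> pverts H. edge H x y}. ?f H x y)"
    by (rule sum.reindex_bij_betw[OF g(1), of "\<lambda>x. \<Sum>y\<in>{y \<in> pverts H. edge H x y}. ?f H x y"])
  finally show ?thesis unfolding graph_invariant_def using bij_betw_same_card[OF g(1)] by simp
qed

context adjacency
begin

text \<open>Counting excludes a colouring, as colour classes have at most \<open>a\<close> vertices.
  After a deletion only the class of the deleted vertex matters, so one cover per class is
  enough.\<close>

lemma critical_if_covers:
  assumes W: "weighted_expansion E V B cl n" and sb: "stable_bound B [0..<length B] a" "a * q < sum_list n"
    and sts: "list_all (stable_in B) sts"
    and cov: "\<And>i. i < length B \<Longrightarrow> cover a' sts ord q (deduct [i] n)"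
  shows "critical E q V"
  unfolding critical_def
proof (intro conjI allI impI)
  note w = weighted_expansionD[OF W]
  show "\<not> colourable E q V"
  proof
    assume "colourable E q V"
    then obtain c where c: "colouring E q V c" unfolding colourable_def by blast
    have "card V \<le> a * q"
      by (rule card_le_if_stable_bound[OF w(2,1,3) subset_refl _ c sb(1)])
        (use expansion_ofD(1)[OF w(2)] in auto)
    then show False using sb(2) card_weighted_expansion[OF W] by simp
  qed
  fix U assume "U \<subset> V"
  then obtain x where x: "x \<in> V" "x \<notin> U" and U: "U \<subseteq> V" by blast
  have i: "cl x < length B" by (rule expansion_ofD(1)[OF w(2) x(1)])
  show "colourable E q U"
  proof (rule colourable_if_cover[OF w(2,1) sts U _ _ cov[OF i]])
    show "length (deduct [cl x] n) = length B" using w(4) unfolding deduct_def by simp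
    fix j assume j: "j < length B"
    have fin: "finite {y \<in> V. cl y = j}" using w(1) by simp
    have "card {y \<in> U. cl y = j} \<le> card {y \<in> V. cl y = j}"
      by (rule card_mono[OF fin]) (use U in blast)
    moreover have "card {y \<in> U. cl y = j} < card {y \<in> V. cl y = j}" if "j = cl x"
      by (rule psubset_card_mono[OF fin]) (use U x that in blast)
    ultimately show "card {y \<in> U. cl y = j} \<le> deduct [cl x] n ! j"
      using w(5)[OF j] w(4) j unfolding deduct_def by auto
  qed
qed

text \<open>By twin-freeness the vertices of an induced copy lie in different classes, so the copy
  projects to an induced copy in \<open>B\<close>, which the exhaustive search would find.\<close>

lemma not_contains_if_not_embeddable:
  assumes exp: "expansion_of E V B cl" and C: "twin_free C" and no: "\<not> embeddable B C (length C) [] [0..<length B]"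
  shows "\<not> contains E V C"
proof
  assume "contains E V C"
  then obtain f where f: "embeds E V C f" unfolding contains_def by blast
  let ?g = "\<lambda>i. cl (f i)"
  have V: "f i \<in> V" if "i < length C" for i by (rule embedsD(2)[OF f that])
  have ne: "f i \<noteq> f j" if "i < length C" "j < length C" "i \<noteq> j" for i j
    using embedsD(1)[OF f] that unfolding inj_on_def by blast
  have inj: "?g i \<noteq> ?g j" if ij: "i < length C" "j < length C" "i \<noteq> j" for i j
  proof
    assume eq: "?g i = ?g j"
    then have "E (f i) (f j)" using expansion_ofD(2)[OF exp V[OF ij(1)] V[OF ij(2)]] ne[OF ij] by simp
    then have "j \<in> set (C ! i)" using embedsD(3)[OF f ij(1,2)] by simp
    moreover have m: "i \<in> set [0..<length C]" "j \<in> set [0..<length C]" using ij by simp_all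
    ultimately have "\<exists>k<length C. k \<noteq> i \<and> k \<noteq> j \<and> (k \<in> set (C ! i)) \<noteq> (k \<in> set (C ! j))"
      using bspec[OF bspec[OF C[unfolded twin_free_def list_all_iff] m(1)] m(2)] ij(3)
      by (auto simp: list_ex_iff)
    then obtain k where k: "k < length C" "k \<noteq> i" "k \<noteq> j" "(k \<in> set (C ! i)) \<noteq> (k \<in> set (C ! j))"
      by blast
    have "E (f i) (f k) \<longleftrightarrow> E (f j) (f k)"
      using expansion_ofD(2)[OF exp V[OF ij(1)] V[OF k(1)]] expansion_ofD(2)[OF exp V[OF ij(2)] V[OF k(1)]]
        ne[OF ij(1) k(1)] ne[OF ij(2) k(1)] k(2,3) eq by auto
    then show False using embedsD(3)[OF f ij(1) k(1)] embedsD(3)[OF f ij(2) k(1)] k(4) by simp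
  qed
  have adj: "?g j \<in> set (B ! ?g i) \<longleftrightarrow> j \<in> set (C ! i)" if ij: "i < length C" "j < length C" "i \<noteq> j" for i j
    using expansion_ofD(2)[OF exp V[OF ij(1)] V[OF ij(2)]] ne[OF ij] inj[OF ij] embedsD(3)[OF f ij(1,2)] by simp
  \<comment> \<open>\<open>m\<close> counts the vertices still to be placed: the induction runs from
    the complete copy back to the empty one.\<close>
  have "embeddable B C m (map ?g [0..<length C - m]) [0..<length B]" if "m \<le> length C" for m
    using that
  proof (induction m)
    case (Suc m)
    let ?k = "length C - Suc m"
    have k: "?k < length C" "length C - m = Suc ?k" using Suc.prems by auto
    have "embeddable B C m (map ?g [0..<?k] @ [?g ?k]) [0..<length B]" using Suc.IH Suc.prems unfolding k(2) by simp
    moreover have "?g ?k \<notin> set (map ?g [0..<?k])"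
    proof
      assume "?g ?k \<in> set (map ?g [0..<?k])"
      then obtain i where "i < ?k" "?g i = ?g ?k" by auto
      then show False using inj[of ?k i] k(1) by simp
    qed
    moreover have "\<forall>j<?k. ?g ?k \<in> set (B ! ?g j) \<longleftrightarrow> ?k \<in> set (C ! j)" using adj[of _ ?k] k(1) by auto
    moreover have "?g ?k < length B" by (rule expansion_ofD(1)[OF exp V[OF k(1)]])
    ultimately show ?case
      by (intro embeddable_Suc[of "?g ?k"]) (auto simp: extends_embedding_def list_all_iff)
  qed simp
  from this[of "length C"] show False using no by simp
qed

end

lemma expansion_relabel:
  assumes exp: "expansion_of E V B cl" and p: "automorphism B p"
  obtains cl' where "expansion_of E V B cl'"
    "\<And>i. i < length B \<Longrightarrow> {x \<in> V. cl' x = i} = {x \<in> V. cl x = p ! i}"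
proof -
  let ?n = "length B"
  have len: "length p = ?n" and dist: "distinct p" and lt: "\<And>i. i < ?n \<Longrightarrow> p ! i < ?n"
    and adj: "\<And>i j. i < ?n \<Longrightarrow> j < ?n \<Longrightarrow> j \<in> set (B ! i) \<longleftrightarrow> p ! j \<in> set (B ! (p ! i))"
    using p unfolding automorphism_def list_all_iff by auto
  have "set p \<subseteq> {..<?n}" using lt len by (auto simp: in_set_conv_nth)
  then have "set p = {..<?n}" using distinct_card[OF dist] len by (intro card_subset_eq) auto
  then have ex: "\<exists>i. i < ?n \<and> p ! i = j" if "j < ?n" for j using that len by (metis in_set_conv_nth lessThan_iff)
  \<comment> \<open>\<open>r\<close> is the inverse of \<open>p\<close>, so that class
    \<open>i\<close> of the new labelling is class \<open>p ! i\<close> of the old one.\<close>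
  define r where "r j = (SOME i. i < ?n \<and> p ! i = j)" for j
  have r: "r j < ?n" "p ! r j = j" if "j < ?n" for j using someI_ex[OF ex[OF that]] unfolding r_def by auto
  have r_eq: "r j = i \<longleftrightarrow> j = p ! i" if "j < ?n" "i < ?n" for i j
    using r[OF that(1)] dist len that(2) by (metis nth_eq_iff_index_eq)
  have clV: "cl x < ?n" if "x \<in> V" for x by (rule expansion_ofD(1)[OF exp that])
  have classes: "{x \<in> V. r (cl x) = i} = {x \<in> V. cl x = p ! i}" if "i < ?n" for i
    using r_eq[OF clV that] by auto
  have "expansion_of E V B (\<lambda>x. r (cl x))"
    unfolding expansion_of_def
  proof (intro conjI ballI allI impI)
    show "r (cl x) < ?n" if "x \<in> V" for x by (rule r(1)[OF clV[OF that]])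
    show "\<exists>x\<in>V. r (cl x) = i" if "i < ?n" for i
      using classes[OF that] exp lt[OF that] unfolding expansion_of_def by blast
    show "E x y \<longleftrightarrow> x \<noteq> y \<and> (r (cl x) = r (cl y) \<or> r (cl y) \<in> set (B ! r (cl x)))" if xy: "x \<in> V" "y \<in> V" for x y
    proof -
      have "r (cl y) \<in> set (B ! r (cl x)) \<longleftrightarrow> cl y \<in> set (B ! cl x)"
        using adj[OF r(1)[OF clV[OF xy(1)]] r(1)[OF clV[OF xy(2)]]] r(2)[OF clV[OF xy(1)]] r(2)[OF clV[OF xy(2)]]
        by simp
      moreover have "r (cl x) = r (cl y) \<longleftrightarrow> cl x = cl y"
        using r(2)[OF clV[OF xy(1)]] r(2)[OF clV[OF xy(2)]] by metis
      ultimately show ?thesis using expansion_ofD(2)[OF exp xy] by simp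
    qed
  qed
  then show ?thesis using that classes by blast
qed

text \<open>Any bijections between classes of equal size can be combined, because adjacency of
  distinct vertices depends only on their classes.\<close>

lemma digraph_iso_if_weighted_expansion:
  assumes G: "pair_graph G" "weighted_expansion (edge G) (pverts G) B cl n"
    and H: "pair_graph H" "weighted_expansion (edge H) (pverts H) B cl' n"
  shows "digraph_iso (with_proj G) (with_proj H)"
proof -
  interpret G: pair_graph G by (rule G)
  interpret H: pair_graph H by (rule H)
  note w = weighted_expansionD[OF G(2)] and w' = weighted_expansionD[OF H(2)]
  have "\<exists>h. bij_betw h {x \<in> pverts G. cl x = i} {x \<in> pverts H. cl' x = i}" if "i < length B" for i
    by (rule finite_same_card_bij) (use w(1) w'(1) w(5)[OF that] w'(5)[OF that] in auto)
  then obtain h where h: "\<And>i. i < length B \<Longrightarrow> bij_betw (h i) {x \<in> pverts G. cl x = i} {x \<in> pverts H. cl' x = i}"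
    by metis
  define g where "g x = h (cl x) x" for x
  have clG: "cl x < length B" if "x \<in> pverts G" for x by (rule expansion_ofD(1)[OF w(2) that])
  have gH: "g x \<in> pverts H" "cl' (g x) = cl x" if "x \<in> pverts G" for x
    using bij_betwE[OF h[OF clG[OF that]]] that unfolding g_def by auto
  have inj: "inj_on g (pverts G)"
  proof (rule inj_onI)
    fix x y assume xy: "x \<in> pverts G" "y \<in> pverts G" "g x = g y"
    then have eq: "cl x = cl y" using gH(2)[OF xy(1)] gH(2)[OF xy(2)] by simp
    show "x = y"
      by (rule inj_onD[OF bij_betw_imp_inj_on[OF h[OF clG[OF xy(1)]]]])
        (use xy eq in \<open>auto simp: g_def\<close>)
  qed
  show ?thesis
  proof (rule digraph_isoI[of _ _ g])
    show "pair_wf_digraph G" "pair_wf_digraph H" by unfold_locales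
    have "y \<in> g ` pverts G" if y: "y \<in> pverts H" for y
    proof -
      have "cl' y < length B" by (rule expansion_ofD(1)[OF w'(2) y])
      then have "h (cl' y) ` {x \<in> pverts G. cl x = cl' y} = {x \<in> pverts H. cl' x = cl' y}"
        by (rule bij_betw_imp_surj_on[OF h])
      moreover have "y \<in> {x \<in> pverts H. cl' x = cl' y}" using y by simp
      ultimately have "y \<in> h (cl' y) ` {x \<in> pverts G. cl x = cl' y}" by simp
      then obtain x where x: "x \<in> pverts G" "cl x = cl' y" "h (cl' y) x = y" by auto
      then have "g x = y" unfolding g_def by simp
      then show ?thesis using x(1) by blast
    qed
    then show "bij_betw g (pverts G) (pverts H)" unfolding bij_betw_def using inj gH(1) by blast
    fix u v assume uv: "u \<in> pverts G" "v \<in> pverts G"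
    then have "g u = g v \<longleftrightarrow> u = v" using inj unfolding inj_on_def by blast
    then show "(u, v) \<in> parcs G \<longleftrightarrow> (g u, g v) \<in> parcs H"
      using expansion_ofD(2)[OF w(2) uv] expansion_ofD(2)[OF w'(2) gH(1)[OF uv(1)] gH(1)[OF uv(2)]]
        gH(2)[OF uv(1)] gH(2)[OF uv(2)]
      unfolding edge_def by simp
  qed
qed

section \<open>The listed graphs as weighted expansions\<close>

definition symmetric_pattern :: "pattern \<Rightarrow> bool" where
  "symmetric_pattern B \<longleftrightarrow> list_all (\<lambda>i. list_all (\<lambda>j. j \<in> set (B ! i) \<longleftrightarrow> i \<in> set (B ! j))
     [0..<length B]) [0..<length B]"

lemma checks_symmetric: "symmetric_pattern cycle5" "symmetric_pattern pattern_G7"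
  by code_simp+

lemma clique_expansion_weighted:
  fixes H B n
  defines "X \<equiv> clique_expansion H (\<lambda>v. n ! (v - 1))"
  assumes H: "represents H B" and B: "loopless B" "symmetric_pattern B"
    and n: "length n = length B" "list_all (\<lambda>x. x \<noteq> 0) n"
  shows "pair_graph X" "weighted_expansion (edge X) (pverts X) B (\<lambda>x. fst x - 1) n"
proof -
  let ?m = "length B"
  have Hv: "pverts H = Suc ` {..<?m}"
    and Ha: "\<And>i j. i < ?m \<Longrightarrow> j < ?m \<Longrightarrow> (Suc i, Suc j) \<in> parcs H \<longleftrightarrow> j \<in> set (B ! i)"
    using H unfolding represents_def by auto
  have sym: "j \<in> set (B ! i) \<longleftrightarrow> i \<in> set (B ! j)" if "i < ?m" "j < ?m" for i j
    using B(2) that unfolding symmetric_pattern_def list_all_iff by auto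
  have V: "pverts X = (SIGMA v : Suc ` {..<?m}. {..<n ! (v - 1)})"
    unfolding X_def clique_expansion_def Let_def Hv by simp
  have arcs: "(x, y) \<in> parcs X \<longleftrightarrow> x \<in> pverts X \<and> y \<in> pverts X \<and> x \<noteq> y \<and>
      (fst x - 1 = fst y - 1 \<or> fst y - 1 \<in> set (B ! (fst x - 1)))" for x y
  proof -
    obtain u i v j where xy: "x = (u, i)" "y = (v, j)" by (cases x, cases y)
    have *: "(x, y) \<in> parcs X \<longleftrightarrow> x \<in> pverts X \<and> y \<in> pverts X \<and> (if u = v then i \<noteq> j else (u, v) \<in> parcs H)"
      unfolding X_def clique_expansion_def Let_def xy by simp
    show ?thesis
    proof (cases "x \<in> pverts X \<and> y \<in> pverts X")
      case True
      then obtain a b where ab: "u = Suc a" "v = Suc b" "a < ?m" "b < ?m" unfolding V xy by auto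
      have "b \<noteq> a \<or> b \<notin> set (B ! a)" using B(1) ab(3) unfolding loopless_iff by blast
      then show ?thesis using * True Ha[OF ab(3,4)] unfolding xy ab by auto
    next
      case False
      then show ?thesis using * by blast
    qed
  qed
  have finV: "finite (pverts X)" unfolding V by (intro finite_SigmaI) auto
  have "parcs X \<subseteq> pverts X \<times> pverts X" using arcs by auto
  then have finA: "finite (parcs X)" using finV finite_subset by blast
  have range: "fst x - 1 < ?m" if "x \<in> pverts X" for x using that unfolding V by auto
  show "pair_graph X"
  proof
    show "fst e \<in> pverts X" if "e \<in> parcs X" for e using that arcs[of "fst e" "snd e"] by simp
    show "snd e \<in> pverts X" if "e \<in> parcs X" for e using that arcs[of "fst e" "snd e"] by simp
    show "finite (pverts X)" "finite (parcs X)" by (rule finV, rule finA)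
    show "fst e \<noteq> snd e" if "e \<in> parcs X" for e using that arcs[of "fst e" "snd e"] by simp
    have "(y, x) \<in> parcs X" if "(x, y) \<in> parcs X" for x y
      using that sym[of "fst y - 1" "fst x - 1"] range[of x] range[of y] unfolding arcs by auto
    then show "symmetric (with_proj X)" unfolding symmetric_def by (auto intro: symI)
  qed
  show "weighted_expansion (edge X) (pverts X) B (\<lambda>x. fst x - 1) n"
    unfolding weighted_expansion_def expansion_of_def
  proof (intro conjI ballI allI impI)
    show "finite (pverts X)" "loopless B" "length n = ?m" by (rule finV, rule B, rule n)
    show "fst x - 1 < ?m" if "x \<in> pverts X" for x by (rule range[OF that])
    show "\<exists>x\<in>pverts X. fst x - 1 = i" if i: "i < ?m" for i
    proof
      have "n ! i \<noteq> 0" using n i by (simp add: list_all_length)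
      then show "(Suc i, 0) \<in> pverts X" using i unfolding V by auto
    qed simp
    show "edge X x y \<longleftrightarrow> x \<noteq> y \<and> (fst x - 1 = fst y - 1 \<or> fst y - 1 \<in> set (B ! (fst x - 1)))"
      if "x \<in> pverts X" "y \<in> pverts X" for x y
      using that unfolding edge_def arcs by blast
    show "card {x \<in> pverts X. fst x - 1 = i} = n ! i" if "i < ?m" for i
    proof -
      have "{x \<in> pverts X. fst x - 1 = i} = Pair (Suc i) ` {..<n ! i}" using that unfolding V by auto
      then show ?thesis by (simp add: card_image inj_on_def)
    qed
  qed
qed

text \<open>\<open>K\<^sub>7\<close> is treated as the expansion of a single vertex, which puts all
  46 graphs into one form. The order is that of \<open>critical_graphs\<close>, so distinct
  positions can be compared by their invariants.\<close>

definition expansion_data :: "(pattern \<times> nat list) list" where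
  "expansion_data = ([[]], [7]) # map (Pair cycle5) critical_weights_cycle5 @
     map (Pair pattern_G7) critical_weights_G7"

lemma clique_weighted_expansion:
  assumes "adjacency E" "finite V" "clique E V" "V \<noteq> {}"
  shows "weighted_expansion E V [[]] (\<lambda>_. 0) [card V]"
proof -
  interpret adjacency E by fact
  show ?thesis
    using assms checks_single(1) irrefl
    unfolding weighted_expansion_def expansion_of_def clique_def by auto
qed

lemma critical_graphs_eq:
  "critical_graphs = complete_graph_on ({0} \<times> {..<7}) # map G1_expansion critical_weights_cycle5 @
     map G7_expansion critical_weights_G7"
  unfolding critical_graphs_def critical_weights_cycle5_def critical_weights_G7_def by (rule refl)

lemma critical_graphs_expansions:
  "list_all2 (\<lambda>H (B, n). pair_graph H \<and> (\<exists>cl. weighted_expansion (edge H) (pverts H) B cl n))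
     critical_graphs expansion_data"
proof -
  let ?K = "complete_graph_on ({0 :: nat} \<times> {..<7 :: nat})"
  have K: "pair_graph ?K"
    by unfold_locales
      (auto simp: complete_graph_on_def symmetric_def sym_def intro: finite_subset[of _ "({0} \<times> {..<7}) \<times> ({0} \<times> {..<7})"])
  have "weighted_expansion (edge ?K) (pverts ?K) [[]] (\<lambda>_. 0) [card (pverts ?K)]"
    by (rule clique_weighted_expansion[OF adjacency_edge[OF K]])
      (auto simp: complete_graph_on_def clique_def edge_def lessThan_empty_iff)
  moreover have "card (pverts ?K) = 7" by (simp add: complete_graph_on_def)
  ultimately have K': "weighted_expansion (edge ?K) (pverts ?K) [[]] (\<lambda>_. 0) [7]" by simp
  have n5: "length n = length cycle5" "list_all (\<lambda>x. x \<noteq> 0) n" if "n \<in> set critical_weights_cycle5" for n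
    using weights_cycle5_vertex_deleted that unfolding list_all_iff by (auto simp: cycle5_def)
  have n7: "length n = length pattern_G7" "list_all (\<lambda>x. x \<noteq> 0) n" if "n \<in> set critical_weights_G7" for n
    using weights_G7_vertex_deleted that unfolding list_all_iff by (auto simp: pattern_G7_def)
  have 5: "pair_graph (G1_expansion n) \<and> (\<exists>cl. weighted_expansion (edge (G1_expansion n)) (pverts (G1_expansion n)) cycle5 cl n)"
    if "n \<in> set critical_weights_cycle5" for n
    unfolding G1_expansion_def
    using clique_expansion_weighted[OF represents_G1 checks_cycle5(3) checks_symmetric(1) n5[OF that]] by blast
  have 7: "pair_graph (G7_expansion n) \<and> (\<exists>cl. weighted_expansion (edge (G7_expansion n)) (pverts (G7_expansion n)) pattern_G7 cl n)"
    if "n \<in> set critical_weights_G7" for n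
    unfolding G7_expansion_def
    using clique_expansion_weighted[OF represents_G7 checks_G7(3) checks_symmetric(2) n7[OF that]] by blast
  let ?R = "\<lambda>H (B, n). pair_graph H \<and> (\<exists>cl. weighted_expansion (edge H) (pverts H) B cl n)"
  have "list_all2 ?R (map G1_expansion critical_weights_cycle5) (map (Pair cycle5) critical_weights_cycle5)"
    unfolding list_all2_map1 list_all2_map2 by (rule list.rel_refl_strong) (use 5 in simp)
  moreover have "list_all2 ?R (map G7_expansion critical_weights_G7) (map (Pair pattern_G7) critical_weights_G7)"
    unfolding list_all2_map1 list_all2_map2 by (rule list.rel_refl_strong) (use 7 in simp)
  ultimately have "list_all2 ?R (map G1_expansion critical_weights_cycle5 @ map G7_expansion critical_weights_G7)
      (map (Pair cycle5) critical_weights_cycle5 @ map (Pair pattern_G7) critical_weights_G7)"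
    by (rule list_all2_appendI)
  moreover have "?R ?K ([[]], [7])" using K K' by auto
  ultimately show ?thesis
    unfolding critical_graphs_eq expansion_data_def list_all2_Cons by (intro conjI)
qed

context adjacency
begin

lemma expansion_data_critical:
  assumes d: "(B, n) \<in> set expansion_data" and W: "weighted_expansion E V B cl n"
  shows "critical E 6 V" "\<not> contains E V path5" "\<not> contains E V gem_pattern"
proof -
  note exp = weighted_expansionD(2)[OF W]
  have len: "length path5 = 5" "length gem_pattern = 5" by (simp_all add: path5_def gem_pattern_def)
  consider "B = [[]]" "n = [7]" | "B = cycle5" "n \<in> set critical_weights_cycle5"
    | "B = pattern_G7" "n \<in> set critical_weights_G7"
    using d unfolding expansion_data_def by auto
  then have "critical E 6 V \<and> \<not> contains E V path5 \<and> \<not> contains E V gem_pattern"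
  proof cases
    case 1
    have "critical E 6 V"
      by (rule critical_if_covers[OF W[unfolded 1], where a = 1 and a' = 1 and sts = "[[0]]" and ord = "[0]"])
        (use checks_single in auto)
    then show ?thesis
      using not_contains_if_not_embeddable[OF exp[unfolded 1]] checks_embeddable len by simp
  next
    case 2
    have l: "length cycle5 = 5" by (simp add: cycle5_def)
    have n: "sum_list n = 13" "\<And>i. i < 5 \<Longrightarrow> cover 2 stable_cycle5 [0..<5] 6 (deduct [i] n)"
      using weights_cycle5_vertex_deleted 2(2) unfolding list_all_iff by auto
    have "critical E 6 V"
      by (rule critical_if_covers[OF W[unfolded 2(1)], where a = 2 and a' = 2 and sts = stable_cycle5 and ord = "[0..<5]"])
        (use checks_cycle5 n l in auto)
    then show ?thesis
      using not_contains_if_not_embeddable[OF exp[unfolded 2(1)]] checks_embeddable len by simp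
  next
    case 3
    have l: "length pattern_G7 = 8" by (simp add: pattern_G7_def)
    have n: "sum_list n = 19" "\<And>i. i < 8 \<Longrightarrow> cover 3 stable_G7 order_G7 6 (deduct [i] n)"
      using weights_G7_vertex_deleted 3(2) unfolding list_all_iff by auto
    have "critical E 6 V"
      by (rule critical_if_covers[OF W[unfolded 3(1)], where a = 3 and a' = 3 and sts = stable_G7 and ord = order_G7])
        (use checks_G7 n l in auto)
    then show ?thesis
      using not_contains_if_not_embeddable[OF exp[unfolded 3(1)]] checks_embeddable checks_embeddable_G7 len by simp
  qed
  then show "critical E 6 V" "\<not> contains E V path5" "\<not> contains E V gem_pattern" by auto
qed

lemma expansion_data_if_critical:
  assumes crit: "critical E 6 V" and fin: "finite V" and P5: "\<not> contains E V path5"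
    and gem: "\<not> contains E V gem_pattern"
  shows "\<exists>B n cl. (B, n) \<in> set expansion_data \<and> weighted_expansion E V B cl n"
proof -
  have relabel: "\<exists>n cl'. n \<in> set N \<and> weighted_expansion E V B cl' n"
    if ce: "critical_expansion E V 6 B cl" and p: "p \<in> set P" "list_all (automorphism B) P"
      "map (\<lambda>i. card {x \<in> V. cl x = i}) p \<in> set N" and B: "loopless B" for B cl p P N
  proof -
    have aut: "automorphism B p" using p(1,2) unfolding list_all_iff by blast
    obtain cl' where cl': "expansion_of E V B cl'"
      "\<And>i. i < length B \<Longrightarrow> {x \<in> V. cl' x = i} = {x \<in> V. cl x = p ! i}"
      using expansion_relabel[OF critical_expansion.exp[OF ce] aut] by blast
    have "length p = length B" using aut unfolding automorphism_def by blast
    then have "weighted_expansion E V B cl' (map (\<lambda>i. card {x \<in> V. cl x = i}) p)"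
      unfolding weighted_expansion_def using fin cl' B by simp
    then show ?thesis using p(3) by blast
  qed
  consider "clique E V" | cl where "critical_expansion E V 6 cycle5 cl"
    | cl where "critical_expansion E V 6 pattern_G7 cl"
    using critical_structure[OF crit fin P5 gem] by blast
  then show ?thesis
  proof cases
    case 1
    have ne: "V \<noteq> {}" using crit unfolding critical_def colourable_def colouring_def by auto
    then obtain x where x: "x \<in> V" by blast
    have "V - {x} \<subset> V" using x by blast
    then obtain c where c: "colouring E 6 (V - {x}) c" using crit unfolding critical_def colourable_def by blast
    have "card (V - {x}) \<le> 6" by (rule colouring_clique_le[OF c clique_subset[OF 1]]) auto
    then have le: "card V \<le> 7" using x fin by simp
    have "\<not> card V \<le> 6"
    proof
      assume "card V \<le> 6"
      then have "colourable E 6 ({} \<union> V)"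
        by (intro extend_colouring[where N = "{}" and c = "\<lambda>_. 0"]) (use fin in \<open>auto simp: colouring_def\<close>)
      then show False using crit unfolding critical_def by simp
    qed
    then have "card V = 7" using le by simp
    then have "weighted_expansion E V [[]] (\<lambda>_. 0) [7]"
      using clique_weighted_expansion[OF adjacency_axioms fin 1 ne] by simp
    moreover have "([[]], [7]) \<in> set expansion_data" unfolding expansion_data_def by simp
    ultimately show ?thesis by blast
  next
    case 2
    obtain p where "p \<in> set aut_cycle5" "map (\<lambda>i. card {x \<in> V. cl x = i}) p \<in> set critical_weights_cycle5"
      using critical_weights_if_critical_cycle5[OF 2] by blast
    from relabel[OF 2 this(1) checks_cycle5(2) this(2) checks_cycle5(3)]
    show ?thesis unfolding expansion_data_def by auto
  next
    case 3
    obtain p where "p \<in> set aut_G7" "map (\<lambda>i. card {x \<in> V. cl x = i}) p \<in> set critical_weights_G7"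
      using critical_weights_if_critical_G7[OF 3] by blast
    from relabel[OF 3 this(1) checks_G7(2) this(2) checks_G7(3)]
    show ?thesis unfolding expansion_data_def by auto
  qed
qed

end

lemma pair_graph_wf: "pair_graph G \<Longrightarrow> pair_wf_digraph G"
  unfolding pair_graph_def pair_digraph_def pair_fin_digraph_def by blast

lemma critical_graphs_nth:
  assumes "i < length critical_graphs"
  obtains B n cl where "expansion_data ! i = (B, n)" "pair_graph (critical_graphs ! i)"
    "weighted_expansion (edge (critical_graphs ! i)) (pverts (critical_graphs ! i)) B cl n"
  using list_all2_nthD[OF critical_graphs_expansions assms] by (cases "expansion_data ! i") auto

lemma length_critical_graphs: "length critical_graphs = 46"
  unfolding critical_graphs_def by simp

lemma length_expansion_data: "length expansion_data = 46"
  using list_all2_lengthD[OF critical_graphs_expansions] length_critical_graphs by simp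

theorem mainTheorem4:
  shows "length critical_graphs = 46 \<and>
    (\<forall>H \<in> set critical_graphs. pair_graph H \<and> vertex_critical 7 H \<and> P5_gem_free H) \<and>
    (\<forall>i < 46. \<forall>j < 46. i \<noteq> j \<longrightarrow> \<not> digraph_iso (critical_graphs ! i) (critical_graphs ! j)) \<and>
    (\<forall>G :: 'a pair_pre_digraph.
       pair_graph G \<and> vertex_critical 7 G \<and> P5_gem_free G \<longrightarrow>
       (\<exists>H \<in> set critical_graphs. digraph_iso G H))"
proof (intro conjI ballI allI impI)
  show "length critical_graphs = 46" by (rule length_critical_graphs)
next
  fix H assume "H \<in> set critical_graphs"
  then obtain i where i: "i < length critical_graphs" "H = critical_graphs ! i" by (metis in_set_conv_nth)
  obtain B n cl where d: "expansion_data ! i = (B, n)" and H: "pair_graph H"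
    and W: "weighted_expansion (edge H) (pverts H) B cl n"
    using critical_graphs_nth[OF i(1)] unfolding i(2) by metis
  have "(B, n) \<in> set expansion_data"
    using d i(1) length_critical_graphs length_expansion_data by (metis nth_mem)
  note * = adjacency.expansion_data_critical[OF adjacency_edge[OF H] this W]
  show "pair_graph H" by (rule H)
  show "vertex_critical 7 (with_proj H)" using vertex_critical_iff[OF H, of 6] *(1) by simp
  show "P5_gem_free (with_proj H)" using P5_gem_free_iff[OF pair_graph_wf[OF H]] *(2,3) by simp
next
  fix i j :: nat assume ij: "i < 46" "j < 46" "i \<noteq> j"
  let ?inv = "\<lambda>(B, n). (sum_list n, degree_product_sum B n)"
  have inv: "graph_invariant (edge (critical_graphs ! k)) (pverts (critical_graphs ! k)) = ?inv (expansion_data ! k)"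
    if "k < 46" for k
  proof -
    have "k < length critical_graphs" using that length_critical_graphs by simp
    then obtain B n cl where "expansion_data ! k = (B, n)" "pair_graph (critical_graphs ! k)"
      "weighted_expansion (edge (critical_graphs ! k)) (pverts (critical_graphs ! k)) B cl n"
      by (rule critical_graphs_nth)
    then show ?thesis using graph_invariant_weighted_expansion[OF _ adjacency_edge] by simp
  qed
  have "distinct (map ?inv expansion_data)" using invariants_distinct unfolding expansion_data_def .
  then have "?inv (expansion_data ! i) \<noteq> ?inv (expansion_data ! j)"
    using ij length_expansion_data nth_eq_iff_index_eq[of "map ?inv expansion_data" i j] by simp
  moreover have "pair_wf_digraph (critical_graphs ! i)"
  proof -
    have "i < length critical_graphs" using ij(1) length_critical_graphs by simp
    then show ?thesis by (rule critical_graphs_nth) (rule pair_graph_wf)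
  qed
  ultimately show "\<not> digraph_iso (with_proj (critical_graphs ! i)) (with_proj (critical_graphs ! j))"
    using graph_invariant_iso[of "critical_graphs ! i" "critical_graphs ! j"] inv[OF ij(1)] inv[OF ij(2)]
    by auto
next
  fix G :: "'a pair_pre_digraph"
  assume "pair_graph G \<and> vertex_critical 7 (with_proj G) \<and> P5_gem_free (with_proj G)"
  then have G: "pair_graph G" and crit: "critical (edge G) 6 (pverts G)"
    and free: "\<not> contains (edge G) (pverts G) path5" "\<not> contains (edge G) (pverts G) gem_pattern"
    using vertex_critical_iff[of G 6] P5_gem_free_iff[OF pair_graph_wf] by auto
  interpret G: pair_graph G by (rule G)
  obtain B n cl where d: "(B, n) \<in> set expansion_data" and W: "weighted_expansion (edge G) (pverts G) B cl n"
    using adjacency.expansion_data_if_critical[OF adjacency_edge[OF G] crit G.pair_finite_verts free] by blast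
  obtain i where i: "i < 46" "expansion_data ! i = (B, n)"
    using d length_expansion_data by (metis in_set_conv_nth)
  have il: "i < length critical_graphs" using i(1) length_critical_graphs by simp
  obtain cl' where H: "pair_graph (critical_graphs ! i)"
    "weighted_expansion (edge (critical_graphs ! i)) (pverts (critical_graphs ! i)) B cl' n"
    using critical_graphs_nth[OF il] i(2) by (metis Pair_inject)
  have "digraph_iso (with_proj G) (with_proj (critical_graphs ! i))"
    by (rule digraph_iso_if_weighted_expansion[OF G W H])
  then show "\<exists>H\<in>set critical_graphs. digraph_iso (with_proj G) (with_proj H)"
    using il nth_mem by blast
qed

end
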